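(* Let $f\in\mathcal G$ have compact support, and suppose that the Mellin transform $\hat f(s)$ has no zeros in the strip $1/2<\Re s<1$. Then the Riemann hypothesis holds if and only if $f$ belongs to the closure in $L_2(0,\infty)$ of $\mathcal B(Pf)$.
   Context: A good kernel is a continuously differentiable function $f:[0,\infty)\to\mathbb C$ with $f(x)\to0$ as $x\to\infty$, $f\in L_1(0,\infty)$, and $\int_0^\infty t|f'(t)|\,dt<\infty$; $\mathcal G$ denotes the class of good kernels. For $f\in\mathcal G$ the Müntz operator is $Pf(x):=\sum_{n=1}^\infty f(nx)-\frac1x\int_0^\infty f(t)\,dt$, defined for a.e. $x>0$. For $\lambda>0$, $K_\lambda g(x):=g(\lambda x)$. $\mathcal B(g)$ is the linear span of $\{K_n g:n\in\mathbb N\}$. The Mellin transform is $\hat f(s):=\int_0^\infty t^{s-1}f(t)\,dt$. *)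

theory Defs
  imports "HOL-Analysis.Analysis"
begin

definition good_kernel :: "(real \<Rightarrow> complex) \<Rightarrow> bool" where
  "good_kernel f \<longleftrightarrow>
     (\<exists>f'. (\<forall>x\<ge>0. (f has_vector_derivative f' x) (at x within {0..}))
         \<and> continuous_on {0..} f'
         \<and> set_integrable lborel {0<..} f
         \<and> (f \<longlongrightarrow> 0) at_top
         \<and> set_nn_integral lborel {0<..} (\<lambda>t. ennreal (t * norm (f' t))) < \<infinity>)"

text \<open>The Muentz operator (the series is meaningful for a.e. x > 0).\<close>
definition muentz :: "(real \<Rightarrow> complex) \<Rightarrow> real \<Rightarrow> complex" where
  "muentz f x = (\<Sum>n. f (real (Suc n) * x))
      - complex_of_real (1 / x) * set_lebesgue_integral lborel {0<..} f"

definition dilate_span :: "(real \<Rightarrow> complex) \<Rightarrow> (real \<Rightarrow> complex) set" where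
  "dilate_span g = {h. \<exists>N (c :: nat \<Rightarrow> complex).
       h = (\<lambda>x. \<Sum>i<N. c i * g (real (Suc i) * x))}"

definition in_L2_closure :: "(real \<Rightarrow> complex) \<Rightarrow> (real \<Rightarrow> complex) set \<Rightarrow> bool" where
  "in_L2_closure g S \<longleftrightarrow>
     (\<forall>e>0. \<exists>h\<in>S. set_nn_integral lborel {0<..} (\<lambda>x. ennreal ((norm (g x - h x))\<^sup>2)) < ennreal e)"

definition mellin :: "(real \<Rightarrow> complex) \<Rightarrow> complex \<Rightarrow> complex" where
  "mellin f s = set_lebesgue_integral lborel {0<..} (\<lambda>t. (complex_of_real t) powr (s - 1) * f t)"

text \<open>Dirichlet eta function (convergent for Re s > 0) and the Riemann zeta function on
  the half plane Re s > 0, s \<noteq> 1, via zeta(s) = eta(s) / (1 - 2^(1-s)).\<close>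
definition dirichlet_eta :: "complex \<Rightarrow> complex" where
  "dirichlet_eta s = (\<Sum>n. (-1) ^ n / (of_nat (Suc n)) powr s)"

definition riemann_zeta :: "complex \<Rightarrow> complex" where
  "riemann_zeta s = dirichlet_eta s / (1 - 2 powr (1 - s))"

definition riemann_hypothesis :: bool where
  "riemann_hypothesis \<longleftrightarrow>
     (\<forall>s. 0 < Re s \<and> Re s < 1 \<and> riemann_zeta s = 0 \<longrightarrow> Re s = 1/2)"

end

theory Submission
  imports Defs "HOL-Complex_Analysis.Complex_Analysis" "HOL-Probability.Probability"
    "HOL-Real_Asymp.Real_Asymp" "HOL-Number_Theory.Prime_Powers"
begin

text \<open>For $0 < \Re s < 1$ the Mellin transform of $Pf$ is $\zeta(s)\hat f(s)$, so a combination of the dilates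
  $K_nPf$ approximates $f$ with error whose transform is $\hat f(s)(1-\zeta(s)A(s))$, where $A$ is a Dirichlet polynomial.
  If the errors tend to zero in $L_2$, their transforms tend to zero at every $s$ with $1/2 < \Re s < 1$,
  which is impossible at a zero of $\zeta$ unless $\hat f(s)=0$; the functional equation treats the other half of the strip.

  Conversely, by Plancherel's identity on the critical line one needs Dirichlet polynomials $A$ for which
  $1-\zeta A$ is small in the weighted space $L_2(|\hat f|^2\,dt)$, where $|s\hat f(s)|$ is square integrable.
  Under the Riemann hypothesis $\zeta(s)/\zeta(s+\varepsilon)$ tends to $1$ as $\varepsilon\to0$ and is dominated by a multiple of $|s|$:
  the quotient $\xi(s)/\xi(s+\varepsilon)$ has modulus one on the line $\Re s=(1-\varepsilon)/2$, is bounded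
  far to the right, and the Phragmen-Lindelof principle applies in between. For fixed $\varepsilon$, Littlewood's bound
  $1/\zeta(s) = O(|s|^{1/4})$ for $\Re s\ge 1/2+\varepsilon/2$ makes the Taylor series of $1/\zeta$ around $s+3$ converge
  at $s+\varepsilon$ uniformly relative to $|s|^{1/4}$, and near $s+3$ the function $1/\zeta$ is a uniform limit of Dirichlet polynomials.\<close>

section \<open>Logarithmic coordinates and convolution\<close>

text \<open>The weight decides which bounds are good enough. Compact support makes \<open>f'\<close>
  bounded, so s times the transform of f is square integrable on the critical line and errors of
  size |s| are affordable, while more is not guaranteed. Hence the exponents 3/4 (growth of \<zeta>
  on the line) and 1/4 (relative error of the Dirichlet polynomials) are chosen to add up to 1, and
  the quotient of Gamma factors may cost one factor |s|. The domination of
  \<zeta>(s)/\<zeta>(s+\<epsilon>) has to be uniform in \<epsilon>, whereas the constant in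
  Littlewood's bound depends on \<epsilon>; in that argument the bound enters only as the growth
  hypothesis of the Phragmen-Lindelof principle, whose conclusion forgets it. In the other
  direction, every approximation error is a multiple of 1/x beyond the support, which lets its norm
  control its transform to the right of the critical line. The functional equation is drawn from the
  Muentz formula itself, applied to two kernels that are cosine transforms of each other. Zeta
  values are handled through \<open>zeta_reg\<close>, which has no pole.\<close>

lemma exp_substitution_aux:
  fixes g :: "real \<Rightarrow> complex"
  assumes [measurable]: "g \<in> borel_measurable borel"
  shows "set_integrable lborel {0<..} g \<longleftrightarrow> integrable lborel (\<lambda>u. exp u *\<^sub>R g (exp u))"
    and "set_lebesgue_integral lborel {0<..} g = (\<integral>u. exp u *\<^sub>R g (exp u) \<partial>lborel)"
proof -
  have rng: "range (exp :: real \<Rightarrow> real) = {0<..}"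
    by (auto simp: image_iff) (metis exp_ln)
  have main: "(\<lambda>x. \<bar>exp x\<bar> *\<^sub>R g (exp x)) absolutely_integrable_on UNIV \<and>
      integral UNIV (\<lambda>x. \<bar>exp x\<bar> *\<^sub>R g (exp x)) = b \<longleftrightarrow>
      g absolutely_integrable_on range exp \<and> integral (range exp) g = b" for b
    by (rule has_absolute_integral_change_of_variables_real)
       (auto intro!: derivative_eq_intros simp: inj_on_def)
  \<comment> \<open>The change of variables theorem speaks of completed Lebesgue measure;
    \<open>L\<close> and \<open>R\<close> bring it back to \<open>lborel\<close>, for which
    \<open>g\<close> has to be Borel on the whole line.\<close>
  have L: "g absolutely_integrable_on {0<..} \<longleftrightarrow> set_integrable lborel {0<..} g"
    unfolding set_integrable_def by (rule integrable_completion) simp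
  have R: "(\<lambda>x. exp x *\<^sub>R g (exp x)) absolutely_integrable_on UNIV \<longleftrightarrow>
        integrable lborel (\<lambda>u. exp u *\<^sub>R g (exp u))"
    unfolding set_integrable_def by (subst integrable_completion) simp_all
  show iff: "set_integrable lborel {0<..} g \<longleftrightarrow> integrable lborel (\<lambda>u. exp u *\<^sub>R g (exp u))"
    using main[of "integral {0<..} g"] main[of "integral UNIV (\<lambda>x. exp x *\<^sub>R g (exp x))"] rng L R by auto
  show "set_lebesgue_integral lborel {0<..} g = (\<integral>u. exp u *\<^sub>R g (exp u) \<partial>lborel)"
  proof (cases "set_integrable lborel {0<..} g")
    case True
    have "set_lebesgue_integral lborel {0<..} g = integral {0<..} g"
      using True by (rule set_borel_integral_eq_integral)
    also have "\<dots> = integral UNIV (\<lambda>u. exp u *\<^sub>R g (exp u))"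
      using main[of "integral {0<..} g"] rng True L by auto
    also have "\<dots> = (\<integral>u. exp u *\<^sub>R g (exp u) \<partial>lborel)"
      using True iff by (intro integral_lborel) auto
    finally show ?thesis .
  next
    case False
    \<comment> \<open>Neither side is integrable here, and both integrals then have the default
      value 0.\<close>
    then show ?thesis using iff
      by (simp add: set_lebesgue_integral_def set_integrable_def not_integrable_integral_eq)
  qed
qed

text \<open>Truncating \<open>g\<close> to the positive axis makes it Borel everywhere and changes
  neither side, because \<open>exp\<close> takes only positive values.\<close>

lemma exp_substitution:
  fixes g :: "real \<Rightarrow> complex"
  assumes "set_borel_measurable lborel {0<..} g"
  shows "set_integrable lborel {0<..} g \<longleftrightarrow> integrable lborel (\<lambda>u. exp u *\<^sub>R g (exp u))"
    and "set_lebesgue_integral lborel {0<..} g = (\<integral>u. exp u *\<^sub>R g (exp u) \<partial>lborel)"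
proof -
  let ?g = "\<lambda>x. indicator {0<..} x *\<^sub>R g x"
  have m: "?g \<in> borel_measurable borel"
    using assms by (simp add: set_borel_measurable_def)
  have 1: "(\<lambda>x. indicator {0<..} x *\<^sub>R ?g x) = ?g" by (auto simp: indicator_def)
  have 2: "(\<lambda>u. exp u *\<^sub>R ?g (exp u)) = (\<lambda>u. exp u *\<^sub>R g (exp u))" by simp
  show "set_integrable lborel {0<..} g \<longleftrightarrow> integrable lborel (\<lambda>u. exp u *\<^sub>R g (exp u))"
    using exp_substitution_aux(1)[OF m] unfolding set_integrable_def 1 2 .
  show "set_lebesgue_integral lborel {0<..} g = (\<integral>u. exp u *\<^sub>R g (exp u) \<partial>lborel)"
    using exp_substitution_aux(2)[OF m] unfolding set_lebesgue_integral_def 1 2 .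
qed

lemma powr_exp_of_real: "complex_of_real (exp u) powr s = exp (s * of_real u)"
  by (simp add: powr_def Ln_of_real)

lemma set_borel_measurable_mellin:
  assumes "set_borel_measurable lborel {0<..} f"
  shows "set_borel_measurable lborel {0<..} (\<lambda>t. (complex_of_real t) powr s * f t)"
proof -
  have 1: "(\<lambda>t. indicator {0<..} t *\<^sub>R (complex_of_real t powr s)) \<in> borel_measurable borel"
    by (rule borel_measurable_continuous_on_indicator) (auto intro!: continuous_intros)
  have 2: "(\<lambda>t. indicator {0<..} t *\<^sub>R f t) \<in> borel_measurable borel"
    using assms by (simp add: set_borel_measurable_def)
  have "(\<lambda>t. (indicator {0<..} t *\<^sub>R (complex_of_real t powr s)) * (indicator {0<..} t *\<^sub>R f t)) \<in> borel_measurable borel"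
    using 1 2 by measurable
  also have "(\<lambda>t. (indicator {0<..} t *\<^sub>R (complex_of_real t powr s)) * (indicator {0<..} t *\<^sub>R f t))
      = (\<lambda>t. indicator {0<..} t *\<^sub>R ((complex_of_real t) powr s * f t))"
    by (auto simp: indicator_def)
  finally show ?thesis by (simp add: set_borel_measurable_def)
qed

text \<open>With t = exp u the Mellin transform becomes a two-sided Laplace transform, thus a
  Fourier transform on each vertical line, and multiplicative convolutions become additive ones. The
  transforms are evaluated and estimated in the variable u.\<close>

lemma mellin_exp:
  assumes "set_borel_measurable lborel {0<..} f"
  shows "set_integrable lborel {0<..} (\<lambda>t. (complex_of_real t) powr (s - 1) * f t)
           \<longleftrightarrow> integrable lborel (\<lambda>u. exp (s * of_real u) * f (exp u))"
    and "mellin f s = (\<integral>u. exp (s * of_real u) * f (exp u) \<partial>lborel)"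
proof -
  have eq: "exp u *\<^sub>R ((complex_of_real (exp u)) powr (s - 1) * f (exp u)) = exp (s * of_real u) * f (exp u)" for u
    unfolding powr_exp_of_real scaleR_conv_of_real
    by (simp add: algebra_simps exp_diff exp_of_real)
  note * = exp_substitution[OF set_borel_measurable_mellin[OF assms, of "s - 1"], unfolded eq]
  show "set_integrable lborel {0<..} (\<lambda>t. (complex_of_real t) powr (s - 1) * f t)
           \<longleftrightarrow> integrable lborel (\<lambda>u. exp (s * of_real u) * f (exp u))"
    by (rule *(1))
  show "mellin f s = (\<integral>u. exp (s * of_real u) * f (exp u) \<partial>lborel)"
    unfolding mellin_def by (rule *(2))
qed

lemma convolution_integrable_pair:
  fixes a b :: "real \<Rightarrow> complex"
  assumes a: "integrable lborel a" and b: "integrable lborel b"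
  shows "integrable (lborel \<Otimes>\<^sub>M lborel) (\<lambda>(v, u). a v * b (u - v))"
proof -
  have [measurable]: "a \<in> borel_measurable borel" "b \<in> borel_measurable borel"
    using a b by (auto dest: borel_measurable_integrable)
  have sh: "integrable lborel (\<lambda>u. b (u - v))" for v
    using lborel_integrable_real_affine[OF b, of 1 "-v"] by simp
  have sh2: "(\<integral>u. norm (b (u - v)) \<partial>lborel) = (\<integral>u. norm (b u) \<partial>lborel)" for v
    using lborel_integral_real_affine[of 1 "\<lambda>u. norm (b u)" "-v"] by simp
  show ?thesis
  proof (rule lborel_pair.Fubini_integrable)
    show "(\<lambda>(v, u). a v * b (u - v)) \<in> borel_measurable (lborel \<Otimes>\<^sub>M lborel)" by measurable
    show "AE x in lborel. integrable lborel (\<lambda>y. case (x, y) of (v, u) \<Rightarrow> a v * b (u - v))"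
      using sh by auto
    show "integrable lborel (\<lambda>x. LINT y|lborel. norm (case (x, y) of (v, u) \<Rightarrow> a v * b (u - v)))"
      using a by (simp add: norm_mult sh2)
  qed
qed

text \<open>Fubini. Multiplying \<open>a\<close> and \<open>b\<close> by exponentials beforehand
  turns this one case into the product rule for Mellin transforms on a vertical line, and for
  Fourier transforms.\<close>

lemma convolution_integral:
  fixes a b :: "real \<Rightarrow> complex"
  assumes a: "integrable lborel a" and b: "integrable lborel b"
  shows "integrable lborel (\<lambda>u. \<integral>v. a v * b (u - v) \<partial>lborel)"
    and "(\<integral>u. (\<integral>v. a v * b (u - v) \<partial>lborel) \<partial>lborel) = (\<integral>v. a v \<partial>lborel) * (\<integral>w. b w \<partial>lborel)"
proof -
  note P = convolution_integrable_pair[OF assms]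
  show "integrable lborel (\<lambda>u. \<integral>v. a v * b (u - v) \<partial>lborel)"
    using lborel_pair.integrable_snd[OF P] by simp
  have "(\<integral>w. b (w - v) \<partial>lborel) = (\<integral>w. b w \<partial>lborel)" for v
    using lborel_integral_real_affine[of 1 b "-v"] by simp
  then show "(\<integral>u. (\<integral>v. a v * b (u - v) \<partial>lborel) \<partial>lborel) = (\<integral>v. a v \<partial>lborel) * (\<integral>w. b w \<partial>lborel)"
    using lborel_pair.Fubini_integral[OF P] by (simp add: mult.commute)
qed

section \<open>Explicit integrals of exponentials\<close>

lemma exp_has_vector_derivative:
  fixes z :: complex
  assumes "z \<noteq> 0"
  shows "((\<lambda>u. exp (z * of_real u) / z) has_vector_derivative exp (z * of_real x)) (at x within S)"
proof -
  have "((\<lambda>w. exp (z * w) / z) has_field_derivative exp (z * of_real x)) (at (of_real x))"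
    using assms by (auto intro!: derivative_eq_intros)
  then show ?thesis
    by (rule has_vector_derivative_real_field)
qed

lemma integral_exp_Icc:
  fixes z :: complex
  assumes "z \<noteq> 0" "a \<le> b"
  shows "has_bochner_integral lborel (\<lambda>u. indicator {a..b} u *\<^sub>R exp (z * of_real u))
           (exp (z * of_real b) / z - exp (z * of_real a) / z)"
  by (rule has_bochner_integral_FTC_Icc[OF assms(2) exp_has_vector_derivative[OF assms(1)]])
     (intro continuous_intros)

lemma integral_exp_Iic:
  fixes z :: complex
  assumes "Re z > 0"
  shows "has_bochner_integral lborel (\<lambda>u. indicator {..c} u *\<^sub>R exp (z * of_real u))
           (exp (z * of_real c) / z)"
proof -
  have z: "z \<noteq> 0" using assms by auto
  have n: "norm (indicator {..c} u *\<^sub>R exp (z * of_real u)) = indicator {..c} u * exp (Re z * u)" for u :: real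
    by (simp add: norm_mult indicator_def)
  have "((\<lambda>u. exp (Re z * u) / Re z) has_real_derivative exp (Re z * x)) (at x)" for x
    using assms by (auto intro!: derivative_eq_intros)
  have reali: "integrable lborel (\<lambda>u. indicator {..c} u * exp (Re z * u))"
  proof -
    have "((\<lambda>x. exp (- Re z * x)) has_integral exp (- Re z * (-c)) / Re z) {-c..}"
      by (rule has_integral_exp_minus_to_infinity) (use assms in auto)
    then have "(\<lambda>x. exp (- Re z * x)) absolutely_integrable_on {-c..}"
      by (intro nonnegative_absolutely_integrable_1) auto
    then have "set_integrable lborel {-c..} (\<lambda>x. exp (- Re z * x))"
      unfolding set_integrable_def by (subst (asm) integrable_completion) auto
    from lborel_integrable_real_affine[OF this[unfolded set_integrable_def], of "-1" 0]
    show ?thesis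
      by (rule back_subst[of "integrable lborel"]) (auto simp: indicator_def)
  qed
  have int: "integrable lborel (\<lambda>u. indicator {..c} u *\<^sub>R exp (z * of_real u))"
    by (rule Bochner_Integration.integrable_bound[OF reali])
       (auto simp: n intro!: measurable_If)
  have lim1: "(\<lambda>n. \<integral>u. indicator {c - real n..c} u *\<^sub>R exp (z * of_real u) \<partial>lborel)
     \<longlonglongrightarrow> (\<integral>u. indicator {..c} u *\<^sub>R exp (z * of_real u) \<partial>lborel)"
  proof (rule integral_dominated_convergence[where w = "\<lambda>u. indicator {..c} u * exp (Re z * u)"])
    show "AE x in lborel. (\<lambda>n. indicator {c - real n..c} x *\<^sub>R exp (z * of_real x))
          \<longlonglongrightarrow> indicator {..c} x *\<^sub>R exp (z * of_real x)"
    proof (rule AE_I2)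
      fix x :: real
      have "eventually (\<lambda>n. c - x \<le> real n) sequentially"
        by (rule eventually_sequentiallyI[of "nat \<lceil>c - x\<rceil>"]) linarith
      then have "eventually (\<lambda>n. indicator {c - real n..c} x *\<^sub>R exp (z * of_real x) = indicator {..c} x *\<^sub>R exp (z * of_real x)) sequentially"
        by eventually_elim (auto simp: indicator_def)
      then show "(\<lambda>n. indicator {c - real n..c} x *\<^sub>R exp (z * of_real x))
          \<longlonglongrightarrow> indicator {..c} x *\<^sub>R exp (z * of_real x)"
        by (rule tendsto_eventually)
    qed
    show "AE x in lborel. norm (indicat_real {c - real i..c} x *\<^sub>R exp (z * complex_of_real x))
         \<le> indicat_real {..c} x * exp (Re z * x)" for i
      by (auto simp: indicator_def)
  qed (use reali in auto)
  have lim2: "(\<lambda>n. exp (z * of_real c) / z - exp (z * of_real (c - real n)) / z) \<longlonglongrightarrow> exp (z * of_real c) / z - 0"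
  proof (intro tendsto_diff tendsto_const)
    have "(\<lambda>n. exp (r * (c - real n))) \<longlonglongrightarrow> 0" if "r > 0" for r :: real
      using that by real_asymp
    from tendsto_divide[OF this[OF assms] tendsto_const[of "norm z"]]
    have "(\<lambda>n. exp (Re z * (c - real n)) / norm z) \<longlonglongrightarrow> 0"
      using z by simp
    then show "(\<lambda>n. exp (z * of_real (c - real n)) / z) \<longlonglongrightarrow> 0"
      by (subst tendsto_norm_zero_iff[symmetric]) (simp add: norm_divide)
  qed
  have "(\<integral>u. indicator {c - real n..c} u *\<^sub>R exp (z * of_real u) \<partial>lborel)
      = exp (z * of_real c) / z - exp (z * of_real (c - real n)) / z" for n
    using has_bochner_integral_integral_eq[OF integral_exp_Icc[OF z, of "c - real n" c]] by simp
  then have "(\<integral>u. indicator {..c} u *\<^sub>R exp (z * of_real u) \<partial>lborel) = exp (z * of_real c) / z"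
    using LIMSEQ_unique[OF lim1] lim2 by simp
  with int show ?thesis by (simp add: has_bochner_integral_iff)
qed

section \<open>The Plancherel identity\<close>

text \<open>The Gaussian is its own Fourier transform up to scaling; this is read off from the
  characteristic function of the standard normal distribution.\<close>

lemma std_normal_fourier:
  fixes d y :: real
  assumes "d > 0"
  shows "integrable lborel (\<lambda>t. complex_of_real (std_normal_density (d * t)) * iexp (t * y))"
    and "(\<integral>t. complex_of_real (std_normal_density (d * t)) * iexp (t * y) \<partial>lborel)
         = of_real (sqrt (2 * pi) / d * std_normal_density (y / d))"
proof -
  let ?h = "\<lambda>x. complex_of_real (std_normal_density x) * iexp (x * (y / d))"
  have n: "integrable lborel (\<lambda>x. std_normal_density x)"
    using integrable_std_normal_moment[of 0] by simp
  have ih: "integrable lborel ?h"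
    by (rule Bochner_Integration.integrable_bound[OF n]) (auto simp: norm_mult)
  have "exp (- (y / d)\<^sup>2 / 2) = (\<integral>x. ?h x \<partial>lborel)"
  proof -
    have "complex_of_real (exp (- (y / d)\<^sup>2 / 2)) = char std_normal_distribution (y / d)"
      by (simp add: char_std_normal_distribution)
    also have "\<dots> = (\<integral>x. std_normal_density x *\<^sub>R iexp (y / d * x) \<partial>lborel)"
      unfolding char_def
      by (subst integral_density) (auto simp: normal_density_nonneg)
    finally show ?thesis by (simp add: scaleR_conv_of_real mult.commute)
  qed
  then have I: "(\<integral>x. ?h x \<partial>lborel) = of_real (sqrt (2 * pi) * std_normal_density (y / d))"
    by (simp add: std_normal_density_def)
  have eq: "?h (0 + d * t) = complex_of_real (std_normal_density (d * t)) * iexp (t * y)" for t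
    using assms by (simp add: field_simps)
  show "integrable lborel (\<lambda>t. complex_of_real (std_normal_density (d * t)) * iexp (t * y))"
    using lborel_integrable_real_affine[OF ih, of d 0] assms unfolding eq by simp
  have "(\<integral>x. ?h x \<partial>lborel) = d *\<^sub>R (\<integral>t. complex_of_real (std_normal_density (d * t)) * iexp (t * y) \<partial>lborel)"
    using lborel_integral_real_affine[of d ?h 0] assms unfolding eq by simp
  with I assms show "(\<integral>t. complex_of_real (std_normal_density (d * t)) * iexp (t * y) \<partial>lborel)
         = of_real (sqrt (2 * pi) / d * std_normal_density (y / d))"
    by (simp add: scaleR_conv_of_real field_simps)
qed

text \<open>Fubini carries the Gaussian across the transform: a wide cutoff on the transform side
  turns into an average of \<open>A\<close> over a window of width \<open>d\<close> around
  0.\<close>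

lemma std_normal_multiplication_formula:
  fixes A :: "real \<Rightarrow> complex"
  assumes A: "integrable lborel A" and d: "d > 0"
  shows "integrable lborel (\<lambda>t. of_real (std_normal_density (d * t)) * (\<integral>y. A y * iexp (t * y) \<partial>lborel))"
    and "(\<integral>t. of_real (std_normal_density (d * t)) * (\<integral>y. A y * iexp (t * y) \<partial>lborel) \<partial>lborel)
       = of_real (sqrt (2 * pi)) * (\<integral>y. of_real (std_normal_density y) * A (d * y) \<partial>lborel)"
proof -
  have [measurable]: "A \<in> borel_measurable borel" using A by auto
  let ?k = "\<lambda>y t. A y * (complex_of_real (std_normal_density (d * t)) * iexp (t * y))"
  have nn: "norm (?k y t) = norm (A y) * std_normal_density (d * t)" for y t
    by (simp add: norm_mult)
  have nint: "integrable lborel (\<lambda>t. std_normal_density (d * t))"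
    using lborel_integrable_real_affine[of "\<lambda>x. std_normal_density x" d 0]
      integrable_std_normal_moment[of 0] d by simp
  have P: "integrable (lborel \<Otimes>\<^sub>M lborel) (\<lambda>(y, t). ?k y t)"
  proof (rule lborel_pair.Fubini_integrable)
    show "AE y in lborel. integrable lborel (\<lambda>t. case (y, t) of (y, t) \<Rightarrow> ?k y t)"
      using std_normal_fourier(1)[OF d] by auto
    show "integrable lborel (\<lambda>y. \<integral>t. norm (case (y, t) of (y, t) \<Rightarrow> ?k y t) \<partial>lborel)"
      using A unfolding prod.case nn by simp
  qed measurable
  have eq: "(\<integral>y. ?k y t \<partial>lborel) = of_real (std_normal_density (d * t)) * (\<integral>y. A y * iexp (t * y) \<partial>lborel)" for t
    by (subst integral_mult_right_zero[symmetric]) (simp add: mult_ac)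
  have "integrable lborel (\<lambda>t. \<integral>y. ?k y t \<partial>lborel)"
    using lborel_pair.integrable_snd[OF P] by simp
  then show "integrable lborel (\<lambda>t. of_real (std_normal_density (d * t)) * (\<integral>y. A y * iexp (t * y) \<partial>lborel))"
    unfolding eq .
  have "(\<integral>t. (\<integral>y. ?k y t \<partial>lborel) \<partial>lborel) = (\<integral>y. (\<integral>t. ?k y t \<partial>lborel) \<partial>lborel)"
    using lborel_pair.Fubini_integral[OF P] by simp
  also have "\<dots> = (\<integral>y. A y * of_real (sqrt (2 * pi) / d * std_normal_density (y / d)) \<partial>lborel)"
    by (simp add: std_normal_fourier(2)[OF d] del: of_real_mult of_real_divide)
  also have "\<dots> = d *\<^sub>R (\<integral>y. A (0 + d * y) * of_real (sqrt (2 * pi) / d * std_normal_density ((0 + d * y) / d)) \<partial>lborel)"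
    using lborel_integral_real_affine[of d "\<lambda>y. A y * of_real (sqrt (2 * pi) / d * std_normal_density (y / d))" 0] d
    by simp
  also have "\<dots> = (\<integral>y. of_real (sqrt (2 * pi)) * (of_real (std_normal_density y) * A (d * y)) \<partial>lborel)"
    unfolding scaleR_conv_of_real integral_mult_right_zero[symmetric]
    using d by (intro Bochner_Integration.integral_cong) (auto simp: field_simps)
  finally show "(\<integral>t. of_real (std_normal_density (d * t)) * (\<integral>y. A y * iexp (t * y) \<partial>lborel) \<partial>lborel)
       = of_real (sqrt (2 * pi)) * (\<integral>y. of_real (std_normal_density y) * A (d * y) \<partial>lborel)"
    unfolding eq by simp
qed

lemma cnj_integral_fourier:
  "cnj (\<integral>u. G u * iexp (t * u) \<partial>lborel) = (\<integral>u. cnj (G u) * iexp (- (t * u)) \<partial>lborel)"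
  using Bochner_Integration.integral_cnj[of lborel "\<lambda>u. G u * iexp (t * u)"] by (simp add: exp_cnj)

text \<open>Plancherel is thereby reduced to Fourier inversion of a single function at a single
  point: the squared modulus of the transform of \<open>G\<close> is the transform of
  \<open>A\<close>, and \<open>A 0\<close> is the squared norm of \<open>G\<close>. Continuity of
  \<open>A\<close> at 0 is what the inversion needs.\<close>

lemma autocorrelation:
  fixes G :: "real \<Rightarrow> complex"
  assumes G: "integrable lborel G" and cont: "continuous_on UNIV G" and B: "\<And>u. norm (G u) \<le> B"
  defines "A \<equiv> \<lambda>y. \<integral>v. G v * cnj (G (v - y)) \<partial>lborel"
  shows "integrable lborel A" and "isCont A 0" and "\<And>y. norm (A y) \<le> B * (\<integral>v. norm (G v) \<partial>lborel)"
    and "\<And>t. (\<integral>y. A y * iexp (t * y) \<partial>lborel) = of_real ((norm (\<integral>u. G u * iexp (t * u) \<partial>lborel))\<^sup>2)"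
proof -
  have [measurable]: "G \<in> borel_measurable borel" using G by auto
  have [measurable]: "cnj \<in> borel_measurable borel"
    by (intro borel_measurable_continuous_onI continuous_intros)
  have B0: "B \<ge> 0" using B[of 0] norm_ge_zero[of "G 0"] by linarith
  have dom: "norm (G v * cnj (G (v - y))) \<le> B * norm (G v)" for v y
    using mult_right_mono[OF B[of "v - y"], of "norm (G v)"] by (simp add: norm_mult mult.commute)
  have iG: "integrable lborel (\<lambda>v. B * norm (G v))" using G by simp
  have pi: "integrable lborel (\<lambda>v. G v * cnj (G (v - y)))" for y
    by (rule Bochner_Integration.integrable_bound[OF iG]) (use dom B0 in auto)
  show "norm (A y) \<le> B * (\<integral>v. norm (G v) \<partial>lborel)" for y
  proof -
    have "norm (A y) \<le> (\<integral>v. B * norm (G v) \<partial>lborel)"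
      unfolding A_def
      by (rule order_trans[OF integral_norm_bound integral_mono[OF integrable_norm[OF pi] iG dom]])
    then show ?thesis by simp
  qed
  show "isCont A 0"
    unfolding continuous_within_sequentially A_def o_def
  proof (intro allI impI)
    fix x :: "nat \<Rightarrow> real" assume "(\<forall>n. x n \<in> UNIV) \<and> x \<longlonglongrightarrow> 0"
    then have x: "x \<longlonglongrightarrow> 0" by simp
    show "(\<lambda>n. \<integral>v. G v * cnj (G (v - x n)) \<partial>lborel) \<longlonglongrightarrow> (\<integral>v. G v * cnj (G (v - 0)) \<partial>lborel)"
    proof (rule integral_dominated_convergence[OF _ _ iG])
      have "isCont G w" for w using cont by (simp add: continuous_on_eq_continuous_at)
      then have "(\<lambda>n. G (v - x n)) \<longlonglongrightarrow> G (v - 0)" for v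
        by (intro isCont_tendsto_compose[of _ G] tendsto_intros x)
      then show "AE v in lborel. (\<lambda>n. G v * cnj (G (v - x n))) \<longlonglongrightarrow> G v * cnj (G (v - 0))"
        by (intro AE_I2 tendsto_intros)
    qed (use dom in auto)
  qed
  \<comment> \<open>The reflected conjugate exhibits \<open>A\<close> as the convolution of
    \<open>G\<close> with \<open>?R\<close>, and its transform is the conjugate of that of
    \<open>G\<close>.\<close>
  let ?R = "\<lambda>w. cnj (G (- w))"
  have R: "integrable lborel ?R"
    using lborel_integrable_real_affine[OF G, of "-1" 0] by simp
  have conv: "A y = (\<integral>v. G v * ?R (y - v) \<partial>lborel)" for y
    unfolding A_def by simp
  show "integrable lborel A"
    using convolution_integral(1)[OF G R] unfolding conv[symmetric] .
  fix t :: real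
  have mod: "integrable lborel (\<lambda>u. H u * iexp (t * u))" if "integrable lborel H" for H :: "real \<Rightarrow> complex"
    by (rule Bochner_Integration.integrable_bound[OF that])
       (use borel_measurable_integrable[OF that] in \<open>auto simp: norm_mult\<close>)
  have e: "iexp (t * y) = iexp (t * v) * iexp (t * (y - v))" for y v
    by (simp add: exp_add[symmetric] algebra_simps)
  have pt: "G v * ?R (y - v) * iexp (t * y) = (G v * iexp (t * v)) * (?R (y - v) * iexp (t * (y - v)))" for v y
    by (simp only: e[of y v] mult_ac)
  have "(\<integral>y. A y * iexp (t * y) \<partial>lborel)
      = (\<integral>y. (\<integral>v. (G v * iexp (t * v)) * (?R (y - v) * iexp (t * (y - v))) \<partial>lborel) \<partial>lborel)"
    unfolding conv integral_mult_left_zero[symmetric] pt ..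
  also have "\<dots> = (\<integral>v. G v * iexp (t * v) \<partial>lborel) * (\<integral>w. ?R w * iexp (t * w) \<partial>lborel)"
    using convolution_integral(2)[OF mod[OF G] mod[OF R]] .
  also have "(\<integral>w. ?R w * iexp (t * w) \<partial>lborel) = (\<integral>w. ?R (0 + -1 * w) * iexp (t * (0 + -1 * w)) \<partial>lborel)"
    using lborel_integral_real_affine[of "-1" "\<lambda>w. ?R w * iexp (t * w)" 0] by simp
  also have "\<dots> = cnj (\<integral>u. G u * iexp (t * u) \<partial>lborel)"
    unfolding cnj_integral_fourier by simp
  finally show "(\<integral>y. A y * iexp (t * y) \<partial>lborel) = of_real ((norm (\<integral>u. G u * iexp (t * u) \<partial>lborel))\<^sup>2)"
    by (simp only: complex_norm_square)
qed

text \<open>A Gaussian cutoff \<open>std_normal_density (d k * t)\<close> is inserted under the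
  integral of \<open>H\<close>. By the multiplication formula the result is a Gaussian average of
  \<open>A\<close> near 0 and tends to a multiple of \<open>A 0\<close>. On the transform side the
  cutoffs increase as \<open>d k\<close> decreases, so monotone convergence gives the integrability
  of \<open>H\<close> together with the value.\<close>

theorem plancherel_continuous:
  fixes G :: "real \<Rightarrow> complex"
  assumes G: "integrable lborel G" and cont: "continuous_on UNIV G" and B: "\<And>u. norm (G u) \<le> B"
  shows "integrable lborel (\<lambda>t. (norm (\<integral>u. G u * iexp (t * u) \<partial>lborel))\<^sup>2)"
    and "(\<integral>t. (norm (\<integral>u. G u * iexp (t * u) \<partial>lborel))\<^sup>2 \<partial>lborel) = 2 * pi * (\<integral>u. (norm (G u))\<^sup>2 \<partial>lborel)"
proof -
  define A where "A = (\<lambda>y. \<integral>v. G v * cnj (G (v - y)) \<partial>lborel)"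
  have A: "integrable lborel A" "isCont A 0" "norm (A y) \<le> B * (\<integral>v. norm (G v) \<partial>lborel)"
    "(\<integral>y. A y * iexp (t * y) \<partial>lborel) = of_real ((norm (\<integral>u. G u * iexp (t * u) \<partial>lborel))\<^sup>2)" for y t
    unfolding A_def using autocorrelation[OF assms] by blast+
  define H where "H = (\<lambda>t. (norm (\<integral>u. G u * iexp (t * u) \<partial>lborel))\<^sup>2)"
  have [measurable]: "G \<in> borel_measurable borel" "A \<in> borel_measurable borel" using G A(1) by auto
  have [measurable]: "H \<in> borel_measurable borel"
    unfolding H_def by measurable
  have Hd: "(norm (\<integral>u. G u * iexp (t * u) \<partial>lborel))\<^sup>2 = H t" for t by (simp add: H_def)
  have A0: "A 0 = of_real (\<integral>u. (norm (G u))\<^sup>2 \<partial>lborel)"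
    unfolding A_def integral_complex_of_real[symmetric] complex_norm_square by simp
  define d :: "nat \<Rightarrow> real" where "d = (\<lambda>k. 1 / real (Suc k))"
  have d: "d k > 0" for k by (simp add: d_def)
  have d0: "d \<longlonglongrightarrow> 0" unfolding d_def by real_asymp
  have ddec: "d j \<le> d i" if "i \<le> j" for i j using that by (simp add: d_def frac_le)
  have intk: "integrable lborel (\<lambda>t. std_normal_density (d k * t) * H t)" for k
    using std_normal_multiplication_formula(1)[OF A(1) d[of k]]
    unfolding A(4) of_real_mult[symmetric] Hd complex_of_real_integrable_eq .
  have eqk: "of_real (\<integral>t. std_normal_density (d k * t) * H t \<partial>lborel)
      = of_real (sqrt (2 * pi)) * (\<integral>y. of_real (std_normal_density y) * A (d k * y) \<partial>lborel)" for k
    using std_normal_multiplication_formula(2)[OF A(1) d[of k]]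
    unfolding A(4) of_real_mult[symmetric] Hd integral_complex_of_real .
  have nint: "integrable lborel (\<lambda>t. std_normal_density t)" "(\<integral>t. std_normal_density t \<partial>lborel) = 1"
    using integrable_std_normal_moment[of 0] integral_std_normal_moment_even[of 0] by auto
  have "(\<lambda>k. \<integral>y. of_real (std_normal_density y) * A (d k * y) \<partial>lborel)
      \<longlonglongrightarrow> (\<integral>y. of_real (std_normal_density y) * A 0 \<partial>lborel)"
  proof (rule integral_dominated_convergence)
    show "integrable lborel (\<lambda>y. std_normal_density y * (B * (\<integral>v. norm (G v) \<partial>lborel)))"
      using nint by simp
    show "AE y in lborel. norm (of_real (std_normal_density y) * A (d k * y))
           \<le> std_normal_density y * (B * (\<integral>v. norm (G v) \<partial>lborel))" for k
      using A(3) by (auto simp: norm_mult intro!: mult_left_mono)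
    show "AE y in lborel. (\<lambda>k. of_real (std_normal_density y) * A (d k * y))
           \<longlonglongrightarrow> of_real (std_normal_density y) * A 0"
    proof (intro AE_I2 tendsto_mult tendsto_const isCont_tendsto_compose[OF A(2)])
      show "(\<lambda>k. d k * y) \<longlonglongrightarrow> 0" for y using tendsto_mult_left_zero[OF d0] .
    qed
  qed auto
  then have "(\<lambda>k. of_real (\<integral>t. std_normal_density (d k * t) * H t \<partial>lborel))
      \<longlonglongrightarrow> of_real (sqrt (2 * pi)) * (\<integral>y. of_real (std_normal_density y) * A 0 \<partial>lborel)"
    unfolding eqk by (intro tendsto_intros)
  also have "of_real (sqrt (2 * pi)) * (\<integral>y. of_real (std_normal_density y) * A 0 \<partial>lborel)
      = complex_of_real (sqrt (2 * pi) * (\<integral>u. (norm (G u))\<^sup>2 \<partial>lborel))"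
    using nint(2) by (simp add: A0 integral_complex_of_real)
  finally have lim: "(\<lambda>k. \<integral>t. std_normal_density (d k * t) * H t \<partial>lborel)
      \<longlonglongrightarrow> sqrt (2 * pi) * (\<integral>u. (norm (G u))\<^sup>2 \<partial>lborel)"
    by (simp only: tendsto_of_real_iff)
  \<comment> \<open>The pointwise limit of the cutoffs: the density at 0 is 1 / sqrt (2 pi).\<close>
  let ?u = "\<lambda>t. 1 / sqrt (2 * pi) * H t"
  have H0: "H t \<ge> 0" for t by (simp add: H_def)
  have mono: "std_normal_density (d i * t) \<le> std_normal_density (d j * t)" if "i \<le> j" for i j t
  proof -
    have "(d j * t)\<^sup>2 \<le> (d i * t)\<^sup>2"
      unfolding power_mult_distrib
      using ddec[OF that] d[of j] by (intro mult_right_mono power_mono) (auto intro: less_imp_le)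
    then show ?thesis by (simp add: std_normal_density_def divide_right_mono)
  qed
  note mc = mono[THEN mult_right_mono[OF _ H0]]
  have ptw: "(\<lambda>k. std_normal_density (d k * t) * H t) \<longlonglongrightarrow> ?u t" for t
  proof -
    have "(\<lambda>k. 1 / sqrt (2 * pi) * exp (- (d k * t)\<^sup>2 / 2) * H t) \<longlonglongrightarrow> 1 / sqrt (2 * pi) * exp (- (0 * t)\<^sup>2 / 2) * H t"
      by (intro tendsto_intros d0) auto
    then show ?thesis by (simp add: std_normal_density_def)
  qed
  note M = integrable_monotone_convergence[where f = "\<lambda>k t. std_normal_density (d k * t) * H t" and u = ?u,
      OF intk _ _ lim] integral_monotone_convergence[where f = "\<lambda>k t. std_normal_density (d k * t) * H t" and u = ?u,
      OF intk _ _ lim]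
  have "integrable lborel ?u"
    by (rule M(1)) (use mc ptw in \<open>auto simp: mono_def\<close>)
  from Bochner_Integration.integrable_mult_right[OF this, of "sqrt (2 * pi)"]
  show "integrable lborel (\<lambda>t. (norm (\<integral>u. G u * iexp (t * u) \<partial>lborel))\<^sup>2)"
    unfolding Hd by simp
  have "(\<integral>t. ?u t \<partial>lborel) = sqrt (2 * pi) * (\<integral>u. (norm (G u))\<^sup>2 \<partial>lborel)"
    by (rule M(2)) (use mc ptw in \<open>auto simp: mono_def\<close>)
  then have "(\<integral>t. H t \<partial>lborel) = sqrt (2 * pi) * sqrt (2 * pi) * (\<integral>u. (norm (G u))\<^sup>2 \<partial>lborel)"
    by (simp add: field_simps)
  then show "(\<integral>t. (norm (\<integral>u. G u * iexp (t * u) \<partial>lborel))\<^sup>2 \<partial>lborel) = 2 * pi * (\<integral>u. (norm (G u))\<^sup>2 \<partial>lborel)"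
    by (simp add: H_def)
qed

section \<open>The zeta function on the right half plane\<close>

text \<open>With m = n + 1 this is (s - 1) times the difference of m^(-s) and the integral of x^(-s)
  over [m, m + 1]. Comparing sum and integral continues the zeta function, and the factor s - 1
  removes the pole.\<close>

definition zeta_term :: "nat \<Rightarrow> complex \<Rightarrow> complex" where
  "zeta_term n s = (s - 1) * of_nat (Suc n) powr (- s)
      - of_nat (Suc n) powr (1 - s) + of_nat (Suc (Suc n)) powr (1 - s)"

text \<open>The function $(s-1)\zeta(s)$ on the half plane $\Re s > 0$.\<close>

definition zeta_reg :: "complex \<Rightarrow> complex" where
  "zeta_reg s = 1 + (\<Sum>n. zeta_term n s)"

lemma norm_of_nat_powr: "norm ((of_nat (Suc n) :: complex) powr s) = real (Suc n) powr Re s"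
  by (subst norm_powr_real_powr) auto

lemma vector_derivative_bound:
  fixes f :: "real \<Rightarrow> 'a :: real_normed_vector"
  assumes "convex S" "\<And>x. x \<in> S \<Longrightarrow> (f has_vector_derivative f' x) (at x within S)"
    and "\<And>x. x \<in> S \<Longrightarrow> norm (f' x) \<le> B" "x \<in> S" "y \<in> S"
  shows "norm (f x - f y) \<le> B * norm (x - y)"
proof (rule differentiable_bound[OF assms(1) _ _ assms(4,5)])
  fix z assume z: "z \<in> S"
  show "(f has_derivative (\<lambda>h. h *\<^sub>R f' z)) (at z within S)"
    using assms(2)[OF z] by (simp add: has_vector_derivative_def)
  show "onorm (\<lambda>h. h *\<^sub>R f' z) \<le> B"
    using assms(3)[OF z] order_trans[OF norm_ge_zero assms(3)[OF z]]
    by (intro onorm_bound) (auto simp: mult.commute[of _ "norm (f' z)"] mult_right_mono)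
qed

text \<open>The expression is the increment over [a, a + 1] of the function \<open>?F\<close>, whose
  derivative is (1 - s)(x^(-s) - a^(-s)). That difference is estimated both by the mean value
  inequality and trivially. The minimum is kept because the first bound alone loses a full factor
  |s|; on the critical line the two are interpolated.\<close>

lemma powr_taylor_bound:
  fixes s :: complex
  assumes "Re s > 0" "a > 0"
  shows "norm ((s - 1) * of_real a powr (- s) - of_real a powr (1 - s) + of_real (a + 1) powr (1 - s))
           \<le> norm (s - 1) * min (norm s * a powr (- Re s - 1)) (2 * a powr (- Re s))"
proof -
  let ?m = "min (norm s * a powr (- Re s - 1)) (2 * a powr (- Re s))"
  have d1: "((\<lambda>x. of_real x powr w) has_vector_derivative w * of_real x powr (w - 1)) (at x within S)"
    if "x > 0" for w :: complex and x :: real and S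
  proof -
    have "((\<lambda>z. z powr w) has_field_derivative w * of_real x powr (w - 1)) (at (of_real x))"
      using that by (intro has_field_derivative_powr) auto
    then show ?thesis by (rule has_vector_derivative_real_field)
  qed
  have step: "norm (of_real x powr (- s) - of_real a powr (- s)) \<le> ?m"
    if x: "x \<in> {a..a+1}" for x
  proof -
    have "norm (of_real x powr (- s) - of_real a powr (- s)) \<le> (norm s * a powr (- Re s - 1)) * norm (x - a)"
    proof (rule vector_derivative_bound[of "{a..a+1}"])
      fix y assume y: "y \<in> {a..a+1}"
      then show "((\<lambda>x. complex_of_real x powr (- s)) has_vector_derivative (- s) * of_real y powr (- s - 1)) (at y within {a..a+1})"
        using assms by (intro d1) auto
      show "norm ((- s) * of_real y powr (- s - 1)) \<le> norm s * a powr (- Re s - 1)"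
        using y assms by (auto simp: norm_mult norm_powr_real_powr intro!: mult_left_mono powr_mono2')
    qed (use x assms in auto)
    also have "\<dots> \<le> (norm s * a powr (- Re s - 1)) * 1"
      using x by (intro mult_left_mono) auto
    finally have 1: "norm (of_real x powr (- s) - of_real a powr (- s)) \<le> norm s * a powr (- Re s - 1)" by simp
    have "norm (of_real x powr (- s) - of_real a powr (- s)) \<le> x powr (- Re s) + a powr (- Re s)"
      using norm_triangle_ineq4[of "of_real x powr (- s)" "of_real a powr (- s)"] x assms
      by (simp add: norm_powr_real_powr)
    also have "x powr (- Re s) \<le> a powr (- Re s)"
      using x assms by (intro powr_mono2') auto
    finally show ?thesis using 1 by simp
  qed
  let ?F = "\<lambda>x. (s - 1) * of_real a powr (- s) * of_real x + of_real x powr (1 - s)"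
  have "norm (?F (a + 1) - ?F a) \<le> (norm (s - 1) * ?m) * norm ((a + 1) - a)"
  proof (rule vector_derivative_bound[of "{a..a+1}"])
    fix y assume y: "y \<in> {a..a+1}"
    show "(?F has_vector_derivative (s - 1) * of_real a powr (- s) * 1 + (1 - s) * of_real y powr (1 - s - 1)) (at y within {a..a+1})"
      using y assms has_vector_derivative_of_real[OF DERIV_ident]
      by (intro has_vector_derivative_add has_vector_derivative_mult_right d1) auto
    have "(s - 1) * of_real a powr (- s) * 1 + (1 - s) * of_real y powr (1 - s - 1)
        = (1 - s) * (of_real y powr (- s) - of_real a powr (- s))" by (simp add: algebra_simps)
    also have "norm \<dots> \<le> norm (1 - s) * ?m"
      unfolding norm_mult by (intro mult_left_mono step y) auto
    finally show "norm ((s - 1) * of_real a powr (- s) * 1 + (1 - s) * of_real y powr (1 - s - 1))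
        \<le> norm (s - 1) * ?m" by (simp add: norm_minus_commute)
  qed auto
  then show ?thesis by (simp add: algebra_simps)
qed

lemma norm_zeta_term_min:
  assumes "Re s > 0"
  shows "norm (zeta_term n s)
           \<le> norm (s - 1) * min (norm s * real (Suc n) powr (- Re s - 1)) (2 * real (Suc n) powr (- Re s))"
  using powr_taylor_bound[OF assms, of "real (Suc n)"]
  by (simp add: zeta_term_def of_nat_Suc add.commute add.left_commute)

lemma norm_zeta_term:
  assumes "Re s > 0"
  shows "norm (zeta_term n s) \<le> norm (s - 1) * norm s * real (Suc n) powr (- Re s - 1)"
  using order_trans[OF norm_zeta_term_min[OF assms] mult_left_mono[OF min.cobounded1 norm_ge_zero]]
  by (simp add: mult.assoc)

lemma summable_Suc_powr:
  assumes "a < -1"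
  shows "summable (\<lambda>n. real (Suc n) powr a)"
  using assms by (subst summable_Suc_iff) (simp add: summable_real_powr_iff)

lemma summable_zeta_term:
  assumes "Re s > 0"
  shows "summable (\<lambda>n. norm (zeta_term n s))"
proof (rule summable_comparison_test')
  show "summable (\<lambda>n. norm (s - 1) * norm s * real (Suc n) powr (- Re s - 1))"
    using assms by (intro summable_mult summable_Suc_powr) auto
  show "norm (norm (zeta_term n s)) \<le> norm (s - 1) * norm s * real (Suc n) powr (- Re s - 1)" if "n \<ge> 0" for n
    using norm_zeta_term[OF assms] by simp
qed

lemma zeta_term_partial_sum:
  "1 + (\<Sum>n<N. zeta_term n s) = (s - 1) * (\<Sum>n<N. of_nat (Suc n) powr (- s)) + of_nat (Suc N) powr (1 - s)"
  by (induction N) (auto simp: zeta_term_def algebra_simps)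

text \<open>A limit formula valid also in the strip, where the Dirichlet series diverges: the
  partial sums are corrected by the boundary term left over from telescoping. The alternating series
  and the integral of the fractional part are both reduced to it.\<close>

lemma zeta_reg_LIMSEQ:
  assumes "Re s > 0"
  shows "(\<lambda>N. (s - 1) * (\<Sum>n<N. of_nat (Suc n) powr (- s)) + of_nat (Suc N) powr (1 - s)) \<longlonglongrightarrow> zeta_reg s"
proof -
  have "(\<lambda>N. \<Sum>n<N. zeta_term n s) \<longlonglongrightarrow> (\<Sum>n. zeta_term n s)"
    using summable_norm_cancel[OF summable_zeta_term[OF assms]] by (rule summable_LIMSEQ)
  then show ?thesis
    unfolding zeta_reg_def zeta_term_partial_sum[symmetric] by (intro tendsto_intros)
qed

lemma norm_zeta_reg_le:
  assumes "Re s \<ge> a" "a > 0"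
  shows "norm (zeta_reg s) \<le> 1 + norm (s - 1) * norm s * (\<Sum>n. real (Suc n) powr (- a - 1))"
proof -
  have s: "Re s > 0" using assms by linarith
  have sm: "summable (\<lambda>n. norm (s - 1) * norm s * real (Suc n) powr (- a - 1))"
    using assms by (intro summable_mult summable_Suc_powr) auto
  have "norm (\<Sum>n. zeta_term n s) \<le> (\<Sum>n. norm (s - 1) * norm s * real (Suc n) powr (- a - 1))"
  proof (rule norm_suminf_le[OF _ sm])
    fix n
    have "norm (zeta_term n s) \<le> norm (s - 1) * norm s * real (Suc n) powr (- Re s - 1)"
      by (rule norm_zeta_term[OF s])
    also have "\<dots> \<le> norm (s - 1) * norm s * real (Suc n) powr (- a - 1)"
      using assms by (intro mult_left_mono powr_mono) auto
    finally show "norm (zeta_term n s) \<le> norm (s - 1) * norm s * real (Suc n) powr (- a - 1)" .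
  qed
  also have "\<dots> = norm (s - 1) * norm s * (\<Sum>n. real (Suc n) powr (- a - 1))"
    using assms by (intro suminf_mult summable_Suc_powr) auto
  finally show ?thesis
    unfolding zeta_reg_def using norm_triangle_ineq[of 1 "\<Sum>n. zeta_term n s"] by simp
qed

lemma holomorphic_zeta_reg: "zeta_reg holomorphic_on {s. Re s > 0}"
proof -
  have "(\<lambda>s. \<Sum>n. zeta_term n s) holomorphic_on {s. Re s > 0}"
  proof (rule holomorphic_uniform_sequence[where f = "\<lambda>N s. \<Sum>n<N. zeta_term n s"])
    show "open {s. Re s > 0}" by (rule open_halfspace_Re_gt)
    show "(\<lambda>s. \<Sum>n<N. zeta_term n s) holomorphic_on {s. Re s > 0}" for N
      unfolding zeta_term_def by (intro holomorphic_intros)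
    fix x :: complex assume "x \<in> {s. Re s > 0}"
    then have x: "Re x > 0" by simp
    define d where "d = Re x / 2"
    have d: "d > 0" using x by (simp add: d_def)
    have re: "Re s \<ge> d" if "s \<in> cball x d" for s
      using that abs_Re_le_cmod[of "x - s"] by (simp add: d_def dist_norm)
    define C where "C = (norm x + d + 1) * (norm x + d)"
    have "uniform_limit (cball x d) (\<lambda>N s. \<Sum>n<N. zeta_term n s) (\<lambda>s. \<Sum>n. zeta_term n s) sequentially"
    proof (rule Weierstrass_m_test)
      show "summable (\<lambda>n. C * real (Suc n) powr (- d - 1))"
        using d by (intro summable_mult summable_Suc_powr) auto
      fix n s assume s: "s \<in> cball x d"
      have s0: "Re s > 0" using re[OF s] d by linarith
      have ns: "norm s \<le> norm x + d"
        using s norm_triangle_ineq2[of s x] by (simp add: dist_norm norm_minus_commute)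
      have ns1: "norm (s - 1) \<le> norm x + d + 1"
        using ns norm_triangle_ineq4[of s 1] by simp
      have "norm (zeta_term n s) \<le> (norm (s - 1) * norm s) * real (Suc n) powr (- Re s - 1)"
        using norm_zeta_term[OF s0] .
      also have "\<dots> \<le> C * real (Suc n) powr (- d - 1)"
        unfolding C_def using ns ns1 re[OF s] d by (intro mult_mono powr_mono) auto
      finally show "norm (zeta_term n s) \<le> C * real (Suc n) powr (- d - 1)" .
    qed
    moreover have "cball x d \<subseteq> {s. Re s > 0}" using re d by fastforce
    ultimately show "\<exists>d>0. cball x d \<subseteq> {s. Re s > 0} \<and>
        uniform_limit (cball x d) (\<lambda>N s. \<Sum>n<N. zeta_term n s) (\<lambda>s. \<Sum>n. zeta_term n s) sequentially"
      using d by blast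
  qed
  then show ?thesis unfolding zeta_reg_def by (intro holomorphic_intros)
qed

lemma zeta_reg_1: "zeta_reg 1 = 1"
proof -
  have "zeta_term n 1 = 0" for n
    using of_nat_neq_0[of n, where 'a = complex] of_nat_neq_0[of "Suc n", where 'a = complex]
    unfolding zeta_term_def by (simp del: of_nat_Suc)
  then show ?thesis by (simp add: zeta_reg_def)
qed

lemma zeta_reg_cnj:
  assumes "Re s > 0"
  shows "zeta_reg (cnj s) = cnj (zeta_reg s)"
proof -
  have p: "cnj (of_nat (Suc n) powr w) = of_nat (Suc n) powr cnj w" for n w
    by (subst cnj_powr) (auto simp: complex_nonpos_Reals_iff)
  have t: "zeta_term n (cnj s) = cnj (zeta_term n s)" for n
    by (simp only: zeta_term_def complex_cnj_add complex_cnj_diff complex_cnj_mult p complex_cnj_minus complex_cnj_one)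
  have "(\<lambda>n. cnj (zeta_term n s)) sums cnj (\<Sum>n. zeta_term n s)"
    unfolding sums_cnj by (rule summable_sums[OF summable_norm_cancel[OF summable_zeta_term[OF assms]]])
  then show ?thesis by (simp add: zeta_reg_def t sums_iff)
qed

lemma dirichlet_series_zeta:
  assumes "Re s > 1"
  shows "summable (\<lambda>n. norm (of_nat (Suc n) powr (- s) :: complex))"
    and "zeta_reg s = (s - 1) * (\<Sum>n. of_nat (Suc n) powr (- s))"
proof -
  show sm: "summable (\<lambda>n. norm (of_nat (Suc n) powr (- s) :: complex))"
    unfolding norm_of_nat_powr using assms by (intro summable_Suc_powr) simp
  have "(\<lambda>N. real (Suc N) powr (1 - Re s)) \<longlonglongrightarrow> 0"
    using assms by real_asymp
  then have "(\<lambda>N. (of_nat (Suc N) :: complex) powr (1 - s)) \<longlonglongrightarrow> 0"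
    by (subst tendsto_norm_zero_iff[symmetric], subst norm_of_nat_powr) simp
  then have "(\<lambda>N. (s - 1) * (\<Sum>n<N. of_nat (Suc n) powr (- s)) + of_nat (Suc N) powr (1 - s))
       \<longlonglongrightarrow> (s - 1) * (\<Sum>n. of_nat (Suc n) powr (- s)) + 0"
    by (intro tendsto_intros summable_LIMSEQ summable_norm_cancel[OF sm])
  with zeta_reg_LIMSEQ[of s] assms show "zeta_reg s = (s - 1) * (\<Sum>n. of_nat (Suc n) powr (- s))"
    using LIMSEQ_unique by fastforce
qed

text \<open>The first 2N alternating terms are the first 2N terms of the zeta series minus twice the
  even ones, and the even ones are 2^(-s) times the first N terms. The odd partial sums differ from
  these by one term, which tends to 0.\<close>

lemma dirichlet_eta_zeta_reg:
  assumes "Re s > 0" "s \<noteq> 1"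
  shows "(s - 1) * dirichlet_eta s = (1 - 2 powr (1 - s)) * zeta_reg s"
proof -
  define e where "e = (\<lambda>n. (-1) ^ n * (of_nat (Suc n) :: complex) powr (- s))"
  define u where "u = (\<lambda>N. (s - 1) * (\<Sum>n<N. of_nat (Suc n) powr (- s)) + (of_nat (Suc N) :: complex) powr (1 - s))"
  define L where "L = (1 - 2 powr (1 - s)) * zeta_reg s / (s - 1)"
  have u: "u \<longlonglongrightarrow> zeta_reg s" unfolding u_def by (rule zeta_reg_LIMSEQ[OF assms(1)])
  have p0: "(\<lambda>N. (of_nat (Suc N) :: complex) powr (- s)) \<longlonglongrightarrow> 0"
  proof -
    have "(\<lambda>N. real (Suc N) powr (- Re s)) \<longlonglongrightarrow> 0" using assms by real_asymp
    then show ?thesis by (subst tendsto_norm_zero_iff[symmetric], subst norm_of_nat_powr) simp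
  qed
  have dbl: "(of_nat (Suc (2 * m + 1)) :: complex) powr w = 2 powr w * of_nat (Suc m) powr w" for m w
  proof -
    have "of_nat (Suc (2 * m + 1)) = complex_of_real 2 * complex_of_real (real (Suc m))" by simp
    then show ?thesis by (subst powr_times_real[symmetric]) auto
  qed
  have E: "(\<Sum>n<2*N. e n) = (\<Sum>n<2*N. of_nat (Suc n) powr (- s)) - 2 powr (1 - s) * (\<Sum>n<N. of_nat (Suc n) powr (- s))" for N
  proof (induction N)
    case (Suc N)
    have "(\<Sum>n<2 * Suc N. e n) = (\<Sum>n<2*N. e n) + of_nat (Suc (2 * N)) powr (- s) - of_nat (Suc (2 * N + 1)) powr (- s)"
      by (simp add: e_def)
    also have "\<dots> = (\<Sum>n<2 * Suc N. of_nat (Suc n) powr (- s)) - 2 powr (1 - s) * (\<Sum>n<N. of_nat (Suc n) powr (- s))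
        - 2 * of_nat (Suc (2 * N + 1)) powr (- s)"
      unfolding Suc.IH by simp
    also have "2 * of_nat (Suc (2 * N + 1)) powr (- s) = 2 powr (1 - s) * of_nat (Suc N) powr (- s)"
      unfolding dbl by (simp add: powr_diff powr_minus field_simps)
    finally show ?case by (simp add: algebra_simps)
  qed simp
  \<comment> \<open>The boundary terms of \<open>u (2 * N)\<close> and of
    \<open>2 powr (1 - s) * u N\<close> are the powers of 2N + 1 and 2N + 2. Neither need converge,
    but their difference is recovered from \<open>u (2 * N + 1) - u (2 * N)\<close>, which tends to
    0.\<close>
  have E2: "(s - 1) * (\<Sum>n<2*N. e n) = u (2 * N) - 2 powr (1 - s) * u N
      + (u (2 * N + 1) - u (2 * N) - (s - 1) * of_nat (Suc (2 * N)) powr (- s))" for N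
    unfolding E u_def using dbl[of N "1 - s"] by (simp add: algebra_simps)
  have sub: "filterlim (\<lambda>N. 2 * N) at_top (sequentially :: nat filter)"
    "filterlim (\<lambda>N. 2 * N + 1) at_top (sequentially :: nat filter)"
    "filterlim (\<lambda>N. N div 2) at_top (sequentially :: nat filter)"
    by (auto intro!: filterlim_subseq strict_monoI filterlim_at_top_div_const_nat)
  have "(\<lambda>N. (s - 1) * (\<Sum>n<2*N. e n)) \<longlonglongrightarrow> zeta_reg s - 2 powr (1 - s) * zeta_reg s
      + (zeta_reg s - zeta_reg s - (s - 1) * 0)"
    unfolding E2
    by (intro tendsto_intros u filterlim_compose[OF u sub(1)] filterlim_compose[OF u sub(2)]
         filterlim_compose[OF p0 sub(1)])
  from tendsto_divide[OF this tendsto_const[of "s - 1"]]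
  have "(\<lambda>N. ((s - 1) * (\<Sum>n<2*N. e n)) / (s - 1)) \<longlonglongrightarrow> L"
    using assms by (simp add: L_def left_diff_distrib)
  then have "(\<lambda>N. \<Sum>n<2*N. e n) \<longlonglongrightarrow> L" using assms by simp
  from filterlim_compose[OF this sub(3)] have 1: "(\<lambda>N. \<Sum>n<2*(N div 2). e n) \<longlonglongrightarrow> L" .
  have "e \<longlonglongrightarrow> 0"
    by (subst tendsto_norm_zero_iff[symmetric]) (use p0[THEN tendsto_norm_zero] in \<open>simp add: e_def norm_mult norm_power\<close>)
  then have 2: "(\<lambda>N. if odd N then e (2*(N div 2)) else 0) \<longlonglongrightarrow> 0"
  proof -
    have "filterlim (\<lambda>N. 2 * (N div 2)) at_top (sequentially :: nat filter)"
      using filterlim_compose[OF sub(1,3)] .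
    from filterlim_compose[OF \<open>e \<longlonglongrightarrow> 0\<close> this]
    have "(\<lambda>N. norm (e (2 * (N div 2)))) \<longlonglongrightarrow> 0" by (rule tendsto_norm_zero)
    then show ?thesis by (rule Lim_null_comparison[rotated]) auto
  qed
  have split: "(\<Sum>n<N. e n) = (\<Sum>n<2*(N div 2). e n) + (if odd N then e (2*(N div 2)) else 0)" for N
  proof (cases "odd N")
    case True
    then obtain k where "N = 2 * k + 1" by (elim oddE)
    then show ?thesis by simp
  qed simp
  have "e sums L"
    unfolding sums_def by (subst split) (use tendsto_add[OF 1 2] in simp)
  moreover have "dirichlet_eta s = (\<Sum>n. e n)"
    unfolding dirichlet_eta_def e_def by (simp add: powr_minus field_simps)
  ultimately have "dirichlet_eta s = L" by (simp add: sums_iff)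
  then show ?thesis using assms by (simp add: L_def)
qed

text \<open>To the left of the line Re s = 1 the modulus of \<open>2 powr (1 - s)\<close> exceeds 1,
  so the division in the definition is by a nonzero number.\<close>

lemma riemann_zeta_eq:
  assumes "0 < Re s" "Re s < 1"
  shows "riemann_zeta s = zeta_reg s / (s - 1)"
proof -
  have s1: "s \<noteq> 1" using assms by auto
  have "norm ((2 :: complex) powr (1 - s)) = 2 powr (1 - Re s)"
    using norm_powr_real_powr[of 2 "1 - s"] by simp
  also have "\<dots> > 1" using assms by simp
  finally have ne: "1 - (2 :: complex) powr (1 - s) \<noteq> 0" by auto
  show ?thesis
    using dirichlet_eta_zeta_reg[OF assms(1) s1] s1 ne
    by (simp add: riemann_zeta_def divide_simps mult.commute)
qed

text \<open>From min x y \<le> x^(3/4) y^(1/4), applied to the two bounds for the terms: the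
  exponent of m = n + 1 becomes (3/4)(3/2) + (1/4)(1/2) = 5/4, which is summable, at the cost of
  |s|^(3/4). The exponent 3/4 leaves exactly |s|^(1/4) for the approximation of 1/\<zeta>.\<close>

lemma zeta_critical_line_bound:
  obtains C where "C > 0" "\<And>s. Re s = 1 / 2 \<Longrightarrow> norm (zeta_reg s / (s - 1)) \<le> C * norm s powr (3 / 4)"
proof -
  define D where "D = (\<Sum>n. 2 powr (1/4) * real (Suc n) powr (- 5 / 4))"
  have sm: "summable (\<lambda>n. 2 powr (1/4) * real (Suc n) powr (- 5 / 4))"
    by (intro summable_mult summable_Suc_powr) simp
  have D: "D \<ge> 0" unfolding D_def by (rule suminf_nonneg[OF sm]) simp
  have "norm (zeta_reg s / (s - 1)) \<le> (4 + D) * norm s powr (3 / 4)" if s: "Re s = 1 / 2" for s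
  proof -
    have ns: "norm s \<ge> 1 / 2" using abs_Re_le_cmod[of s] s by simp
    have ns1: "norm (s - 1) \<ge> 1 / 2" using abs_Re_le_cmod[of "s - 1"] s by simp
    have mini: "min x y \<le> x powr (3/4) * y powr (1/4)" if "x \<ge> 0" "y \<ge> 0" for x y :: real
    proof -
      have "min x y = min x y powr (3/4) * min x y powr (1/4)"
        using that by (cases "min x y = 0") (auto simp: powr_add[symmetric])
      also have "\<dots> \<le> x powr (3/4) * y powr (1/4)"
        using that by (intro mult_mono powr_mono2) auto
      finally show ?thesis .
    qed
    have t: "norm (zeta_term n s) \<le> norm (s - 1) * norm s powr (3/4) * (2 powr (1/4) * real (Suc n) powr (- 5 / 4))" for n
    proof -
      have "min (norm s * real (Suc n) powr (- Re s - 1)) (2 * real (Suc n) powr (- Re s))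
          \<le> (norm s * real (Suc n) powr (- Re s - 1)) powr (3/4) * (2 * real (Suc n) powr (- Re s)) powr (1/4)"
        by (rule mini) auto
      also have "\<dots> = norm s powr (3/4) * (2 powr (1/4) * (real (Suc n) powr (- 9 / 8) * real (Suc n) powr (-1/8)))"
        unfolding s by (simp add: powr_mult powr_powr)
      also have "real (Suc n) powr (- 9 / 8) * real (Suc n) powr (-1/8) = real (Suc n) powr (- 5/4)"
        by (simp add: powr_add[symmetric])
      finally have "norm (s - 1) * min (norm s * real (Suc n) powr (- Re s - 1)) (2 * real (Suc n) powr (- Re s))
        \<le> norm (s - 1) * (norm s powr (3/4) * (2 powr (1/4) * real (Suc n) powr (- 5/4)))"
        by (intro mult_left_mono) auto
      from order_trans[OF norm_zeta_term_min[of s n] this] s show ?thesis by (simp add: mult.assoc)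
    qed
    have "norm (\<Sum>n. zeta_term n s) \<le> (\<Sum>n. norm (s - 1) * norm s powr (3/4) * (2 powr (1/4) * real (Suc n) powr (- 5 / 4)))"
      by (rule norm_suminf_le[OF t]) (intro summable_mult[OF sm])
    also have "\<dots> = norm (s - 1) * norm s powr (3/4) * D"
      unfolding D_def by (rule suminf_mult[OF sm])
    finally have "norm (zeta_reg s) \<le> 1 + norm (s - 1) * norm s powr (3/4) * D"
      unfolding zeta_reg_def using norm_triangle_ineq[of 1 "\<Sum>n. zeta_term n s"] by simp
    then have "norm (zeta_reg s / (s - 1)) \<le> (1 + norm (s - 1) * norm s powr (3/4) * D) / norm (s - 1)"
      by (simp add: norm_divide divide_right_mono)
    also have "\<dots> = 1 / norm (s - 1) + norm s powr (3/4) * D"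
      using ns1 by (subst add_divide_distrib) auto
    also have "1 / norm (s - 1) \<le> 2" using ns1 by (simp add: divide_simps)
    also have "2 \<le> 4 * norm s powr (3/4)"
    proof -
      have "(1/2 :: real) powr 1 \<le> (1/2) powr (3/4)" by (rule powr_mono') auto
      also have "\<dots> \<le> norm s powr (3/4)" using ns by (intro powr_mono2) auto
      finally show ?thesis by simp
    qed
    finally show ?thesis by (simp add: algebra_simps)
  qed
  moreover have "4 + D > 0" using D by simp
  ultimately show ?thesis using that by blast
qed

section \<open>The Muentz formula\<close>

lemma sum_indicator_floor:
  fixes y :: real
  assumes "0 \<le> y"
  shows "(\<Sum>n<N. indicator {real (Suc n)..} y :: real) = real (min N (nat \<lfloor>y\<rfloor>))"
proof (induction N)
  case (Suc N)
  have "real (Suc N) \<le> y \<longleftrightarrow> Suc N \<le> nat \<lfloor>y\<rfloor>"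
    using assms by (simp add: le_nat_iff le_floor_iff)
  then show ?case using Suc by (auto simp: indicator_def min_def)
qed simp

lemma exp_ln_powr: "x > 0 \<Longrightarrow> exp (s * of_real (ln x)) = complex_of_real x powr s"
  by (simp add: powr_def Ln_of_real)

text \<open>The field arithmetic behind \<open>frac_mellin\<close>, with \<open>X\<close> =
  (N+1)^(1-s), \<open>Y\<close> = (N+1)^(-s) and \<open>S\<close> the sum of the first N terms of
  the zeta series.\<close>

lemma geometric_tail_algebra:
  fixes s X Y S :: complex
  assumes "s \<noteq> 0" "s \<noteq> 1"
  shows "X / (1 - s) - (S + Y - X) / s = - ((s - 1) * S + X + (s - 1) * Y) / (s - 1) / s"
proof -
  define d where "d = s - 1"
  have d: "d \<noteq> 0" using assms by (simp add: d_def)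
  have s: "s = d + 1" by (simp add: d_def)
  have "X / d - X / s = X * (s - d) / (d * s)"
    using d assms by (simp add: diff_frac_eq right_diff_distrib)
  also have "s - d = 1" by (simp add: d_def)
  finally have 1: "X / d - X / s = X / d / s" by simp
  have 2: "1 - s = - d" by (simp add: d_def)
  have "- (d * S + X + d * Y) / d / s = - ((S + Y) / s) - X / d / s"
    using d by (simp add: add_divide_distrib diff_divide_distrib)
  also have "\<dots> = X / (- d) - (S + Y - X) / s"
    unfolding 1[symmetric] by (simp add: add_divide_distrib diff_divide_distrib)
  finally show ?thesis unfolding 2 by (simp only: d_def)
qed

lemma exp_shift_factor: "of_real (exp (v - u)) * (exp (of_real v) * z) = of_real (exp (- u)) * (exp (2 * of_real v) * (z::complex))"
proof -
  have "complex_of_real (exp (v - u)) * exp (of_real v) = of_real (exp (v - u) * exp v)"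
    by (simp only: exp_of_real of_real_mult)
  also have "exp (v - u) * exp v = exp (- u) * exp (2 * v)" by (simp add: exp_add[symmetric])
  also have "complex_of_real \<dots> = of_real (exp (- u)) * exp (2 * of_real v)"
    by (simp add: exp_of_real[symmetric])
  finally show ?thesis by (simp only: mult.assoc[symmetric])
qed

text \<open>In the variable x = exp (-w) this is the classical integral of frac x against x^(-s-1)
  over the positive axis. It converges for 0 < Re s < 1 because frac x is at most x near 0 and at
  most 1 near infinity. Cutting it off at x = N + 1 gives the expressions of
  \<open>zeta_reg_LIMSEQ\<close> up to a term tending to 0.\<close>

lemma frac_mellin:
  assumes "0 < Re s" "Re s < 1"
  defines "b \<equiv> \<lambda>w. exp (s * of_real w) * of_real (frac (exp (- w)))"
  shows "integrable lborel b" and "(\<integral>w. b w \<partial>lborel) = - zeta_reg s / (s - 1) / s"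
proof -
  have s: "s \<noteq> 0" "s \<noteq> 1" using assms by auto
  define r where "r = (\<lambda>w. exp (- s * of_real w) * of_real (frac (exp w)))"
  have [measurable]: "r \<in> borel_measurable borel" unfolding r_def frac_def by measurable
  have D: "integrable lborel (\<lambda>w. indicator {..0} w *\<^sub>R exp (complex_of_real (1 - Re s) * of_real w)
             + indicator {..0} (-w) *\<^sub>R exp (complex_of_real (Re s) * of_real (- w)))"
  proof (intro Bochner_Integration.integrable_add)
    show "integrable lborel (\<lambda>w. indicator {..0} w *\<^sub>R exp (complex_of_real (1 - Re s) * of_real w))"
      using integral_exp_Iic[of "of_real (1 - Re s)" 0] assms by (auto simp: has_bochner_integral_iff)
    have "integrable lborel (\<lambda>w. indicator {..0} w *\<^sub>R exp (complex_of_real (Re s) * of_real w))"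
      using integral_exp_Iic[of "of_real (Re s)" 0] assms by (auto simp: has_bochner_integral_iff)
    from lborel_integrable_real_affine[OF this, of "-1" 0]
    show "integrable lborel (\<lambda>w. indicator {..0} (-w) *\<^sub>R exp (complex_of_real (Re s) * of_real (-w)))"
      by simp
  qed
  have nr: "norm (r w) \<le> norm (indicator {..0} w *\<^sub>R exp (complex_of_real (1 - Re s) * of_real w)
             + indicator {..0} (-w) *\<^sub>R exp (complex_of_real (Re s) * of_real (- w)))" for w :: real
  proof -
    have fr: "frac (exp w) \<le> 1" "frac (exp w) \<le> exp w"
      using frac_lt_1[of "exp w"] by (auto simp: frac_def)
    have e: "norm (r w) = exp (- Re s * w) * frac (exp w)"
      by (simp add: r_def norm_mult)
    have "indicator {..0} w *\<^sub>R exp (complex_of_real (1 - Re s) * of_real w)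
             + indicator {..0} (-w) *\<^sub>R exp (complex_of_real (Re s) * of_real (- w))
         = complex_of_real (indicator {..0} w * exp ((1 - Re s) * w) + indicator {..0} (-w) * exp (- Re s * w))"
      by (simp add: scaleR_conv_of_real exp_of_real[symmetric])
    then have e2: "norm (indicator {..0} w *\<^sub>R exp (complex_of_real (1 - Re s) * of_real w)
             + indicator {..0} (-w) *\<^sub>R exp (complex_of_real (Re s) * of_real (- w)))
         = indicator {..0} w * exp ((1 - Re s) * w) + indicator {..0} (-w) * exp (- Re s * w)"
      by (simp only: norm_of_real) (auto simp: indicator_def)
    show ?thesis
    proof (cases "w \<le> 0")
      case True
      have "exp (- Re s * w) * frac (exp w) \<le> exp (- Re s * w) * exp w"
        using fr by (intro mult_left_mono) auto
      also have "\<dots> = exp ((1 - Re s) * w)" by (simp add: exp_add[symmetric] algebra_simps)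
      finally show ?thesis unfolding e e2 using True by (simp add: indicator_def add_increasing2)
    next
      case False
      have "exp (- Re s * w) * frac (exp w) \<le> exp (- Re s * w) * 1"
        using fr by (intro mult_left_mono) auto
      then show ?thesis unfolding e e2 using False by (simp add: indicator_def)
    qed
  qed
  have ir: "integrable lborel r"
    by (rule Bochner_Integration.integrable_bound[OF D]) (use nr in auto)
  have rb: "r (0 + -1 * w) = b w" for w by (simp add: r_def b_def)
  show "integrable lborel b"
    using lborel_integrable_real_affine[OF ir, of "-1" 0] unfolding rb by simp
  have br: "(\<integral>w. b w \<partial>lborel) = (\<integral>w. r w \<partial>lborel)"
    using lborel_integral_real_affine[of "-1" r 0] unfolding rb by simp
  define t where "t = (\<lambda>N w. indicator {..ln (real (Suc N))} w *\<^sub>R r w)"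
  have lim: "(\<lambda>N. \<integral>w. t N w \<partial>lborel) \<longlonglongrightarrow> (\<integral>w. r w \<partial>lborel)"
  proof (rule integral_dominated_convergence)
    show "integrable lborel (\<lambda>w. norm (r w))" using ir by simp
    show "AE w in lborel. norm (t N w) \<le> norm (r w)" for N by (auto simp: t_def indicator_def)
    show "AE w in lborel. (\<lambda>N. t N w) \<longlonglongrightarrow> r w"
    proof (rule AE_I2)
      fix w :: real
      have "filterlim (\<lambda>N. ln (real (Suc N))) at_top sequentially" by real_asymp
      then have "eventually (\<lambda>N. w \<le> ln (real (Suc N))) sequentially"
        by (simp add: filterlim_at_top)
      then have "eventually (\<lambda>N. t N w = r w) sequentially"
        by eventually_elim (simp add: t_def)
      then show "(\<lambda>N. t N w) \<longlonglongrightarrow> r w" by (rule tendsto_eventually)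
    qed
  qed (simp_all add: t_def)
  \<comment> \<open>Up to the cutoff the floor is a finite sum of indicators, so the integral splits
    into elementary ones. The last interval is a single point; it makes the integrand agree with
    \<open>t N\<close> at the endpoint too.\<close>
  have tN: "has_bochner_integral lborel (t N)
      (of_nat (Suc N) powr (1 - s) / (1 - s)
        - (\<Sum>n<Suc N. of_nat (Suc N) powr (- s) / (- s) - of_nat (Suc n) powr (- s) / (- s)))" for N
  proof -
    have "has_bochner_integral lborel
       (\<lambda>w. indicator {..ln (real (Suc N))} w *\<^sub>R exp ((1 - s) * of_real w)
          - (\<Sum>n<Suc N. indicator {ln (real (Suc n))..ln (real (Suc N))} w *\<^sub>R exp (- s * of_real w)))
       (exp ((1 - s) * of_real (ln (real (Suc N)))) / (1 - s)
        - (\<Sum>n<Suc N. exp (- s * of_real (ln (real (Suc N)))) / (- s) - exp (- s * of_real (ln (real (Suc n)))) / (- s)))"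
      using assms s
      by (intro has_bochner_integral_diff has_bochner_integral_sum integral_exp_Iic integral_exp_Icc) auto
    moreover have "indicator {..ln (real (Suc N))} w *\<^sub>R exp ((1 - s) * of_real w)
          - (\<Sum>n<Suc N. indicator {ln (real (Suc n))..ln (real (Suc N))} w *\<^sub>R exp (- s * of_real w)) = t N w" for w
    proof (cases "w \<le> ln (real (Suc N))")
      case True
      have le: "real (Suc n) \<le> exp w \<longleftrightarrow> ln (real (Suc n)) \<le> w" for n
        by (metis exp_ln exp_le_cancel_iff of_nat_0_less_iff zero_less_Suc)
      have "exp w \<le> real (Suc N)"
        using True by (metis exp_ln exp_le_cancel_iff of_nat_0_less_iff zero_less_Suc)
      then have fl: "nat \<lfloor>exp w\<rfloor> \<le> Suc N" by linarith
      have "(\<Sum>n<Suc N. indicator {ln (real (Suc n))..ln (real (Suc N))} w *\<^sub>R exp (- s * of_real w))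
          = (\<Sum>n<Suc N. indicator {real (Suc n)..} (exp w) *\<^sub>R exp (- s * of_real w))"
        using True le by (intro sum.cong refl) (auto simp: indicator_def simp del: of_nat_Suc)
      also have "\<dots> = real (nat \<lfloor>exp w\<rfloor>) *\<^sub>R exp (- s * of_real w)"
        unfolding scaleR_sum_left[symmetric] using fl by (subst sum_indicator_floor) (auto simp: min_def)
      also have "real (nat \<lfloor>exp w\<rfloor>) = of_int \<lfloor>exp w\<rfloor>" by simp
      finally have sm: "(\<Sum>n<Suc N. indicator {ln (real (Suc n))..ln (real (Suc N))} w *\<^sub>R exp (- s * of_real w))
        = of_real (of_int \<lfloor>exp w\<rfloor>) * exp (- s * of_real w)" by (simp only: scaleR_conv_of_real)
      have "exp ((1 - s) * of_real w) = exp (- s * of_real w + of_real w)"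
        by (simp add: algebra_simps)
      also have "\<dots> = exp (- s * of_real w) * of_real (exp w)"
        by (simp only: exp_add exp_of_real)
      finally show ?thesis
        unfolding sm using True by (simp add: t_def r_def frac_def right_diff_distrib)
    next
      case False
      then show ?thesis by (simp add: t_def)
    qed
    ultimately show ?thesis by (simp only: exp_ln_powr of_nat_0_less_iff zero_less_Suc of_real_of_nat_eq)
  qed
  have val: "(\<integral>w. t N w \<partial>lborel) = - ((s - 1) * (\<Sum>n<N. of_nat (Suc n) powr (- s)) + of_nat (Suc N) powr (1 - s)
        + (s - 1) * of_nat (Suc N) powr (- s)) / (s - 1) / s" for N
  proof -
    have p: "of_nat (Suc N) powr (1 - s) = of_nat (Suc N) * (of_nat (Suc N) :: complex) powr (- s)"
      by (simp add: powr_diff powr_minus field_simps del: of_nat_Suc)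
    have "(\<Sum>n<Suc N. of_nat (Suc N) powr (- s) / (- s) - of_nat (Suc n) powr (- s) / (- s))
      = of_nat (Suc N) * of_nat (Suc N) powr (- s) / (- s) - (\<Sum>n<Suc N. of_nat (Suc n) powr (- s)) / (- s)"
      unfolding sum_subtractf sum_divide_distrib[symmetric] by simp
    also have "\<dots> = ((\<Sum>n<N. of_nat (Suc n) powr (- s)) + of_nat (Suc N) powr (- s) - of_nat (Suc N) powr (1 - s)) / s"
      unfolding p by (simp add: diff_divide_distrib add_divide_distrib)
    finally have *: "(\<Sum>n<Suc N. of_nat (Suc N) powr (- s) / (- s) - of_nat (Suc n) powr (- s) / (- s))
      = ((\<Sum>n<N. of_nat (Suc n) powr (- s)) + of_nat (Suc N) powr (- s) - of_nat (Suc N) powr (1 - s)) / s" .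
    show ?thesis
      unfolding has_bochner_integral_integral_eq[OF tN] * by (rule geometric_tail_algebra[OF s])
  qed
  have p0: "(\<lambda>N. (of_nat (Suc N) :: complex) powr (- s)) \<longlonglongrightarrow> 0"
  proof -
    have "(\<lambda>N. real (Suc N) powr (- Re s)) \<longlonglongrightarrow> 0" using assms by real_asymp
    then show ?thesis by (subst tendsto_norm_zero_iff[symmetric], subst norm_of_nat_powr) simp
  qed
  have "(\<lambda>N. \<integral>w. t N w \<partial>lborel) \<longlonglongrightarrow> - (zeta_reg s + (s - 1) * 0) / (s - 1) / s"
    unfolding val using s by (intro tendsto_intros zeta_reg_LIMSEQ assms p0) auto
  with lim have "(\<integral>w. r w \<partial>lborel) = - zeta_reg s / (s - 1) / s"
    using LIMSEQ_unique by fastforce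
  with br show "(\<integral>w. b w \<partial>lborel) = - zeta_reg s / (s - 1) / s" by simp
qed

section \<open>Mellin and Muentz transforms of a good kernel\<close>

context
  fixes f f' :: "real \<Rightarrow> complex"
  assumes deriv: "\<forall>x\<ge>0. (f has_vector_derivative f' x) (at x within {0..})"
    and contf': "continuous_on {0..} f'"
    and tends: "(f \<longlongrightarrow> 0) at_top"
    and fin: "set_nn_integral lborel {0<..} (\<lambda>t. ennreal (t * norm (f' t))) < \<infinity>"
begin

lemma kernel_measurable:
  "set_borel_measurable lborel {0<..} f" "set_borel_measurable lborel {0<..} f'"
  "(\<lambda>v. f' (exp v)) \<in> borel_measurable borel"
proof -
  have "continuous_on {0..} f"
    using deriv by (auto simp: continuous_on_eq_continuous_within intro: has_vector_derivative_continuous)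
  then have "continuous_on {0<..} f" "continuous_on {0<..} f'"
    using contf' by (auto elim: continuous_on_subset)
  then show "set_borel_measurable lborel {0<..} f" "set_borel_measurable lborel {0<..} f'"
    unfolding set_borel_measurable_def by (auto intro!: borel_measurable_continuous_on_indicator)
  show "(\<lambda>v. f' (exp v)) \<in> borel_measurable borel"
    by (intro borel_measurable_continuous_onI continuous_on_compose2[OF contf'] continuous_intros) auto
qed

lemma integrable_deriv_exp2: "integrable lborel (\<lambda>v. exp (2 * of_real v) * f' (exp v))"
proof -
  have m: "set_borel_measurable lborel {0<..} (\<lambda>t. t *\<^sub>R f' t)"
    using set_borel_measurable_mellin[OF kernel_measurable(2), of 1]
    unfolding set_borel_measurable_def by (rule measurable_cong[THEN iffD1, rotated]) (auto simp: scaleR_conv_of_real indicator_def)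
  have "set_integrable lborel {0<..} (\<lambda>t. t *\<^sub>R f' t)"
    unfolding set_integrable_def
  proof (rule integrableI_bounded)
    show "(\<lambda>x. indicat_real {0<..} x *\<^sub>R x *\<^sub>R f' x) \<in> borel_measurable lborel"
      using m by (simp add: set_borel_measurable_def)
    have "(\<integral>\<^sup>+ x. ennreal (norm (indicat_real {0<..} x *\<^sub>R x *\<^sub>R f' x)) \<partial>lborel)
        = set_nn_integral lborel {0<..} (\<lambda>t. ennreal (t * norm (f' t)))"
      by (intro nn_integral_cong) (auto simp: indicator_def)
    with fin show "(\<integral>\<^sup>+ x. ennreal (norm (indicat_real {0<..} x *\<^sub>R x *\<^sub>R f' x)) \<partial>lborel) < \<infinity>" by simp
  qed
  then have "integrable lborel (\<lambda>u. exp u *\<^sub>R (exp u *\<^sub>R f' (exp u)))"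
    using exp_substitution(1)[OF m] by simp
  moreover have "exp u *\<^sub>R (exp u *\<^sub>R z) = exp (2 * of_real u) * z" for u and z :: complex
  proof -
    have "exp (2 * complex_of_real u) = of_real (exp u) * of_real (exp u)"
      by (simp only: exp_double power2_eq_square exp_of_real)
    then show ?thesis by (simp add: scaleR_conv_of_real)
  qed
  ultimately show ?thesis by simp
qed

text \<open>For v \<le> 0 the derivative is bounded by compactness and the exponential decays; for v
  > 0 the exponential is at most that of \<open>integrable_deriv_exp2\<close>.\<close>

lemma integrable_deriv_exp:
  assumes "0 \<le> Re s" "Re s \<le> 1"
  shows "integrable lborel (\<lambda>v. exp ((s + 1) * of_real v) * f' (exp v))"
proof -
  have "compact (f' ` {0..1})"
    using contf' by (intro compact_continuous_image) (auto elim: continuous_on_subset)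
  then obtain M where M: "\<And>x. x \<in> {0..1} \<Longrightarrow> norm (f' x) \<le> M"
    by (meson compact_imp_bounded bounded_iff imageI)
  have i0: "integrable lborel (\<lambda>v. indicator {..0} v *\<^sub>R exp ((s + 1) * of_real v))"
    using integral_exp_Iic[of "s + 1" 0] assms by (auto simp: has_bochner_integral_iff)
  have "integrable lborel (\<lambda>v. norm (exp (2 * of_real v) * f' (exp v))
           + M * norm (indicator {..0} v *\<^sub>R exp ((s + 1) * of_real v)))"
    by (intro Bochner_Integration.integrable_add integrable_norm Bochner_Integration.integrable_mult_right
          integrable_deriv_exp2 i0)
  then show ?thesis
  proof (rule Bochner_Integration.integrable_bound)
    show "(\<lambda>v. exp ((s + 1) * complex_of_real v) * f' (exp v)) \<in> borel_measurable lborel"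
      using kernel_measurable(3) by measurable
    have "norm (exp ((s + 1) * complex_of_real v) * f' (exp v))
         \<le> norm (exp (2 * of_real v) * f' (exp v)) + M * norm (indicator {..0} v *\<^sub>R exp ((s + 1) * of_real v))" for v
    proof (cases "v \<le> 0")
      case True
      then have "norm (f' (exp v)) \<le> M" by (intro M) auto
      from mult_right_mono[OF this, of "norm (exp ((s + 1) * of_real v))"]
      show ?thesis using True by (simp add: norm_mult mult.commute add_increasing)
    next
      case False
      then have "(Re s + 1) * v \<le> 2 * v" using assms by (intro mult_right_mono) auto
      then have "norm (exp ((s + 1) * complex_of_real v)) \<le> norm (exp (2 * complex_of_real v))" by simp
      from mult_right_mono[OF this, of "norm (f' (exp v))"] show ?thesis
        using False by (simp add: norm_mult)
    qed
    then show "AE v in lborel. norm (exp ((s + 1) * complex_of_real v) * f' (exp v))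
         \<le> norm (norm (exp (2 * of_real v) * f' (exp v)) + M * norm (indicator {..0} v *\<^sub>R exp ((s + 1) * of_real v)))"
      by (intro AE_I2) (metis abs_ge_self order_trans real_norm_def)
  qed
qed

text \<open>The fundamental theorem of calculus taken from infinity, where f tends to 0. Written
  with an indicator it presents f as a superposition of step functions weighted by
  \<open>f'\<close>; both f and its Muentz transform thereby become convolutions of
  \<open>f'\<close> with explicit functions.\<close>

lemma kernel_eq_integral_deriv:
  "integrable lborel (\<lambda>v. indicator {u..} v *\<^sub>R (exp (of_real v) * f' (exp v)))"
  "f (exp u) = - (\<integral>v. indicator {u..} v *\<^sub>R (exp (of_real v) * f' (exp v)) \<partial>lborel)"
proof -
  let ?g = "\<lambda>v. exp (of_real v) * f' (exp v)"
  have gm[measurable]: "?g \<in> borel_measurable borel" using kernel_measurable(3) by measurable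
  have I: "integrable lborel (\<lambda>v. norm (of_real (exp (-u)) * (exp (2 * of_real v) * f' (exp v))))"
    by (intro integrable_norm Bochner_Integration.integrable_mult_right integrable_deriv_exp2)
  have bd: "norm (indicator {u..} v *\<^sub>R ?g v) \<le> norm (of_real (exp (-u)) * (exp (2 * of_real v) * f' (exp v)))" for v
  proof (cases "u \<le> v")
    case True
    have "exp v \<le> exp (- u) * exp (2 * v)" using True by (simp add: exp_add[symmetric])
    from mult_right_mono[OF this, of "norm (f' (exp v))"] show ?thesis
      using True by (simp add: norm_mult mult.assoc)
  qed (simp add: norm_mult)
  show int: "integrable lborel (\<lambda>v. indicator {u..} v *\<^sub>R ?g v)"
    by (rule Bochner_Integration.integrable_bound[OF I]) (use bd in auto)
  have cg: "continuous_on UNIV ?g"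
    by (intro continuous_intros continuous_on_compose2[OF contf']) auto
  have dg: "((\<lambda>v. f (exp v)) has_vector_derivative ?g v) (at v within S)" for v S
  proof -
    have "(f has_vector_derivative f' (exp v)) (at (exp v) within {0..})" by (intro deriv[rule_format]) simp
    moreover have "at (exp v) within {0..} = at (exp v)"
      by (rule at_within_interior) auto
    ultimately have 1: "(f has_vector_derivative f' (exp v)) (at (exp v))" by simp
    have "(exp has_vector_derivative exp v) (at v)"
      unfolding has_real_derivative_iff_has_vector_derivative[symmetric] by (rule DERIV_exp)
    from vector_diff_chain_at[OF this 1] show ?thesis
      by (simp add: o_def scaleR_conv_of_real exp_of_real has_vector_derivative_at_within)
  qed
  have ftc: "(\<integral>v. indicator {u..u + real n} v *\<^sub>R ?g v \<partial>lborel) = f (exp (u + real n)) - f (exp u)" for n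
    by (rule integral_FTC_Icc) (auto intro: dg continuous_on_subset[OF cg])
  have l1: "(\<lambda>n. \<integral>v. indicator {u..u + real n} v *\<^sub>R ?g v \<partial>lborel) \<longlonglongrightarrow> (\<integral>v. indicator {u..} v *\<^sub>R ?g v \<partial>lborel)"
  proof (rule integral_dominated_convergence[OF _ _ integrable_norm[OF int]])
    show "AE v in lborel. (\<lambda>n. indicator {u..u + real n} v *\<^sub>R ?g v) \<longlonglongrightarrow> indicator {u..} v *\<^sub>R ?g v"
    proof (rule AE_I2)
      fix v :: real
      have "eventually (\<lambda>n. v - u \<le> real n) sequentially"
        by (rule eventually_sequentiallyI[of "nat \<lceil>v - u\<rceil>"]) linarith
      then have "eventually (\<lambda>n. indicator {u..u + real n} v *\<^sub>R ?g v = indicator {u..} v *\<^sub>R ?g v) sequentially"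
        by eventually_elim (auto simp: indicator_def)
      then show "(\<lambda>n. indicator {u..u + real n} v *\<^sub>R ?g v) \<longlonglongrightarrow> indicator {u..} v *\<^sub>R ?g v"
        by (rule tendsto_eventually)
    qed
    show "AE v in lborel. norm (indicator {u..u + real n} v *\<^sub>R ?g v) \<le> norm (indicator {u..} v *\<^sub>R ?g v)" for n
      by (auto simp: indicator_def)
  qed measurable
  have "filterlim (\<lambda>n. exp (u + real n)) at_top sequentially" by real_asymp
  from filterlim_compose[OF tends this]
  have "(\<lambda>n. f (exp (u + real n)) - f (exp u)) \<longlonglongrightarrow> 0 - f (exp u)" by (intro tendsto_intros)
  with l1 have "(\<integral>v. indicator {u..} v *\<^sub>R ?g v \<partial>lborel) = - f (exp u)"
    unfolding ftc using LIMSEQ_unique by fastforce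
  then show "f (exp u) = - (\<integral>v. indicator {u..} v *\<^sub>R ?g v \<partial>lborel)" by simp
qed

text \<open>Integration by parts in convolution form: f is minus the convolution of
  \<open>f'\<close> with a step function, whose transform is 1/s. The case s = 1 yields the integral
  of f in the Muentz operator.\<close>

lemma mellin_kernel:
  assumes "0 < Re s" "Re s \<le> 1"
  shows "integrable lborel (\<lambda>u. exp (s * of_real u) * f (exp u))"
    and "s * mellin f s = - (\<integral>v. exp ((s + 1) * of_real v) * f' (exp v) \<partial>lborel)"
proof -
  let ?a = "\<lambda>v. exp ((s + 1) * of_real v) * f' (exp v)"
  let ?c = "\<lambda>w::real. indicator {..0} w *\<^sub>R exp (s * of_real w)"
  have c: "integrable lborel ?c" "(\<integral>w. ?c w \<partial>lborel) = 1 / s"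
    using integral_exp_Iic[of s 0] assms by (auto simp: has_bochner_integral_iff)
  note conv = convolution_integral[OF integrable_deriv_exp[OF less_imp_le[OF assms(1)] assms(2)] c(1)]
  have "?a v * ?c (u - v) = exp (s * of_real u) * (indicator {u..} v *\<^sub>R (exp (of_real v) * f' (exp v)))" for u v
  proof -
    have "exp ((s + 1) * of_real v) * exp (s * of_real (u - v)) = exp (s * of_real u) * exp (of_real v)"
      by (simp add: exp_add[symmetric] algebra_simps)
    then show ?thesis by (simp add: indicator_def mult.assoc mult.left_commute)
  qed
  then have eq: "(\<integral>v. ?a v * ?c (u - v) \<partial>lborel) = - (exp (s * of_real u) * f (exp u))" for u
    unfolding kernel_eq_integral_deriv(2)[of u] by (simp only: integral_mult_right_zero mult_minus_right minus_minus)
  show "integrable lborel (\<lambda>u. exp (s * of_real u) * f (exp u))"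
    using conv(1) unfolding eq by simp
  show "s * mellin f s = - (\<integral>v. ?a v \<partial>lborel)"
  proof -
    have "s \<noteq> 0" using assms by auto
    then show ?thesis
      using conv(2) unfolding eq mellin_exp(2)[OF kernel_measurable(1)] c(2)
      by (simp add: eq_divide_eq mult.commute minus_equation_iff)
  qed
qed

text \<open>Summing f(nx) = - (integral of \<open>f'\<close> over t \<ge> nx) over n counts each t
  exactly floor(t/x) times, while the integral of f divided by x is minus the integral of (t/x)
  f'(t). What remains is the fractional part of t/x.\<close>

lemma muentz_exp:
  "muentz f (exp u) = (\<integral>v. of_real (frac (exp (v - u))) * (exp (of_real v) * f' (exp v)) \<partial>lborel)"
proof -
  let ?g = "\<lambda>v. exp (of_real v) * f' (exp v)"
  have gm[measurable]: "?g \<in> borel_measurable borel" using kernel_measurable(3) by measurable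
  have I: "integrable lborel (\<lambda>v. of_real (exp (v - u)) * ?g v)"
  proof -
    have "integrable lborel (\<lambda>v. of_real (exp (-u)) * (exp (2 * of_real v) * f' (exp v)))"
      by (intro Bochner_Integration.integrable_mult_right integrable_deriv_exp2)
    then show ?thesis unfolding exp_shift_factor .
  qed
  have part: "(\<Sum>n<N. f (real (Suc n) * exp u))
      = - (\<integral>v. (\<Sum>n<N. indicator {real (Suc n)..} (exp (v - u))) *\<^sub>R ?g v \<partial>lborel)" for N
  proof -
    have ind: "indicator {u + ln (real (Suc n))..} v = (indicator {real (Suc n)..} (exp (v - u)) :: real)" for n v
    proof -
      have "real (Suc n) \<le> exp (v - u) \<longleftrightarrow> ln (real (Suc n)) \<le> v - u"
        by (metis exp_ln exp_le_cancel_iff of_nat_0_less_iff zero_less_Suc)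
      then show ?thesis by (simp add: indicator_def le_diff_eq add.commute)
    qed
    have ff: "f (real (Suc n) * exp u) = - (\<integral>v. indicator {real (Suc n)..} (exp (v - u)) *\<^sub>R ?g v \<partial>lborel)"
      and ii: "integrable lborel (\<lambda>v. indicator {real (Suc n)..} (exp (v - u)) *\<^sub>R ?g v)" for n
    proof -
      have "exp (u + ln (real (Suc n))) = real (Suc n) * exp u"
        by (simp add: exp_add)
      then show "f (real (Suc n) * exp u) = - (\<integral>v. indicator {real (Suc n)..} (exp (v - u)) *\<^sub>R ?g v \<partial>lborel)"
        using kernel_eq_integral_deriv(2)[of "u + ln (real (Suc n))"] unfolding ind by simp
      show "integrable lborel (\<lambda>v. indicator {real (Suc n)..} (exp (v - u)) *\<^sub>R ?g v)"
        using kernel_eq_integral_deriv(1)[of "u + ln (real (Suc n))"] unfolding ind .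
    qed
    show ?thesis unfolding ff scaleR_sum_left sum_negf using ii by (subst Bochner_Integration.integral_sum) auto
  qed
  \<comment> \<open>The floor is at most t/x, so the finiteness of the integral of t |f'(t)|
    dominates everything, including the partial sums below.\<close>
  have fl: "integrable lborel (\<lambda>v. of_int \<lfloor>exp (v - u)\<rfloor> *\<^sub>R ?g v)"
  proof (rule Bochner_Integration.integrable_bound[OF I])
    show "AE v in lborel. norm (of_int \<lfloor>exp (v - u)\<rfloor> *\<^sub>R ?g v) \<le> norm (of_real (exp (v - u)) * ?g v)"
      by (intro AE_I2) (auto simp: norm_mult intro!: mult_right_mono)
  qed measurable
  have "(\<lambda>N. \<integral>v. (\<Sum>n<N. indicator {real (Suc n)..} (exp (v - u))) *\<^sub>R ?g v \<partial>lborel)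
      \<longlonglongrightarrow> (\<integral>v. of_int \<lfloor>exp (v - u)\<rfloor> *\<^sub>R ?g v \<partial>lborel)"
  proof (rule integral_dominated_convergence[OF _ _ integrable_norm[OF I]])
    show "AE v in lborel. (\<lambda>N. (\<Sum>n<N. indicator {real (Suc n)..} (exp (v - u))) *\<^sub>R ?g v)
        \<longlonglongrightarrow> of_int \<lfloor>exp (v - u)\<rfloor> *\<^sub>R ?g v"
    proof (rule AE_I2)
      fix v :: real
      have "eventually (\<lambda>N. nat \<lfloor>exp (v - u)\<rfloor> \<le> N) sequentially" by (rule eventually_ge_at_top)
      then have "eventually (\<lambda>N. (\<Sum>n<N. indicator {real (Suc n)..} (exp (v - u))) *\<^sub>R ?g v
           = of_int \<lfloor>exp (v - u)\<rfloor> *\<^sub>R ?g v) sequentially"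
        by eventually_elim (subst sum_indicator_floor, auto simp: min_def)
      then show "(\<lambda>N. (\<Sum>n<N. indicator {real (Suc n)..} (exp (v - u))) *\<^sub>R ?g v)
        \<longlonglongrightarrow> of_int \<lfloor>exp (v - u)\<rfloor> *\<^sub>R ?g v" by (rule tendsto_eventually)
    qed
    show "AE v in lborel. norm ((\<Sum>n<N. indicator {real (Suc n)..} (exp (v - u))) *\<^sub>R ?g v)
        \<le> norm (of_real (exp (v - u)) * ?g v)" for N
    proof (rule AE_I2)
      fix v
      have "real (min N (nat \<lfloor>exp (v - u)\<rfloor>)) \<le> real (nat \<lfloor>exp (v - u)\<rfloor>)"
        by (simp only: of_nat_le_iff min.cobounded2)
      also have "\<dots> \<le> exp (v - u)" by simp
      finally have "real (min N (nat \<lfloor>exp (v - u)\<rfloor>)) \<le> exp (v - u)" .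
      then show "norm ((\<Sum>n<N. indicator {real (Suc n)..} (exp (v - u))) *\<^sub>R ?g v)
        \<le> norm (of_real (exp (v - u)) * ?g v)"
        by (subst sum_indicator_floor) (auto simp: norm_mult simp del: of_nat_min intro!: mult_right_mono)
    qed
  qed measurable
  from tendsto_minus[OF this] have "(\<lambda>n. f (real (Suc n) * exp u)) sums - (\<integral>v. of_int \<lfloor>exp (v - u)\<rfloor> *\<^sub>R ?g v \<partial>lborel)"
    unfolding sums_def part .
  then have 1: "(\<Sum>n. f (real (Suc n) * exp u)) = - (\<integral>v. of_int \<lfloor>exp (v - u)\<rfloor> *\<^sub>R ?g v \<partial>lborel)"
    by (simp add: sums_iff)
  have "set_lebesgue_integral lborel {0<..} f = mellin f 1"
    unfolding mellin_def by (rule set_lebesgue_integral_cong) auto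
  also have "\<dots> = - (\<integral>v. exp (2 * of_real v) * f' (exp v) \<partial>lborel)"
    using mellin_kernel(2)[of 1] by simp
  finally have "complex_of_real (1 / exp u) * set_lebesgue_integral lborel {0<..} f
      = - (\<integral>v. complex_of_real (1 / exp u) * (exp (2 * of_real v) * f' (exp v)) \<partial>lborel)" by simp
  also have "(\<lambda>v. complex_of_real (1 / exp u) * (exp (2 * of_real v) * f' (exp v))) = (\<lambda>v. of_real (exp (v - u)) * ?g v)"
    unfolding exp_shift_factor by (simp add: exp_minus field_simps)
  finally have 2: "complex_of_real (1 / exp u) * set_lebesgue_integral lborel {0<..} f
      = - (\<integral>v. of_real (exp (v - u)) * ?g v \<partial>lborel)" .
  have "muentz f (exp u) = (\<integral>v. of_real (exp (v - u)) * ?g v \<partial>lborel) - (\<integral>v. of_int \<lfloor>exp (v - u)\<rfloor> *\<^sub>R ?g v \<partial>lborel)"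
    unfolding muentz_def 1 2 by simp
  also have "\<dots> = (\<integral>v. of_real (exp (v - u)) * ?g v - of_int \<lfloor>exp (v - u)\<rfloor> *\<^sub>R ?g v \<partial>lborel)"
    using I fl by (rule Bochner_Integration.integral_diff[symmetric])
  finally show ?thesis by (simp add: frac_def algebra_simps scaleR_conv_of_real)
qed

text \<open>By \<open>muentz_exp\<close> the Muentz transform is a convolution, so two known
  transforms multiply: -s times that of f, and -\<zeta>(s)/s for the fractional part. The factors s
  cancel.\<close>

lemma muentz_mellin_kernel:
  assumes "0 < Re s" "Re s < 1"
  shows "integrable lborel (\<lambda>u. exp (s * of_real u) * muentz f (exp u))"
    and "(\<integral>u. exp (s * of_real u) * muentz f (exp u) \<partial>lborel) = zeta_reg s / (s - 1) * mellin f s"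
proof -
  let ?a = "\<lambda>v. exp ((s + 1) * of_real v) * f' (exp v)"
  let ?b = "\<lambda>w. exp (s * of_real w) * complex_of_real (frac (exp (- w)))"
  note b = frac_mellin[OF assms]
  have s1: "Re s \<le> 1" using assms by simp
  note conv = convolution_integral[OF integrable_deriv_exp[OF less_imp_le[OF assms(1)] s1] b(1)]
  have "?a v * ?b (u - v) = exp (s * of_real u) * (of_real (frac (exp (v - u))) * (exp (of_real v) * f' (exp v)))" for u v
  proof -
    have "exp ((s + 1) * of_real v) * exp (s * of_real (u - v)) = exp (s * of_real u) * exp (of_real v)"
      by (simp add: exp_add[symmetric] algebra_simps)
    then show ?thesis by (simp add: mult.assoc mult.left_commute)
  qed
  then have eq: "(\<integral>v. ?a v * ?b (u - v) \<partial>lborel) = exp (s * of_real u) * muentz f (exp u)" for u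
    unfolding muentz_exp by (simp only: integral_mult_right_zero)
  show "integrable lborel (\<lambda>u. exp (s * of_real u) * muentz f (exp u))"
    using conv(1) unfolding eq .
  have "(\<integral>v. ?a v \<partial>lborel) = - (s * mellin f s)" using mellin_kernel(2)[OF assms(1) s1] by simp
  then show "(\<integral>u. exp (s * of_real u) * muentz f (exp u) \<partial>lborel) = zeta_reg s / (s - 1) * mellin f s"
  proof -
    have "s \<noteq> 0" "s \<noteq> 1" using assms by auto
    then show ?thesis
      using conv(2) unfolding eq b(2) \<open>(\<integral>v. ?a v \<partial>lborel) = - (s * mellin f s)\<close> by (simp add: mult.commute)
  qed
qed

end

section \<open>The functional equation\<close>

text \<open>The partial fractions of the cotangent at z = iy. They come from the Gamma function:
  differentiating the reflection formula for \<open>rGamma\<close> gives \<psi>(1 - z) - \<psi>(z) =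
  pi cot (pi z), and the limit formula for the digamma function turns the left side into the
  series.\<close>

lemma sums_inverse_squares_shifted:
  fixes y :: real
  assumes "y > 0"
  shows "(\<lambda>n. 1 / ((real (Suc n))\<^sup>2 + y\<^sup>2)) sums (pi / y * (1 / (exp (2 * pi * y) - 1) + 1 / 2) - 1 / (2 * y\<^sup>2))"
proof -
  define z where "z = \<i> * complex_of_real y"
  define E where "E = exp (pi * y)"
  have E: "E > 1" using assms by (simp add: E_def)
  have z0: "z \<noteq> 0" using assms by (simp add: z_def)
  have npi: "z \<notin> \<int>\<^sub>\<le>\<^sub>0" "1 - z \<notin> \<int>\<^sub>\<le>\<^sub>0"
    using assms by (auto simp: z_def complex_is_Int_iff elim!: nonpos_Ints_cases simp: complex_eq_iff)
  have s: "sin (of_real pi * z) = complex_of_real (1 / E - E) / (2 * \<i>)" and c: "cos (of_real pi * z) = complex_of_real (1 / E + E) / 2"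
  proof -
    have "\<i> * (of_real pi * z) = - of_real (pi * y)" by (simp add: z_def complex_eq_iff)
    then have e: "exp (\<i> * (of_real pi * z)) = 1 / E" "exp (- (\<i> * (of_real pi * z))) = E"
      by (simp_all add: E_def exp_of_real[symmetric] exp_minus divide_simps)
    then show "sin (of_real pi * z) = complex_of_real (1 / E - E) / (2 * \<i>)" "cos (of_real pi * z) = complex_of_real (1 / E + E) / 2"
      by (simp_all add: sin_exp_eq cos_exp_eq)
  qed
  have s0: "sin (of_real pi * z) \<noteq> 0"
  proof -
    have "1 / E \<noteq> E" using E less_1_mult[OF E E] by (simp add: divide_simps)
    then have "complex_of_real (1 / E - E) \<noteq> 0" unfolding of_real_eq_0_iff by simp
    then show ?thesis unfolding s by simp
  qed
  have refl: "rGamma w * rGamma (1 - w) = sin (of_real pi * w) / of_real pi" for w :: complex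
    by (rule rGamma_reflection_complex)
  have d1: "((\<lambda>w. rGamma w * rGamma (1 - w)) has_field_derivative
      rGamma z * rGamma (1 - z) * (Digamma (1 - z) - Digamma z)) (at z)"
    using npi by (auto intro!: derivative_eq_intros has_field_derivative_rGamma_no_nonpos_int[THEN DERIV_chain2] has_field_derivative_rGamma_no_nonpos_int simp: algebra_simps)
  have d2: "((\<lambda>w. rGamma w * rGamma (1 - w)) has_field_derivative cos (of_real pi * z)) (at z)"
    unfolding refl by (auto intro!: derivative_eq_intros)
  have "sin (of_real pi * z) / of_real pi * (Digamma (1 - z) - Digamma z) = cos (of_real pi * z)"
    using DERIV_unique[OF d1 d2] unfolding refl .
  then have R: "Digamma (1 - z) - Digamma z = of_real pi * cos (of_real pi * z) / sin (of_real pi * z)"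
    using s0 by (simp add: field_simps)
  have P: "Digamma (1 + z) = Digamma z + 1 / z" using Digamma_plus1[OF z0] by (simp add: add.commute)
  \<comment> \<open>The logarithms in the two limits cancel. Using 1 + z instead of z makes the
    series start at 1; the correction 1/z is \<open>P\<close>.\<close>
  have "(\<lambda>m. (of_real (ln (real m)) - (\<Sum>n<m. inverse ((1 + z) + of_nat n)))
           - (of_real (ln (real m)) - (\<Sum>n<m. inverse ((1 - z) + of_nat n)))) \<longlonglongrightarrow> Digamma (1 + z) - Digamma (1 - z)"
    by (intro tendsto_diff Digamma_LIMSEQ) (auto simp: z_def complex_eq_iff)
  also have "(\<lambda>m. (of_real (ln (real m)) - (\<Sum>n<m. inverse ((1 + z) + of_nat n)))
           - (of_real (ln (real m)) - (\<Sum>n<m. inverse ((1 - z) + of_nat n))))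
        = (\<lambda>m. \<Sum>n<m. 2 * z * of_real (1 / ((real (Suc n))\<^sup>2 + y\<^sup>2)))"
  proof
    fix m
    have "inverse ((1 - z) + of_nat n) - inverse ((1 + z) + of_nat n) = 2 * z * of_real (1 / ((real (Suc n))\<^sup>2 + y\<^sup>2))" for n
    proof -
      have ne: "(1 - z) + of_nat n \<noteq> 0" "(1 + z) + of_nat n \<noteq> 0"
        using assms by (auto simp: z_def complex_eq_iff)
      have pr: "((1 - z) + of_nat n) * ((1 + z) + of_nat n) = of_real ((real (Suc n))\<^sup>2 + y\<^sup>2)"
        by (simp add: z_def algebra_simps power2_eq_square)
      have "inverse ((1 - z) + of_nat n) - inverse ((1 + z) + of_nat n)
          = 2 * z / (((1 - z) + of_nat n) * ((1 + z) + of_nat n))"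
        using ne by (simp add: inverse_eq_divide diff_frac_eq)
      then show ?thesis unfolding pr by simp
    qed
    then show "(of_real (ln (real m)) - (\<Sum>n<m. inverse ((1 + z) + of_nat n)))
           - (of_real (ln (real m)) - (\<Sum>n<m. inverse ((1 - z) + of_nat n)))
        = (\<Sum>n<m. 2 * z * of_real (1 / ((real (Suc n))\<^sup>2 + y\<^sup>2)))"
      by (simp add: sum_subtractf[symmetric] del: of_real_divide)
  qed
  finally have "(\<lambda>n. 2 * z * of_real (1 / ((real (Suc n))\<^sup>2 + y\<^sup>2))) sums (Digamma (1 + z) - Digamma (1 - z))"
    by (simp add: sums_def)
  from sums_divide[OF this, of "2 * z"] z0
  have S: "(\<lambda>n. complex_of_real (1 / ((real (Suc n))\<^sup>2 + y\<^sup>2))) sums ((Digamma (1 + z) - Digamma (1 - z)) / (2 * z))"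
    by simp
  have "Digamma (1 + z) - Digamma (1 - z) = 1 / z - of_real pi * (complex_of_real (1 / E + E) / 2) / (complex_of_real (1 / E - E) / (2 * \<i>))"
    using R P unfolding s c by (simp add: algebra_simps)
  also have "\<dots> / (2 * z) = complex_of_real (pi / y * (1 / (E * E - 1) + 1 / 2) - 1 / (2 * y\<^sup>2))"
  proof -
    have EE: "E * E \<noteq> 1" using E by (metis less_1_mult less_irrefl)
    have "(1 / E + E) / (1 / E - E) = - (1 + 2 / (E * E - 1))"
      using E EE by (simp add: divide_simps) (simp add: algebra_simps)
    then have q: "complex_of_real (1 / E + E) / complex_of_real (1 / E - E) = - of_real (1 + 2 * (1 / (E * E - 1)))"
      by (simp only: of_real_divide[symmetric] of_real_minus[symmetric]) simp
    have "P * (N / 2) / (D / (2 * \<i>)) = P * \<i> * (N / D)" for P N D :: complex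
      by (cases "D = 0") (simp_all add: field_simps)
    then have q2: "of_real pi * (complex_of_real (1 / E + E) / 2) / (complex_of_real (1 / E - E) / (2 * \<i>))
        = - (of_real pi * \<i> * of_real (1 + 2 * (1 / (E * E - 1))))"
      by (simp only: q mult_minus_right)
    have "(1 / z - - (of_real pi * \<i> * of_real (1 + 2 * T))) / (2 * z) = complex_of_real (pi / y * (T + 1 / 2) - 1 / (2 * y\<^sup>2))" for T :: real
      using assms by (simp add: z_def field_simps power2_eq_square)
    then show ?thesis unfolding q2 .
  qed
  also have "E * E = exp (2 * pi * y)" by (simp add: E_def exp_add[symmetric])
  finally show ?thesis using S by (simp only: sums_of_real_iff)
qed

section \<open>Gamma integrals in logarithmic coordinates\<close>

lemma Gamma_log_integral:
  assumes "Re z > 0"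
  shows "has_bochner_integral lborel (\<lambda>u. exp (z * of_real u) * of_real (exp (- exp u))) (Gamma z)"
proof -
  let ?f = "\<lambda>t. complex_of_real (exp (- t))"
  have m: "set_borel_measurable lborel {0<..} ?f"
    unfolding set_borel_measurable_def by measurable
  have eq: "complex_of_real t powr (z - 1) / of_real (exp t) = complex_of_real t powr (z - 1) * ?f t" for t
    by (simp add: exp_minus divide_inverse)
  note a = absolutely_integrable_Gamma_integral'[OF assms, unfolded eq]
  have "set_borel_measurable lborel {0<..} (\<lambda>t. complex_of_real t powr (z - 1) * ?f t)"
    by (rule set_borel_measurable_mellin[OF m])
  then have b: "set_integrable lborel {0<..} (\<lambda>t. complex_of_real t powr (z - 1) * ?f t)"
    using a unfolding set_integrable_def set_borel_measurable_def by (subst (asm) integrable_completion) auto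
  have "mellin ?f z = integral {0<..} (\<lambda>t. complex_of_real t powr (z - 1) * ?f t)"
    unfolding mellin_def by (rule set_borel_integral_eq_integral(2)[OF b])
  also have "\<dots> = Gamma z"
    using Gamma_integral_complex'[OF assms] unfolding eq by (rule integral_unique)
  finally show ?thesis
    using b mellin_exp[OF m, of z] by (simp add: has_bochner_integral_iff)
qed

lemma has_bochner_integral_shift:
  fixes f :: "real \<Rightarrow> complex"
  assumes "has_bochner_integral lborel f I"
  shows "has_bochner_integral lborel (\<lambda>u. f (u + c)) I"
  using lborel_has_bochner_integral_real_affine_iff[of 1 f I c] assms by (simp add: add.commute)

lemma Gamma_log_integral_scaled:
  assumes "Re z > 0" "c > 0"
  shows "has_bochner_integral lborel (\<lambda>u. exp (z * of_real u) * of_real (exp (- (c * exp u)))) (exp (- z * of_real (ln c)) * Gamma z)"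
proof -
  have e: "exp (- z * of_real (ln c)) * (exp (z * of_real (u + ln c)) * of_real (exp (- exp (u + ln c))))
      = exp (z * of_real u) * of_real (exp (- (c * exp u)))" for u
  proof -
    have "exp (- z * of_real (ln c)) * exp (z * of_real (u + ln c)) = exp (z * of_real u)"
      by (subst exp_add[symmetric]) (simp add: algebra_simps)
    moreover have "exp (u + ln c) = c * exp u" using assms by (simp add: exp_add)
    ultimately show ?thesis by (simp add: mult.assoc[symmetric])
  qed
  show ?thesis
    using has_bochner_integral_mult_right[OF has_bochner_integral_shift[OF Gamma_log_integral[OF assms(1)], of "ln c"], of "exp (- z * of_real (ln c))"]
    unfolding e by simp
qed

text \<open>The product of the two Gamma integrals is the integral of a convolution, and the inner
  integral is again a Gamma integral, at 1 with scale 1 + exp (-u). This supplies the transform of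
  the kernel 1/(1 + x^2).\<close>

lemma Gamma_product_integral:
  assumes "0 < Re a" "Re a < 1"
  shows "has_bochner_integral lborel (\<lambda>u. exp (a * of_real u) / of_real (1 + exp u)) (Gamma a * Gamma (1 - a))"
proof -
  let ?A = "\<lambda>v. exp (a * of_real v) * complex_of_real (exp (- exp v))"
  let ?B = "\<lambda>w. exp (- ((1 - a) * of_real w)) * complex_of_real (exp (- exp (- w)))"
  have A: "integrable lborel ?A" "(\<integral>v. ?A v \<partial>lborel) = Gamma a"
    using Gamma_log_integral[of a] assms by (auto simp: has_bochner_integral_iff)
  have "has_bochner_integral lborel ?B (Gamma (1 - a))"
    using lborel_has_bochner_integral_real_affine_iff[of "-1" "\<lambda>u. exp ((1 - a) * of_real u) * complex_of_real (exp (- exp u))" "Gamma (1 - a)" 0]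
      Gamma_log_integral[of "1 - a"] assms by simp
  then have B: "integrable lborel ?B" "(\<integral>v. ?B v \<partial>lborel) = Gamma (1 - a)"
    by (auto simp: has_bochner_integral_iff)
  have inner: "(\<integral>v. ?A v * ?B (u - v) \<partial>lborel) = exp (a * of_real u) / of_real (1 + exp u)" for u
  proof -
    define c where "c = 1 + exp (- u)"
    have c: "c > 0" by (simp add: c_def add_pos_pos)
    have pt: "?A v * ?B (u - v) = exp (- ((1 - a) * of_real u)) * (exp (1 * of_real v) * of_real (exp (- (c * exp v))))" for v
    proof -
      have "exp (- exp v) * exp (- exp (- (u - v))) = exp (- (c * exp v))"
        by (subst exp_add[symmetric]) (simp add: c_def algebra_simps exp_add[symmetric])
      moreover have "exp (a * of_real v) * exp (- ((1 - a) * of_real (u - v))) = exp (- ((1 - a) * of_real u)) * exp (1 * of_real v)"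
        by (subst (1 2) exp_add[symmetric]) (simp add: algebra_simps)
      ultimately have "(exp (a * of_real v) * exp (- ((1 - a) * of_real (u - v)))) * complex_of_real (exp (- exp v) * exp (- exp (- (u - v))))
         = exp (- ((1 - a) * of_real u)) * exp (1 * of_real v) * of_real (exp (- (c * exp v)))" by simp
      then show ?thesis by (simp only: of_real_mult mult_ac)
    qed
    have "(\<integral>v. ?A v * ?B (u - v) \<partial>lborel) = exp (- ((1 - a) * of_real u)) * (exp (- 1 * of_real (ln c)) * Gamma 1)"
      unfolding pt integral_mult_right_zero using has_bochner_integral_integral_eq[OF Gamma_log_integral_scaled[of 1 c]] c by simp
    also have "exp (- 1 * complex_of_real (ln c)) = 1 / of_real c"
      using c by (simp add: exp_minus exp_of_real divide_inverse)
    also have "exp (- ((1 - a) * of_real u)) = exp (a * of_real u) * of_real (exp (- u))"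
      by (simp add: exp_of_real[symmetric] exp_add[symmetric] algebra_simps)
    also have "exp (a * of_real u) * of_real (exp (- u)) * (1 / of_real c * Gamma 1) = exp (a * of_real u) * of_real (exp (- u) / c)"
      by simp
    also have "exp (- u) / c = 1 / (1 + exp u)"
      by (simp add: c_def exp_minus field_simps)
    finally show ?thesis by simp
  qed
  show ?thesis
    using convolution_integral[OF A(1) B(1)] unfolding inner A(2) B(2) by (simp add: has_bochner_integral_iff)
qed

lemma nn_integral_finite_by_inverse_square:
  assumes "\<And>t. t > 0 \<Longrightarrow> t * norm (f' t) \<le> C / (1 + t\<^sup>2)"
  shows "set_nn_integral lborel {0<..} (\<lambda>t. ennreal (t * norm (f' t))) < \<infinity>"
proof -
  have "set_integrable lborel {0<..} (\<lambda>x::real. inverse (1 + x\<^sup>2))"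
    using integrable_I0i_1_div_plus_square
    by (simp add: interval_lebesgue_integrable_def zero_ereal_def divide_inverse)
  then have i: "integrable lborel (\<lambda>x::real. C * (indicator {0<..} x * inverse (1 + x\<^sup>2)))"
    unfolding set_integrable_def by simp
  have "set_nn_integral lborel {0<..} (\<lambda>t. ennreal (t * norm (f' t)))
      \<le> (\<integral>\<^sup>+ x. ennreal (norm (C * (indicator {0<..} x * inverse (1 + x\<^sup>2)))) \<partial>lborel)"
  proof (intro nn_integral_mono)
    fix x :: real
    have "t * norm (f' t) \<le> norm (C * inverse (1 + t\<^sup>2))" if "t > 0" for t
      using assms[OF that] by (simp add: divide_inverse)
    then show "ennreal (x * norm (f' x)) * indicator {0<..} x \<le> ennreal (norm (C * (indicator {0<..} x * inverse (1 + x\<^sup>2))))"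
      by (auto simp: indicator_def intro!: ennreal_leI)
  qed
  also have "\<dots> < \<infinity>" using i unfolding integrable_iff_bounded by blast
  finally show ?thesis .
qed

section \<open>A pair of kernels dual under the cosine transform\<close>

definition exp_kernel :: "real \<Rightarrow> complex" where
  "exp_kernel x = of_real (exp (- (2 * pi * x)))"

text \<open>Twice the integral over t > 0 of exp (-2 pi t) cos (2 pi x t), the normalisation suited
  to Poisson summation over the integers.\<close>

definition poisson_kernel :: "real \<Rightarrow> complex" where
  "poisson_kernel x = of_real (1 / (pi * (1 + x\<^sup>2)))"

text \<open>The constant is 27 + 1: cubing y/3 \<le> exp (y/3) gives the 27, and y \<le> exp y the
  1.\<close>

lemma cube_mult_exp_le:
  fixes y :: real
  assumes "y \<ge> 0"
  shows "y * (1 + y\<^sup>2) * exp (- y) \<le> 28"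
proof -
  have "y / 3 \<le> exp (y / 3)" using exp_ge_add_one_self[of "y / 3"] by linarith
  then have "(y / 3) ^ 3 \<le> exp (y / 3) ^ 3" using assms by (intro power_mono) auto
  also have "exp (y / 3) ^ 3 = exp y" by (simp add: exp_of_nat_mult[symmetric])
  finally have 1: "y ^ 3 \<le> 27 * exp y" by (simp add: power_divide)
  have 2: "y \<le> exp y" using exp_ge_add_one_self[of y] by linarith
  have "y * (1 + y\<^sup>2) \<le> 28 * exp y" using 1 2 by (simp add: algebra_simps power2_eq_square power3_eq_cube)
  then show ?thesis by (simp add: exp_minus field_simps)
qed

lemma exp_kernel_good:
  defines "f' \<equiv> \<lambda>x. complex_of_real (- (2 * pi) * exp (- (2 * pi * x)))"
  shows "\<forall>x\<ge>0. (exp_kernel has_vector_derivative f' x) (at x within {0..})"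
    "continuous_on {0..} f'" "(exp_kernel \<longlongrightarrow> 0) at_top"
    "set_nn_integral lborel {0<..} (\<lambda>t. ennreal (t * norm (f' t))) < \<infinity>"
proof -
  show "\<forall>x\<ge>0. (exp_kernel has_vector_derivative f' x) (at x within {0..})"
    unfolding exp_kernel_def f'_def
    by (intro allI impI has_vector_derivative_of_real) (auto intro!: derivative_eq_intros)
  show "continuous_on {0..} f'" unfolding f'_def by (intro continuous_intros)
  have "((\<lambda>x. exp (- (2 * pi * x))) \<longlongrightarrow> 0) at_top" by real_asymp
  then show "(exp_kernel \<longlongrightarrow> 0) at_top"
    unfolding exp_kernel_def using tendsto_of_real by fastforce
  show "set_nn_integral lborel {0<..} (\<lambda>t. ennreal (t * norm (f' t))) < \<infinity>"
  proof (rule nn_integral_finite_by_inverse_square[where C = 28])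
    fix t :: real assume t: "t > 0"
    let ?y = "2 * pi * t"
    have "t\<^sup>2 \<le> ?y\<^sup>2"
      using t pi_gt3 by (intro power_mono) auto
    then have "?y * (1 + t\<^sup>2) * exp (- ?y) \<le> ?y * (1 + ?y\<^sup>2) * exp (- ?y)"
      using t by (intro mult_right_mono mult_left_mono) auto
    also have "\<dots> \<le> 28" using t by (intro cube_mult_exp_le) auto
    finally have "?y * exp (- ?y) \<le> 28 / (1 + t\<^sup>2)"
      by (subst pos_le_divide_eq) (simp_all only: mult_ac add_pos_nonneg zero_less_one zero_le_power2)
    moreover have "t * norm (f' t) = ?y * exp (- ?y)"
      unfolding f'_def norm_of_real by (simp add: abs_mult)
    ultimately show "t * norm (f' t) \<le> 28 / (1 + t\<^sup>2)" by (simp only:)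
  qed
qed

lemma poisson_kernel_good:
  defines "f' \<equiv> \<lambda>x. complex_of_real (- (2 * x) / (pi * (1 + x\<^sup>2)\<^sup>2))"
  shows "\<forall>x\<ge>0. (poisson_kernel has_vector_derivative f' x) (at x within {0..})"
    "continuous_on {0..} f'" "(poisson_kernel \<longlongrightarrow> 0) at_top"
    "set_nn_integral lborel {0<..} (\<lambda>t. ennreal (t * norm (f' t))) < \<infinity>"
proof -
  have p: "1 + x\<^sup>2 > 0" for x :: real by (simp add: add_pos_nonneg)
  then have ne: "1 + x\<^sup>2 \<noteq> 0" for x :: real using less_irrefl by metis
  show "\<forall>x\<ge>0. (poisson_kernel has_vector_derivative f' x) (at x within {0..})"
    unfolding poisson_kernel_def f'_def
    by (intro allI impI has_vector_derivative_of_real)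
       (use ne in \<open>auto intro!: derivative_eq_intros simp: power2_eq_square divide_simps\<close>)
  show "continuous_on {0..} f'" unfolding f'_def by (intro continuous_intros) (use ne in auto)
  have "((\<lambda>x. 1 / (pi * (1 + x\<^sup>2))) \<longlongrightarrow> 0) at_top" by real_asymp
  from tendsto_of_real[OF this, where 'a = complex] show "(poisson_kernel \<longlongrightarrow> 0) at_top"
    unfolding poisson_kernel_def by (simp only: of_real_0)
  show "set_nn_integral lborel {0<..} (\<lambda>t. ennreal (t * norm (f' t))) < \<infinity>"
  proof (rule nn_integral_finite_by_inverse_square[where C = 2])
    fix t :: real assume t: "t > 0"
    have "t * norm (f' t) = (2 * t\<^sup>2) / (pi * (1 + t\<^sup>2)\<^sup>2)"
      unfolding f'_def norm_of_real using t by (simp add: abs_mult power2_eq_square)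
    also have "\<dots> \<le> (2 * (1 + t\<^sup>2)) / (1 * (1 + t\<^sup>2)\<^sup>2)"
      using p[of t] pi_gt3 by (intro frac_le mult_mono) auto
    also have "\<dots> = 2 / (1 + t\<^sup>2)"
    proof -
      have "2 * q / (1 * q\<^sup>2) = 2 / q" if "q > 0" for q :: real
        using that by (simp add: power2_eq_square)
      then show ?thesis using p[of t] .
    qed
    finally show "t * norm (f' t) \<le> 2 / (1 + t\<^sup>2)" .
  qed
qed

lemma mellin_exp_kernel:
  assumes "0 < Re s"
  shows "mellin exp_kernel s = exp (- s * of_real (ln (2 * pi))) * Gamma s"
  using has_bochner_integral_integral_eq[OF Gamma_log_integral_scaled[OF assms, of "2 * pi"]]
  by (subst mellin_exp(2)[OF kernel_measurable(1)[OF exp_kernel_good]]) (simp add: exp_kernel_def)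

text \<open>The substitution x to x^2 reduces 1/(1 + x^2) to the 1/(1 + x) of
  \<open>Gamma_product_integral\<close>.\<close>

lemma mellin_poisson_kernel:
  assumes "0 < Re s" "Re s < 2"
  shows "mellin poisson_kernel s = Gamma (s / 2) * Gamma (1 - s / 2) / (2 * of_real pi)"
proof -
  have "has_bochner_integral lborel (\<lambda>u. exp (s / 2 * of_real (0 + 2 * u)) / of_real (1 + exp (0 + 2 * u)))
      ((Gamma (s / 2) * Gamma (1 - s / 2)) /\<^sub>R \<bar>2\<bar>)"
    by (subst lborel_has_bochner_integral_real_affine_iff[symmetric])
       (use Gamma_product_integral[of "s / 2"] assms in auto)
  note * = has_bochner_integral_mult_right[OF this, of "1 / of_real pi"]
  have pt: "1 / of_real pi * (exp (s / 2 * of_real (0 + 2 * u)) / of_real (1 + exp (0 + 2 * u)))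
      = exp (s * of_real u) * poisson_kernel (exp u)" for u
  proof -
    have "exp (0 + 2 * u) = (exp u)\<^sup>2" by (simp add: exp_double)
    then show ?thesis unfolding poisson_kernel_def by simp
  qed
  have "has_bochner_integral lborel (\<lambda>u. exp (s * of_real u) * poisson_kernel (exp u))
     (Gamma (s / 2) * Gamma (1 - s / 2) / (2 * of_real pi))"
    using * unfolding pt by (simp add: scaleR_conv_of_real mult.commute)
  then show ?thesis
    by (subst mellin_exp(2)[OF kernel_measurable(1)[OF poisson_kernel_good]]) (simp add: has_bochner_integral_iff)
qed

lemma set_integral_eq_mellin_1: "set_lebesgue_integral lborel {0<..} f = mellin f 1"
  unfolding mellin_def by (rule set_lebesgue_integral_cong) auto

text \<open>The cosine transform exchanges the two kernels, so their Muentz transforms are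
  related by the inversion $x \mapsto 1/x$; this is the partial fraction expansion of the cotangent.\<close>

lemma muentz_poisson_kernel_inversion:
  assumes "y > 0"
  shows "muentz poisson_kernel (1 / y) = of_real y * muentz exp_kernel y"
proof -
  define q where "q = exp (- (2 * pi * y))"
  have q: "0 < q" "q < 1" using assms by (auto simp: q_def)
  have "exp_kernel (real (Suc n) * y) = of_real (q * q ^ n)" for n
    by (simp add: exp_kernel_def q_def exp_of_nat_mult[symmetric] exp_add[symmetric] algebra_simps)
  moreover have "(\<lambda>n. q * q ^ n) sums (q * (1 / (1 - q)))"
    using q by (intro sums_mult geometric_sums) auto
  ultimately have sm: "(\<lambda>n. exp_kernel (real (Suc n) * y)) sums of_real (q * (1 / (1 - q)))"
    by (simp only: sums_of_real_iff)
  have s1: "(\<Sum>n. exp_kernel (real (Suc n) * y)) = of_real (1 / (exp (2 * pi * y) - 1))"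
  proof -
    have "exp (2 * pi * y) > 1" using assms by simp
    then have "q * (1 / (1 - q)) = 1 / (exp (2 * pi * y) - 1)"
      by (simp add: q_def exp_minus divide_simps)
    with sm show ?thesis
      by (simp only: sums_iff)
  qed
  have i1: "set_lebesgue_integral lborel {0<..} exp_kernel = of_real (1 / (2 * pi))"
  proof -
    have "exp (- 1 * complex_of_real (ln (2 * pi))) = of_real (exp (- ln (2 * pi)))"
      by (simp only: exp_of_real[symmetric]) simp
    also have "exp (- ln (2 * pi)) = 1 / (2 * pi)"
      by (simp add: exp_minus inverse_eq_divide)
    finally show ?thesis
      unfolding set_integral_eq_mellin_1 by (subst mellin_exp_kernel) simp_all
  qed
  have e1: "muentz exp_kernel y = of_real (1 / (exp (2 * pi * y) - 1) - 1 / (2 * pi * y))"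
    unfolding muentz_def s1 i1 by simp
  have "poisson_kernel (real (Suc n) * (1 / y)) = of_real (y\<^sup>2 / pi * (1 / ((real (Suc n))\<^sup>2 + y\<^sup>2)))" for n
    using assms unfolding poisson_kernel_def by (simp add: power_divide field_simps)
  moreover have "(\<lambda>n. y\<^sup>2 / pi * (1 / ((real (Suc n))\<^sup>2 + y\<^sup>2))) sums
      (y\<^sup>2 / pi * (pi / y * (1 / (exp (2 * pi * y) - 1) + 1 / 2) - 1 / (2 * y\<^sup>2)))"
    by (intro sums_mult sums_inverse_squares_shifted assms)
  ultimately have "(\<lambda>n. poisson_kernel (real (Suc n) * (1 / y))) sums
      of_real (y\<^sup>2 / pi * (pi / y * (1 / (exp (2 * pi * y) - 1) + 1 / 2) - 1 / (2 * y\<^sup>2)))"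
    by (simp only: sums_of_real_iff)
  then have s2: "(\<Sum>n. poisson_kernel (real (Suc n) * (1 / y)))
      = of_real (y\<^sup>2 / pi * (pi / y * (1 / (exp (2 * pi * y) - 1) + 1 / 2) - 1 / (2 * y\<^sup>2)))"
    by (simp only: sums_iff)
  have i2: "set_lebesgue_integral lborel {0<..} poisson_kernel = of_real (1 / 2)"
    unfolding set_integral_eq_mellin_1
    by (subst mellin_poisson_kernel) (auto simp: Gamma_one_half_complex of_real_mult[symmetric] simp del: of_real_mult)
  define T where "T = 1 / (exp (2 * pi * y) - 1)"
  have "muentz poisson_kernel (1 / y) = of_real (y\<^sup>2 / pi * (pi / y * (T + 1 / 2) - 1 / (2 * y\<^sup>2)) - y * (1 / 2))"
    unfolding muentz_def s2 i2 T_def by simp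
  \<comment> \<open>The 1/2 in the cotangent expansion is cancelled by the integral 1/2 of the
    Poisson kernel; its last term becomes the integral term of the exponential kernel.\<close>
  also have "y\<^sup>2 / pi * (pi / y * (T + 1 / 2) - 1 / (2 * y\<^sup>2)) - y * (1 / 2) = y * (T - 1 / (2 * pi * y))"
    using assms by (simp add: field_simps power2_eq_square)
  finally show ?thesis unfolding e1 by (simp add: T_def)
qed

text \<open>As \<open>zeta_reg\<close> contains the factor s - 1, this is s(s-1) pi^(-s/2)
  Gamma(s/2) \<zeta>(s), twice Riemann's \<xi>.\<close>

definition xi :: "complex \<Rightarrow> complex" where
  "xi s = s * zeta_reg s * (exp (- (s / 2) * of_real (ln pi)) * Gamma (s / 2))"

lemma Re_pos_notin_nonpos_Ints: "Re z > 0 \<Longrightarrow> z \<notin> \<int>\<^sub>\<le>\<^sub>0"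
  by (auto elim!: nonpos_Ints_cases)

lemma cross_multiply_shift:
  fixes s a b A B :: complex
  assumes "a / (s - 1) * A = b / (- s) * B" "s \<noteq> 0" "s \<noteq> 1"
  shows "s * a * A = (1 - s) * b * B"
proof -
  have "s * a * A = (s * (s - 1)) * (a / (s - 1) * A)" using assms(2,3) by simp
  also have "\<dots> = (s * (s - 1)) * (b / (- s) * B)" by (simp only: assms(1))
  also have "\<dots> = - ((s - 1) * b * B)" using assms(2,3) by simp
  finally show ?thesis by (simp only: mult_minus_left[symmetric] minus_diff_eq)
qed

text \<open>The inversion x to 1/x exchanges the Muentz transforms of the two kernels up to a
  factor, and on the Mellin side it exchanges s and 1 - s. The Muentz formula on both sides gives
  the unsymmetric functional equation \<open>eq\<close>; Legendre duplication makes it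
  symmetric.\<close>

theorem xi_functional_equation:
  assumes "0 < Re s" "Re s < 1"
  shows "xi s = xi (1 - s)"
proof -
  have s: "s \<noteq> 0" "s \<noteq> 1" using assms by auto
  have "(\<integral>u. exp (s * of_real u) * muentz poisson_kernel (exp u) \<partial>lborel)
      = (\<integral>u. exp (s * of_real (0 + -1 * u)) * muentz poisson_kernel (exp (0 + -1 * u)) \<partial>lborel)"
    using lborel_integral_real_affine[of "-1" "\<lambda>u. exp (s * of_real u) * muentz poisson_kernel (exp u)" 0] by simp
  also have "\<dots> = (\<integral>u. exp ((1 - s) * of_real u) * muentz exp_kernel (exp u) \<partial>lborel)"
  proof (intro Bochner_Integration.integral_cong refl)
    fix u :: real
    have "muentz poisson_kernel (exp (0 + -1 * u)) = of_real (exp u) * muentz exp_kernel (exp u)"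
      using muentz_poisson_kernel_inversion[of "exp u"] by (simp add: exp_minus divide_inverse)
    moreover have "exp (s * of_real (0 + -1 * u)) * of_real (exp u) = exp ((1 - s) * of_real u)"
      by (simp add: exp_of_real[symmetric] exp_add[symmetric] algebra_simps)
    ultimately show "exp (s * of_real (0 + -1 * u)) * muentz poisson_kernel (exp (0 + -1 * u)) = exp ((1 - s) * of_real u) * muentz exp_kernel (exp u)"
      by (simp only: mult.assoc[symmetric])
  qed
  finally have "zeta_reg s / (s - 1) * mellin poisson_kernel s = zeta_reg (1 - s) / ((1 - s) - 1) * mellin exp_kernel (1 - s)"
    using muentz_mellin_kernel(2)[OF poisson_kernel_good assms] muentz_mellin_kernel(2)[OF exp_kernel_good, of "1 - s"] assms
    by simp
  then have eq: "zeta_reg s / (s - 1) * (Gamma (s / 2) * Gamma (1 - s / 2) / (2 * of_real pi))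
     = zeta_reg (1 - s) / (- s) * (exp (- (1 - s) * of_real (ln (2 * pi))) * Gamma (1 - s))"
    using assms by (simp add: mellin_poisson_kernel mellin_exp_kernel)
  define G where "G = Gamma (1 - s / 2)"
  have G: "G \<noteq> 0"
    unfolding G_def using assms by (intro Gamma_nonzero Re_pos_notin_nonpos_Ints) simp
  have half: "(1 - s) / 2 + 1 / 2 = 1 - s / 2" "2 * ((1 - s) / 2) = 1 - s" "1 - (1 - s) = s"
    by (simp_all add: field_simps)
  have "Gamma ((1 - s) / 2) * Gamma ((1 - s) / 2 + 1 / 2)
      = exp ((1 - 2 * ((1 - s) / 2)) * of_real (ln 2)) * of_real (sqrt pi) * Gamma (2 * ((1 - s) / 2))"
    by (rule Gamma_legendre_duplication) (use assms in \<open>auto intro!: Re_pos_notin_nonpos_Ints add_pos_pos\<close>)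
  then have dup: "Gamma ((1 - s) / 2) * G = exp (s * of_real (ln 2)) * of_real (sqrt pi) * Gamma (1 - s)"
    unfolding half G_def .
  have sq: "complex_of_real (sqrt pi) = exp (of_real (ln pi / 2))"
    by (simp only: exp_of_real) (simp add: ln_sqrt[symmetric])
  have two_pi: "2 * of_real pi = exp (complex_of_real (ln (2 * pi)))"
    by (simp only: exp_of_real) simp
  have G1: "Gamma (1 - s) = Gamma ((1 - s) / 2) * G * exp (- s * of_real (ln 2) - of_real (ln pi / 2))"
    unfolding dup sq by (simp add: exp_diff exp_minus)
  have "s * zeta_reg s * (Gamma (s / 2) * G / (2 * of_real pi))
     = (1 - s) * zeta_reg (1 - s) * (exp (- (1 - s) * of_real (ln (2 * pi))) * Gamma (1 - s))"
    using eq s unfolding G_def[symmetric] by (intro cross_multiply_shift)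
  then have "s * zeta_reg s * Gamma (s / 2) * G
     = (1 - s) * zeta_reg (1 - s) * (exp (- (1 - s) * of_real (ln (2 * pi))) * Gamma (1 - s)) * (2 * of_real pi)"
    by (simp add: divide_simps mult.assoc)
  then have "(s * zeta_reg s * Gamma (s / 2)) * G
     = ((1 - s) * zeta_reg (1 - s) * Gamma ((1 - s) / 2) * (exp (- (1 - s) * of_real (ln (2 * pi)))
         * exp (- s * of_real (ln 2) - of_real (ln pi / 2)) * exp (of_real (ln (2 * pi))))) * G"
    unfolding G1 two_pi by (simp only: mult_ac)
  then have main: "s * zeta_reg s * Gamma (s / 2)
     = (1 - s) * zeta_reg (1 - s) * Gamma ((1 - s) / 2) * (exp (- (1 - s) * of_real (ln (2 * pi)))
         * exp (- s * of_real (ln 2) - of_real (ln pi / 2)) * exp (of_real (ln (2 * pi))))"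
    using G by simp
  have ex: "exp (- (s / 2) * of_real (ln pi)) * (exp (- (1 - s) * of_real (ln (2 * pi)))
         * exp (- s * of_real (ln 2) - of_real (ln pi / 2)) * exp (of_real (ln (2 * pi))))
      = exp (- ((1 - s) / 2) * of_real (ln pi))"
  proof -
    have l: "complex_of_real (ln (2 * pi)) = of_real (ln 2) + of_real (ln pi)" by (simp add: ln_mult)
    have "- (s / 2) * P + (- (1 - s) * (T + P) + (- s * T - P / 2) + (T + P)) = - ((1 - s) / 2) * P" for T P :: complex
      by (simp add: field_simps)
    then show ?thesis unfolding l by (simp only: exp_add[symmetric] of_real_divide of_real_numeral)
  qed
  have "xi s = (s * zeta_reg s * Gamma (s / 2)) * exp (- (s / 2) * of_real (ln pi))"
    unfolding xi_def by (simp only: mult_ac)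
  also have "\<dots> = (1 - s) * zeta_reg (1 - s) * Gamma ((1 - s) / 2) *
      (exp (- (s / 2) * of_real (ln pi)) * (exp (- (1 - s) * of_real (ln (2 * pi)))
         * exp (- s * of_real (ln 2) - of_real (ln pi / 2)) * exp (of_real (ln (2 * pi)))))"
    unfolding main by (simp only: mult_ac)
  also have "\<dots> = xi (1 - s)" unfolding ex xi_def by (simp only: mult_ac)
  finally show ?thesis .
qed

section \<open>Zeros on the line of real part one\<close>

text \<open>Absolute summability over pairs (d, m) of positive integers permits grouping by the
  product n = dm. The index 0 is kept out because this grouping is a bijection only for positive
  integers.\<close>

lemma dirichlet_convolution_sums:
  fixes a b :: "nat \<Rightarrow> complex"
  assumes a: "summable (\<lambda>n. norm (a n))" "a sums A" "a 0 = 0"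
    and b: "summable (\<lambda>n. norm (b n))" "b sums B" "b 0 = 0"
  shows "(\<lambda>n. \<Sum>d | d dvd n. a d * b (n div d)) sums (A * B)"
proof -
  define I where "I = {1::nat..}"
  have hs: "(a has_sum A) I" "(b has_sum B) I"
    using norm_summable_imp_has_sum[OF a(1,2)] norm_summable_imp_has_sum[OF b(1,2)] a(3) b(3)
    by (subst has_sum_cong_neutral[where T = UNIV and g = "\<lambda>n. _ n"]; auto simp: I_def not_less_eq_eq)+
  have abs: "(\<lambda>n. norm (a n)) summable_on I" "(\<lambda>n. norm (b n)) summable_on I"
    using norm_summable_imp_summable_on[of "\<lambda>n. norm (a n)"] norm_summable_imp_summable_on[of "\<lambda>n. norm (b n)"] a(1) b(1)
    by (auto elim: summable_on_subset_banach)
  have "(\<lambda>x. norm (case x of (d, m) \<Rightarrow> a d * b m)) summable_on (I \<times> I)"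
    by (rule summable_on_SigmaI[where g = "\<lambda>d. norm (a d) * infsum (\<lambda>m. norm (b m)) I"])
       (auto simp: norm_mult intro!: has_sum_cmult_right summable_on_cmult_left abs has_sum_infsum)
  then have sm: "(\<lambda>(d, m). a d * b m) summable_on (I \<times> I)" by (rule abs_summable_summable)
  have "((\<lambda>(d, m). a d * b m) has_sum (A * B)) (I \<times> I)"
    by (rule has_sum_SigmaI[OF _ _ sm, where g = "\<lambda>d. a d * B"])
       (auto intro!: has_sum_cmult_right has_sum_cmult_left hs)
  also have "?this \<longleftrightarrow> ((\<lambda>(n, d). a d * b (n div d)) has_sum (A * B)) (Sigma I (\<lambda>n. {d. d dvd n}))"
    by (rule has_sum_reindex_bij_witness[where i = "\<lambda>(n, d). (d, n div d)" and j = "\<lambda>(d, m). (d * m, d)"])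
       (auto simp: I_def dvd_div_eq_0_iff Suc_le_eq)
  finally have "((\<lambda>n. \<Sum>d | d dvd n. a d * b (n div d)) has_sum (A * B)) I"
    by (rule has_sum_SigmaD) (auto simp: I_def intro!: has_sum_finiteI)
  \<comment> \<open>At n = 0 every number is a divisor, and the sum over this infinite set has the
    default value 0.\<close>
  then have "((\<lambda>n. \<Sum>d | d dvd n. a d * b (n div d)) has_sum (A * B)) UNIV"
    by (subst has_sum_cong_neutral[where T = I and g = "\<lambda>n. \<Sum>d | d dvd n. a d * b (n div d)"])
       (auto simp: I_def not_less_eq_eq)
  then show ?thesis by (rule has_sum_imp_sums)
qed

section \<open>The von Mangoldt series\<close>

lemma mangoldt_bounds: "0 \<le> (mangoldt n :: real)" "mangoldt n \<le> ln (real n)"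
proof -
  have nn: "0 \<le> (mangoldt n :: real)" for n
    using aprimedivisor_pos_nat[of n] primepow_gt_Suc_0[of n]
    by (auto simp: mangoldt_def Suc_le_eq intro!: ln_ge_zero)
  show "0 \<le> (mangoldt n :: real)" by (rule nn)
  show "mangoldt n \<le> ln (real n)"
  proof (cases "n = 0")
    case False
    have "(mangoldt n :: real) \<le> (\<Sum>d | d dvd n. mangoldt d)"
      using False nn by (intro member_le_sum) auto
    also have "\<dots> = ln (real n)" using mangoldt_sum[OF False, where 'a = real] by simp
    finally show ?thesis .
  qed simp
qed

lemma summable_ln_powr:
  assumes "a > (1 :: real)"
  shows "summable (\<lambda>n. ln (real n) * real n powr (- a))"
proof (rule summable_comparison_test)
  \<comment> \<open>Half of the margin a - 1 absorbs the logarithm, and the other half keeps the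
    series convergent.\<close>
  define e where "e = (a - 1) / 2"
  have e: "e > 0" using assms by (simp add: e_def)
  show "summable (\<lambda>n. real n powr (e - a) / e)"
    using assms by (intro summable_divide) (simp add: summable_real_powr_iff e_def field_simps)
  have "norm (ln (real n) * real n powr (- a)) \<le> real n powr (e - a) / e" if "n \<ge> 1" for n
  proof -
    have "ln (real n) * real n powr (- a) \<le> (real n powr e / e) * real n powr (- a)"
      using that e by (intro mult_right_mono ln_powr_bound) auto
    also have "\<dots> = real n powr (e - a) / e" by (simp add: powr_diff powr_minus field_simps)
    finally show ?thesis using that by (simp add: abs_mult)
  qed
  then show "\<exists>N. \<forall>n\<ge>N. norm (ln (real n) * real n powr (- a)) \<le> real n powr (e - a) / e" by blast
qed

definition mangoldt_series :: "complex \<Rightarrow> complex" where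
  "mangoldt_series s = (\<Sum>n. mangoldt n * of_nat n powr (- s))"

lemma norm_of_nat_powr': "norm ((of_nat n :: complex) powr s) = real n powr Re s"
  by (cases "n = 0") (auto simp: norm_powr_real_powr)

lemma norm_mangoldt: "norm (mangoldt n :: complex) = mangoldt n"
proof -
  have "(mangoldt n :: complex) = of_real (mangoldt n)" by simp
  then show ?thesis using mangoldt_bounds(1)[of n] by (metis norm_of_real abs_of_nonneg)
qed

lemma summable_mangoldt_series:
  assumes "Re s > 1"
  shows "summable (\<lambda>n. norm (mangoldt n * of_nat n powr (- s) :: complex))"
proof (rule summable_comparison_test[OF _ summable_ln_powr[OF assms]])
  show "\<exists>N. \<forall>n\<ge>N. norm (norm (mangoldt n * of_nat n powr (- s) :: complex)) \<le> ln (real n) * real n powr (- Re s)"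
    using mangoldt_bounds
    by (intro exI[of _ 0]) (auto simp: norm_mult norm_of_nat_powr' norm_mangoldt abs_mult intro!: mult_right_mono)
qed

lemma zeta_sums:
  assumes "Re s > 1"
  shows "(\<lambda>n. of_nat n powr (- s)) sums (zeta_reg s / (s - 1))"
    and "summable (\<lambda>n. norm (of_nat n powr (- s) :: complex))"
proof -
  have s: "s - 1 \<noteq> 0" using assms by auto
  show "summable (\<lambda>n. norm (of_nat n powr (- s) :: complex))"
    using dirichlet_series_zeta(1)[OF assms] by (subst (asm) summable_Suc_iff)
  have "(\<lambda>n. of_nat (Suc n) powr (- s) :: complex) sums (zeta_reg s / (s - 1))"
    using summable_sums[OF summable_norm_cancel[OF dirichlet_series_zeta(1)[OF assms]]]
      dirichlet_series_zeta(2)[OF assms] s by simp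
  from sums_Suc_imp[OF _ this] show "(\<lambda>n. of_nat n powr (- s)) sums (zeta_reg s / (s - 1))" by simp
qed

text \<open>The divisor sums of the von Mangoldt function are logarithms, so the series times
  \<zeta> is -\<zeta>'. In terms of \<open>zeta_reg\<close> this says that the series is 1/(s-1)
  minus the logarithmic derivative of \<open>zeta_reg\<close>, multiplied out so that no division by
  a possible zero occurs.\<close>

lemma mangoldt_series_eq:
  assumes "Re s > 1"
  shows "mangoldt_series s * zeta_reg s = zeta_reg s / (s - 1) - deriv zeta_reg s"
proof -
  \<comment> \<open>Strictly between 1 and Re s, so that on the open half plane right of
    \<open>a\<close> the Dirichlet series has one summable majorant and may be differentiated
    termwise.\<close>
  define a where "a = (1 + Re s) / 2"
  have a: "a > 1" "Re s > a" using assms by (auto simp: a_def)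
  let ?S = "{z. Re z > a}"
  have S: "open ?S" by (rule open_halfspace_Re_gt)
  obtain g g' where g: "\<forall>x\<in>?S. ((\<lambda>n. of_nat (Suc n) powr (- x)) sums g x) \<and>
      ((\<lambda>n. - of_real (ln (real (Suc n))) * of_nat (Suc n) powr (- x)) sums g' x) \<and> (g has_field_derivative g' x) (at x)"
  proof (rule series_and_derivative_comparison[OF S, where f = "\<lambda>n x. of_nat (Suc n) powr (- x)"
        and f' = "\<lambda>n x. - of_real (ln (real (Suc n))) * of_nat (Suc n) powr (- x)" and h = "\<lambda>n. real (Suc n) powr (- a)"])
    show "summable (\<lambda>n. real (Suc n) powr (- a))" using a by (intro summable_Suc_powr) auto
    show "((\<lambda>x. of_nat (Suc n) powr (- x)) has_field_derivative - of_real (ln (real (Suc n))) * of_nat (Suc n) powr (- x)) (at x)" for n and x :: complex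
    proof -
      have l: "Ln (of_nat (Suc n)) = of_real (ln (real (Suc n)))"
        by (metis Ln_of_real of_nat_0_less_iff of_real_of_nat_eq zero_less_Suc)
      have "(\<lambda>x :: complex. of_nat (Suc n) powr (- x)) = (\<lambda>x. exp (- x * of_real (ln (real (Suc n)))))"
        using l by (auto simp: powr_def simp del: of_nat_Suc)
      moreover have "((\<lambda>x :: complex. exp (- x * of_real (ln (real (Suc n))))) has_field_derivative
         - of_real (ln (real (Suc n))) * exp (- x * of_real (ln (real (Suc n))))) (at x)"
        by (auto intro!: derivative_eq_intros)
      ultimately show ?thesis using l by (simp add: powr_def del: of_nat_Suc)
    qed
    have "norm ((of_nat (Suc n) :: complex) powr (- x)) \<le> real (Suc n) powr (- a)" if "x \<in> ?S" for n x
      using that unfolding norm_of_nat_powr by (intro powr_mono) auto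
    then show "\<forall>\<^sub>F n in sequentially. \<forall>x\<in>?S. norm ((of_nat (Suc n) :: complex) powr (- x)) \<le> real (Suc n) powr (- a)"
      by simp
  qed (use that in blast)
  have s1: "s \<noteq> 1" and s0: "Re s > 0" using assms by auto
  have gz: "g x = zeta_reg x / (x - 1)" if "x \<in> ?S" for x
  proof -
    have "(\<lambda>n. of_nat (Suc n) powr (- x)) sums g x" using g that by blast
    from sums_Suc_imp[OF _ this] have "(\<lambda>n. of_nat n powr (- x)) sums g x" by simp
    moreover have "Re x > 1" using that a by simp
    ultimately show ?thesis using zeta_sums(1) sums_unique2 by blast
  qed
  have sS: "s \<in> ?S" using a by simp
  have Zd: "(zeta_reg has_field_derivative deriv zeta_reg s) (at s)"
    using holomorphic_derivI[OF holomorphic_zeta_reg open_halfspace_Re_gt] s0 by simp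
  have "((\<lambda>x. zeta_reg x / (x - 1)) has_field_derivative (deriv zeta_reg s * (s - 1) - zeta_reg s) / (s - 1)^2) (at s)"
    using s1 by (auto intro!: derivative_eq_intros Zd simp: power2_eq_square)
  moreover have "((\<lambda>x. zeta_reg x / (x - 1)) has_field_derivative g' s) (at s)"
    by (rule has_field_derivative_transform_within_open[OF _ S sS gz]) (use g sS in auto)
  ultimately have g's: "g' s = (deriv zeta_reg s * (s - 1) - zeta_reg s) / (s - 1)^2"
    by (rule DERIV_unique[symmetric])
  have "(\<lambda>n. - of_real (ln (real (Suc n))) * of_nat (Suc n) powr (- s)) sums g' s" using g sS by blast
  from sums_minus[OF this] have "(\<lambda>n. of_real (ln (real (Suc n))) * of_nat (Suc n) powr (- s)) sums - g' s" by simp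
  then have 1: "(\<lambda>n. of_real (ln (real n)) * of_nat n powr (- s)) sums - g' s"
    by (intro sums_Suc_imp[where f = "\<lambda>n. of_real (ln (real n)) * of_nat n powr (- s)"]) simp_all
  have ms: "(\<lambda>n. mangoldt n * of_nat n powr (- s)) sums mangoldt_series s"
    unfolding mangoldt_series_def by (rule summable_sums[OF summable_norm_cancel[OF summable_mangoldt_series[OF assms]]])
  have "(\<lambda>n. \<Sum>d | d dvd n. mangoldt d * of_nat d powr (- s) * of_nat (n div d) powr (- s))
      sums (mangoldt_series s * (zeta_reg s / (s - 1)))"
    by (rule dirichlet_convolution_sums[OF summable_mangoldt_series[OF assms] ms _ zeta_sums(2,1)[OF assms]]) auto
  also have "(\<lambda>n. \<Sum>d | d dvd n. mangoldt d * of_nat d powr (- s) * of_nat (n div d) powr (- s))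
     = (\<lambda>n. of_real (ln (real n)) * (of_nat n :: complex) powr (- s))"
  proof
    fix n :: nat
    show "(\<Sum>d | d dvd n. mangoldt d * of_nat d powr (- s) * of_nat (n div d) powr (- s))
        = of_real (ln (real n)) * (of_nat n :: complex) powr (- s)"
    proof (cases "n = 0")
      case False
      have "(\<Sum>d | d dvd n. mangoldt d * of_nat d powr (- s) * of_nat (n div d) powr (- s))
         = (\<Sum>d | d dvd n. mangoldt d * (of_nat n :: complex) powr (- s))"
      proof (rule sum.cong[OF refl])
        fix d assume "d \<in> {d. d dvd n}"
        then have "n = d * (n div d)" by simp
        then have "(of_nat n :: complex) = of_real (real d) * of_real (real (n div d))"
          by (metis of_nat_mult of_real_of_nat_eq)
        then have "(of_nat n :: complex) powr (- s) = of_nat d powr (- s) * of_nat (n div d) powr (- s)"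
          by (simp add: powr_times_real)
        then show "mangoldt d * of_nat d powr (- s) * of_nat (n div d) powr (- s) = mangoldt d * (of_nat n :: complex) powr (- s)"
          by simp
      qed
      also have "\<dots> = of_real (ln (real n)) * of_nat n powr (- s)"
        by (simp add: sum_distrib_right[symmetric] mangoldt_sum[OF False])
      finally show ?thesis .
    qed simp
  qed
  finally have "mangoldt_series s * (zeta_reg s / (s - 1)) = - g' s" using 1 sums_unique2 by blast
  then have "mangoldt_series s * (zeta_reg s / (s - 1)) * (s - 1) = - g' s * (s - 1)" by simp
  then have "mangoldt_series s * zeta_reg s = - g' s * (s - 1)" using s1 by simp
  also have "\<dots> = zeta_reg s / (s - 1) - deriv zeta_reg s"
    unfolding g's using s1 by (simp add: power2_eq_square divide_simps)
  finally show ?thesis .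
qed

text \<open>The value at 1 is 1, while the value at 2 is the sum of the inverse squares and exceeds
  1. Nonconstancy is what gives zeros a finite order and makes them countable.\<close>

lemma zeta_reg_nonconstant: "\<not> zeta_reg constant_on {s. Re s > 0}"
proof
  assume "zeta_reg constant_on {s. Re s > 0}"
  then obtain c where c: "\<And>s. Re s > 0 \<Longrightarrow> zeta_reg s = c" by (auto simp: constant_on_def)
  have "zeta_reg 2 = 1" using c[of 2] c[of 1] zeta_reg_1 by simp
  moreover have "zeta_reg 2 = (\<Sum>n. of_nat (Suc n) powr (- 2))"
    using dirichlet_series_zeta(2)[of 2] by simp
  moreover have "(of_nat (Suc n) powr (- 2) :: complex) = of_real (real (Suc n) powr (- 2))" for n
    using powr_of_real[of "real (Suc n)" "-2"] by simp
  ultimately have "of_real (\<Sum>n. real (Suc n) powr (- 2)) = (1 :: complex)"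
    using suminf_of_real[OF summable_Suc_powr[of "-2"], where 'a = complex] by simp
  then have "(\<Sum>n. real (Suc n) powr (- 2)) = 1" by (simp only: of_real_eq_1_iff)
  moreover have "(\<Sum>n\<in>{0, 1}. real (Suc n) powr (- 2)) \<le> (\<Sum>n. real (Suc n) powr (- 2))"
    by (rule sum_le_suminf[OF summable_Suc_powr]) auto
  moreover have "(\<Sum>n\<in>{0, 1}. real (Suc n) powr (- 2)) > 1" by simp
  ultimately show False by linarith
qed

text \<open>\<open>k\<close> is the order of vanishing at \<open>w\<close>, possibly 0, seen as the
  residue of the logarithmic derivative.\<close>

lemma zeta_reg_log_deriv_limit:
  assumes w: "Re w > 0"
  obtains k :: nat where "zeta_reg w = 0 \<longleftrightarrow> k > 0"
    "((\<lambda>s. (s - w) * (deriv zeta_reg s / zeta_reg s)) \<longlongrightarrow> of_nat k) (at w)"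
    "eventually (\<lambda>s. zeta_reg s \<noteq> 0) (at w)"
proof -
  let ?S = "{s. Re s > 0}"
  have S: "open ?S" "connected ?S" "w \<in> ?S"
    using w by (auto simp: open_halfspace_Re_gt convex_halfspace_Re_gt convex_connected)
  have lim0: "((\<lambda>s. (s - w) * (deriv g s / g s)) \<longlongrightarrow> 0) (at w)"
    if g: "g holomorphic_on T" "open T" "w \<in> T" "g w \<noteq> 0" for g T
  proof -
    have "g \<midarrow>w\<rightarrow> g w" "deriv g \<midarrow>w\<rightarrow> deriv g w"
      using g holomorphic_on_imp_continuous_on[OF g(1)] holomorphic_on_imp_continuous_on[OF holomorphic_deriv[OF g(1,2)]]
      by (auto simp: continuous_on_eq_continuous_at isCont_def)
    then have "((\<lambda>s. (s - w) * (deriv g s / g s)) \<longlongrightarrow> (w - w) * (deriv g w / g w)) (at w)"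
      by (intro tendsto_intros) (use g in auto)
    then show ?thesis by simp
  qed
  show ?thesis
  proof (cases "zeta_reg w = 0")
    case False
    have "isCont zeta_reg w"
      using holomorphic_on_imp_continuous_on[OF holomorphic_zeta_reg] S by (simp add: continuous_on_eq_continuous_at)
    then have "eventually (\<lambda>s. zeta_reg s \<noteq> 0) (at w)"
      using False by (simp add: isCont_def tendsto_imp_eventually_ne)
    with lim0[OF holomorphic_zeta_reg S(1,3)] False that[of 0] show ?thesis by simp
  next
    case True
    obtain g r n where g: "0 < n" "0 < r" "ball w r \<subseteq> ?S" "g holomorphic_on ball w r"
      "\<And>s. s \<in> ball w r \<Longrightarrow> zeta_reg s = (s - w) ^ n * g s" "\<And>s. s \<in> ball w r \<Longrightarrow> g s \<noteq> 0"
      using holomorphic_factor_zero_nonconstant[OF holomorphic_zeta_reg S True zeta_reg_nonconstant] by metis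
    have ev: "eventually (\<lambda>s. s \<in> ball w r - {w}) (at w)"
      using g(2) by (intro eventually_at_in_open) auto
    have "((\<lambda>s. of_nat n + (s - w) * (deriv g s / g s)) \<longlongrightarrow> of_nat n + 0) (at w)"
      by (intro tendsto_intros lim0[OF g(4)]) (use g in auto)
    moreover have "eventually (\<lambda>s. of_nat n + (s - w) * (deriv g s / g s) = (s - w) * (deriv zeta_reg s / zeta_reg s)) (at w)"
      using ev
    proof eventually_elim
      case (elim s)
      then have s: "s \<in> ball w r" "s \<noteq> w" by auto
      have "(g has_field_derivative deriv g s) (at s)"
        using g(4) s by (intro holomorphic_derivI[of g "ball w r"]) auto
      then have "((\<lambda>s. (s - w) ^ n * g s) has_field_derivative
          of_nat n * (s - w) ^ (n - 1) * g s + (s - w) ^ n * deriv g s) (at s)"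
        by (auto intro!: derivative_eq_intros simp: mult_ac)
      then have "(zeta_reg has_field_derivative of_nat n * (s - w) ^ (n - 1) * g s + (s - w) ^ n * deriv g s) (at s)"
        by (rule has_field_derivative_transform_within_open[of _ _ _ "ball w r"]) (use s g(5) in auto)
      then have d: "deriv zeta_reg s = of_nat n * (s - w) ^ (n - 1) * g s + (s - w) ^ n * deriv g s"
        by (rule DERIV_imp_deriv)
      obtain m where m: "n = Suc m" using g(1) by (cases n) auto
      have gs: "g s \<noteq> 0" "s - w \<noteq> 0" using g(6) s by auto
      show ?case
        unfolding d g(5)[OF s(1)] m using gs by (simp add: field_simps)
    qed
    ultimately have "((\<lambda>s. (s - w) * (deriv zeta_reg s / zeta_reg s)) \<longlongrightarrow> of_nat n + 0) (at w)"
      by (rule Lim_transform_eventually)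
    then have "((\<lambda>s. (s - w) * (deriv zeta_reg s / zeta_reg s)) \<longlongrightarrow> of_nat n) (at w)" by simp
    moreover have "eventually (\<lambda>s. zeta_reg s \<noteq> 0) (at w)"
      using ev by eventually_elim (use g in auto)
    ultimately show ?thesis using that[of n] g(1) True by blast
  qed
qed

text \<open>Approaching \<open>w\<close> from the right along 1/(j+1), the scaled series picks up
  minus the order of the zero, and at w = 1 the residue of the pole of \<zeta>.\<close>

lemma mangoldt_series_limit:
  assumes w: "Re w \<ge> 1"
  obtains k :: nat where "zeta_reg w = 0 \<longrightarrow> k > 0"
    "(\<lambda>j. of_real (1 / real (Suc j)) * mangoldt_series (w + of_real (1 / real (Suc j))))
       \<longlonglongrightarrow> (if w = 1 then 1 else - of_nat k)"
proof -
  define s where "s = (\<lambda>j. w + complex_of_real (1 / real (Suc j)))"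
  obtain k :: nat where k: "zeta_reg w = 0 \<longleftrightarrow> k > 0"
    "((\<lambda>s. (s - w) * (deriv zeta_reg s / zeta_reg s)) \<longlongrightarrow> of_nat k) (at w)"
    "eventually (\<lambda>s. zeta_reg s \<noteq> 0) (at w)"
  proof -
    have "Re w > 0" using w by simp
    then show ?thesis by (rule zeta_reg_log_deriv_limit) (rule that)
  qed
  have h0: "(\<lambda>j. 1 / real (Suc j)) \<longlonglongrightarrow> 0" by real_asymp
  have "s \<longlonglongrightarrow> w + of_real 0" unfolding s_def by (intro tendsto_intros h0)
  then have sw: "s \<longlonglongrightarrow> w" by simp
  have sne: "s j \<noteq> w" for j by (simp add: s_def del: of_nat_Suc of_real_divide)
  have fl: "filterlim s (at w) sequentially"
    using sw sne by (simp add: filterlim_at)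
  have re: "Re (s j) > 1" for j
  proof -
    have "1 / real (Suc j) > 0" by simp
    moreover have "Re (s j) = Re w + 1 / real (Suc j)" unfolding s_def plus_complex.sel Re_complex_of_real ..
    ultimately show ?thesis using w by linarith
  qed
  have first: "(\<lambda>j. (s j - w) / (s j - 1)) \<longlonglongrightarrow> (if w = 1 then 1 else 0)"
  proof (cases "w = 1")
    case True
    have "s j - 1 \<noteq> 0" for j using re[of j] by auto
    then have "(\<lambda>j. (s j - w) / (s j - 1)) = (\<lambda>j. 1)" using True by auto
    then show ?thesis using True by simp
  next
    case False
    have "(\<lambda>j. (s j - w) / (s j - 1)) \<longlonglongrightarrow> (w - w) / (w - 1)"
      by (intro tendsto_intros sw) (use False in auto)
    then show ?thesis using False by simp
  qed
  have "(\<lambda>j. (s j - w) / (s j - 1) - (s j - w) * (deriv zeta_reg (s j) / zeta_reg (s j)))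
     \<longlonglongrightarrow> (if w = 1 then 1 else 0) - of_nat k"
    by (intro tendsto_diff first filterlim_compose[OF k(2) fl])
  also have "(if w = 1 then 1 else 0) - of_nat k = (if w = 1 then 1 else - of_nat k :: complex)"
    using k(1) zeta_reg_1 by auto
  finally have lim: "(\<lambda>j. (s j - w) / (s j - 1) - (s j - w) * (deriv zeta_reg (s j) / zeta_reg (s j)))
     \<longlonglongrightarrow> (if w = 1 then 1 else - of_nat k)" .
  have "eventually (\<lambda>j. zeta_reg (s j) \<noteq> 0) sequentially"
    by (rule eventually_compose_filterlim[OF k(3) fl])
  then have "eventually (\<lambda>j. (s j - w) / (s j - 1) - (s j - w) * (deriv zeta_reg (s j) / zeta_reg (s j))
      = of_real (1 / real (Suc j)) * mangoldt_series (w + of_real (1 / real (Suc j)))) sequentially"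
  proof eventually_elim
    case (elim j)
    have "mangoldt_series (s j) * zeta_reg (s j) / zeta_reg (s j)
        = (zeta_reg (s j) / (s j - 1) - deriv zeta_reg (s j)) / zeta_reg (s j)"
      by (simp only: mangoldt_series_eq[OF re])
    then have "mangoldt_series (s j) = 1 / (s j - 1) - deriv zeta_reg (s j) / zeta_reg (s j)"
      using elim by (simp add: diff_divide_distrib)
    moreover have "s j - w = of_real (1 / real (Suc j))" by (simp add: s_def)
    moreover have "w + of_real (1 / real (Suc j)) = s j" by (simp only: s_def)
    ultimately show ?case by (simp only: right_diff_distrib) (simp del: of_nat_Suc of_real_divide)
  qed
  from Lim_transform_eventually[OF lim this] k(1) that show ?thesis by blast
qed

text \<open>Mertens' argument. For a zero 1 + it of order k the combination 3, 4, 1 of the series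
  near 1, 1 + it and 1 + 2it has the scaled limit 3 - 4k - m with k \<ge> 1 and m \<ge> 0, which is
  negative, although its real part is a series of nonnegative terms.\<close>

lemma zeta_reg_nonzero:
  assumes "Re w \<ge> 1"
  shows "zeta_reg w \<noteq> 0"
proof
  assume Z: "zeta_reg w = 0"
  then have w1: "w \<noteq> 1" using zeta_reg_1 by auto
  obtain k :: nat where "zeta_reg w = 0 \<longrightarrow> k > 0"
    "(\<lambda>j. of_real (1 / real (Suc j)) * mangoldt_series (w + of_real (1 / real (Suc j))))
       \<longlonglongrightarrow> (if w = 1 then 1 else - of_nat k)"
    by (rule mangoldt_series_limit[OF assms]) (rule that)
  with Z w1 have k: "k > 0" "(\<lambda>j. of_real (1 / real (Suc j)) * mangoldt_series (w + of_real (1 / real (Suc j))))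
       \<longlonglongrightarrow> - of_nat k" by simp_all
  have sumsL: "(\<lambda>n. mangoldt n * of_nat n powr (- s)) sums mangoldt_series s" if "Re s > 1" for s
    unfolding mangoldt_series_def by (rule summable_sums[OF summable_norm_cancel[OF summable_mangoldt_series[OF that]]])
  show False
  proof (cases "Re w > 1")
    case True
    \<comment> \<open>To the right of the line Re w = 1 the series stays bounded near
      \<open>w\<close>, so the scaled limit is 0 and cannot be -k.\<close>
    define B where "B = (\<Sum>n. norm (mangoldt n * of_nat n powr (- w) :: complex))"
    have hB: "norm (mangoldt_series (w + of_real h)) \<le> B" if "h > 0" for h
    proof -
      have "norm (mangoldt n * of_nat n powr (- (w + of_real h)) :: complex) \<le> norm (mangoldt n * of_nat n powr (- w) :: complex)" for n
      proof (cases "n = 0")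
        case False
        then show ?thesis unfolding norm_mult norm_of_nat_powr' using that
          by (intro mult_left_mono powr_mono) (auto simp: mangoldt_bounds(1))
      qed simp
      then show ?thesis unfolding B_def mangoldt_series_def
        by (intro norm_suminf_le summable_mangoldt_series True)
    qed
    have b: "norm (mangoldt_series (w + of_real (1 / real (Suc j)))) \<le> B" for j by (rule hB) simp
    have lim0: "(\<lambda>j. (1 / real (Suc j)) * B) \<longlonglongrightarrow> 0" by real_asymp
    have bd: "norm (of_real (1 / real (Suc j)) * mangoldt_series (w + of_real (1 / real (Suc j)))) \<le> (1 / real (Suc j)) * B" for j
      unfolding norm_mult norm_of_real using b[of j] by (intro mult_mono) (simp_all del: of_real_divide of_nat_Suc)
    have "(\<lambda>j. of_real (1 / real (Suc j)) * mangoldt_series (w + of_real (1 / real (Suc j)))) \<longlonglongrightarrow> 0"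
      by (rule Lim_null_comparison[OF always_eventually[OF allI[OF bd]] lim0])
    with k show False using LIMSEQ_unique by fastforce
  next
    case False
    define t where "t = Im w"
    have w: "w = 1 + \<i> * of_real t" using False assms by (auto simp: complex_eq_iff t_def)
    have t: "t \<noteq> 0" using w w1 by auto
    obtain m where m: "(\<lambda>j. of_real (1 / real (Suc j)) * mangoldt_series ((1 + \<i> * of_real (2 * t)) + of_real (1 / real (Suc j))))
       \<longlonglongrightarrow> - complex_of_nat m"
    proof -
      have ne: "1 + \<i> * complex_of_real (2 * t) \<noteq> 1" and r: "Re (1 + \<i> * of_real (2 * t)) \<ge> 1" using t by auto
      show ?thesis
        by (rule mangoldt_series_limit[OF r]) (use that ne in simp)
    qed
    have o: "(\<lambda>j. of_real (1 / real (Suc j)) * mangoldt_series (1 + of_real (1 / real (Suc j)))) \<longlonglongrightarrow> 1"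
      by (rule mangoldt_series_limit[of 1]) simp_all
    have "(\<lambda>j. Re (3 * (of_real (1 / real (Suc j)) * mangoldt_series (1 + of_real (1 / real (Suc j))))
        + 4 * (of_real (1 / real (Suc j)) * mangoldt_series (w + of_real (1 / real (Suc j))))
        + of_real (1 / real (Suc j)) * mangoldt_series ((1 + \<i> * of_real (2 * t)) + of_real (1 / real (Suc j)))))
       \<longlonglongrightarrow> Re (3 * 1 + 4 * (- of_nat k) + (- of_nat m))"
      by (intro tendsto_intros o k m)
    moreover have "Re (3 * (of_real (1 / real (Suc j)) * mangoldt_series (1 + of_real (1 / real (Suc j))))
        + 4 * (of_real (1 / real (Suc j)) * mangoldt_series (w + of_real (1 / real (Suc j))))
        + of_real (1 / real (Suc j)) * mangoldt_series ((1 + \<i> * of_real (2 * t)) + of_real (1 / real (Suc j)))) \<ge> 0" for j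
    proof -
      define h where "h = 1 / real (Suc j)"
      have h: "h > 0" by (simp add: h_def)
      have R: "(\<lambda>n. mangoldt n * real n powr (- (1 + h)) * cos (y * ln (real n))) sums Re (mangoldt_series (1 + \<i> * of_real y + of_real h))" for y
      proof -
        have sR: "(\<lambda>n. Re (mangoldt n * of_nat n powr (- (1 + \<i> * of_real y + of_real h)))) sums Re (mangoldt_series (1 + \<i> * of_real y + of_real h))"
          by (intro sums_Re sumsL) (use h in simp)
        have eR: "Re (mangoldt n * of_nat n powr (- (1 + \<i> * of_real y + of_real h))) = mangoldt n * real n powr (- (1 + h)) * cos (y * ln (real n))" for n
        proof (cases "n = 0")
          case False
          have "Re (complex_of_real (mangoldt n) * z) = mangoldt n * Re z" for z
            by (simp del: of_real_mangoldt)
          then have r: "Re (mangoldt n * z) = mangoldt n * Re z" for z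
            by (simp only: of_real_mangoldt)
          have "Re (of_nat n powr (- (1 + \<i> * of_real y + of_real h))) = real n powr (- (1 + h)) * cos (y * ln (real n))"
            using False by (simp add: powr_def Ln_of_nat Re_exp algebra_simps)
          then show ?thesis unfolding r by (simp only: mult.assoc)
        qed simp
        show ?thesis using sR unfolding eR .
      qed
      have S: "(\<lambda>n. 3 * (mangoldt n * real n powr (- (1 + h)) * cos (0 * ln (real n)))
          + 4 * (mangoldt n * real n powr (- (1 + h)) * cos (t * ln (real n)))
          + mangoldt n * real n powr (- (1 + h)) * cos (2 * t * ln (real n)))
         sums (3 * Re (mangoldt_series (1 + \<i> * of_real 0 + of_real h)) + 4 * Re (mangoldt_series (1 + \<i> * of_real t + of_real h))
            + Re (mangoldt_series (1 + \<i> * of_real (2 * t) + of_real h)))"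
        by (intro sums_add sums_mult R)
      have N: "0 \<le> 3 * (mangoldt n * real n powr (- (1 + h)) * cos (0 * ln (real n)))
          + 4 * (mangoldt n * real n powr (- (1 + h)) * cos (t * ln (real n)))
          + mangoldt n * real n powr (- (1 + h)) * cos (2 * t * ln (real n))" for n
      proof -
        define \<theta> where "\<theta> = t * ln (real n)"
        have c2: "cos (2 * t * ln (real n)) = 2 * (cos \<theta>)\<^sup>2 - 1"
          using cos_double_cos[of \<theta>] by (simp add: \<theta>_def mult.assoc)
        \<comment> \<open>The trigonometric square: 3 + 4 cos \<theta> + cos 2\<theta> = 2 (1 + cos
          \<theta>)^2.\<close>
        have "3 * (A * cos 0) + 4 * (A * C) + A * (2 * C\<^sup>2 - 1) = 2 * A * (1 + C)\<^sup>2" for A C :: real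
          by (simp add: power2_eq_square algebra_simps)
        then have "3 * (mangoldt n * real n powr (- (1 + h)) * cos (0 * ln (real n)))
          + 4 * (mangoldt n * real n powr (- (1 + h)) * cos (t * ln (real n)))
          + mangoldt n * real n powr (- (1 + h)) * cos (2 * t * ln (real n))
          = 2 * (mangoldt n * real n powr (- (1 + h))) * (1 + cos \<theta>)\<^sup>2"
          unfolding c2 \<theta>_def[symmetric] by (simp only: mult_zero_left)
        then show ?thesis using mangoldt_bounds(1)[of n] by simp
      qed
      have "0 \<le> 3 * Re (mangoldt_series (1 + \<i> * of_real 0 + of_real h)) + 4 * Re (mangoldt_series (1 + \<i> * of_real t + of_real h))
            + Re (mangoldt_series (1 + \<i> * of_real (2 * t) + of_real h))"
        by (rule sums_le[OF N sums_zero S])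
      then have "0 \<le> h * (3 * Re (mangoldt_series (1 + \<i> * of_real 0 + of_real h)) + 4 * Re (mangoldt_series (1 + \<i> * of_real t + of_real h))
            + Re (mangoldt_series (1 + \<i> * of_real (2 * t) + of_real h)))"
        using h by (intro mult_nonneg_nonneg) simp_all
      moreover have "Re (3 * (of_real h * a) + 4 * (of_real h * b) + of_real h * c) = h * (3 * Re a + 4 * Re b + Re c)" for a b c
        by (simp add: algebra_simps)
      ultimately show ?thesis unfolding h_def[symmetric] w by (simp only: of_real_0 mult_zero_right add_0_right)
    qed
    ultimately have "0 \<le> Re (3 * 1 + 4 * (- of_nat k) + (- of_nat m))"
      by (rule LIMSEQ_le_const[OF _ exI[of _ 0, OF allI[OF impI]]])
    then show False using k(1) by simp
  qed
qed

section \<open>Growth of the reciprocal zeta function\<close>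

text \<open>The Moebius map G/(2B - G) sends the half plane Re G < B into the unit disc and fixes 0,
  so the Schwarz lemma applies; solving its inequality for |G| gives the bound.\<close>

lemma borel_caratheodory:
  assumes holg: "g holomorphic_on ball c R" and R: "0 < \<rho>" "\<rho> < R"
    and A: "\<And>z. z \<in> ball c R \<Longrightarrow> Re (g z) < A" and z: "z \<in> cball c \<rho>"
  shows "norm (g z - g c) \<le> 2 * \<rho> / (R - \<rho>) * (A - Re (g c))"
proof -
  define B where "B = A - Re (g c)"
  have R0: "R > 0" using R by simp
  have B: "B > 0" using A[of c] R0 by (simp add: B_def)
  define G where "G = (\<lambda>w. g (c + of_real R * w) - g c)"
  have inb: "c + of_real R * w \<in> ball c R" if "norm w < 1" for w
    using that R0 by (simp add: dist_norm norm_mult)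
  have ReG: "Re (G w) < B" if "norm w < 1" for w
    using A[OF inb[OF that]] by (simp add: G_def B_def)
  have ne: "2 * of_real B - G w \<noteq> 0" if "norm w < 1" for w
    using ReG[OF that] B by (auto simp: complex_eq_iff)
  have holG: "G holomorphic_on ball 0 1"
  proof -
    have "(g \<circ> (\<lambda>w. c + of_real R * w)) holomorphic_on ball 0 1"
      by (rule holomorphic_on_compose_gen[OF _ holg]) (use inb in \<open>auto intro!: holomorphic_intros\<close>)
    then show ?thesis unfolding G_def o_def by (intro holomorphic_intros)
  qed
  define h where "h = (\<lambda>w. G w / (2 * of_real B - G w))"
  have holh: "h holomorphic_on ball 0 1"
    unfolding h_def using ne by (intro holomorphic_intros holG) auto
  have h1: "norm (h w) < 1" if "norm w < 1" for w
  proof -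
    have "(norm (2 * of_real B - G w))\<^sup>2 - (norm (G w))\<^sup>2 = 4 * B * (B - Re (G w))"
      by (simp only: cmod_power2) (simp add: power2_eq_square algebra_simps)
    also have "\<dots> > 0" using B ReG[OF that] by simp
    finally have "norm (G w) < norm (2 * of_real B - G w)"
      by (simp add: power2_less_imp_less)
    then show ?thesis unfolding h_def norm_divide using ne[OF that] by simp
  qed
  define w where "w = (z - c) / of_real R"
  have nw: "norm w \<le> \<rho> / R" using z R0 by (simp add: w_def norm_divide dist_norm norm_minus_commute divide_right_mono)
  have "\<rho> / R < 1" using R by simp
  then have nw1: "norm w < 1" using nw by linarith
  have Gw: "G w = g z - g c" using R0 by (simp add: G_def w_def)
  have "norm (h w) \<le> norm w"
    by (rule Schwarz_Lemma(1)[OF holh _ h1 nw1]) (auto simp: h_def G_def)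
  then have "norm (G w) \<le> norm w * norm (2 * of_real B - G w)"
    using ne[OF nw1] by (simp add: h_def norm_divide divide_simps)
  also have "\<dots> \<le> (\<rho> / R) * (2 * B + norm (G w))"
    using norm_triangle_ineq4[of "2 * of_real B" "G w"] B nw R
    by (intro mult_mono) (auto simp: norm_mult)
  finally have "norm (G w) * (R - \<rho>) \<le> 2 * \<rho> * B"
    using R0 by (simp add: field_simps)
  then show ?thesis using R by (simp add: Gw B_def field_simps)
qed

text \<open>Let g be a logarithm of \<phi>. Borel-Caratheodory bounds its Taylor coefficients twice:
  absolutely, from the small disc where \<phi> is close to 1, and proportionally to ln M, from the
  large disc. The first bound is used for finitely many coefficients and the second for a geometric
  tail so far out that the coefficient of ln M is below \<delta>. This takes the place of a three
  circles argument. The quantifiers stand inside the formula because \<open>K\<close> must be the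
  same for all \<phi>, c and M.\<close>

lemma reciprocal_bound_local:
  fixes R r r1 \<delta> :: real
  assumes "0 < r1" "0 < r" "r < R" "r1 \<le> R" "0 < \<delta>"
  obtains K where "K > 0"
    "\<forall>\<phi> c M w. \<phi> holomorphic_on ball c R \<and> (\<forall>z\<in>ball c R. \<phi> z \<noteq> 0 \<and> norm (\<phi> z) \<le> M) \<and> M \<ge> 1 \<and>
       (\<forall>z\<in>ball c r1. norm (\<phi> z - 1) \<le> 3 / 4) \<and> w \<in> cball c r
       \<longrightarrow> norm (1 / \<phi> w) \<le> K * M powr \<delta>"
proof -
  \<comment> \<open>An intermediate radius: Borel-Caratheodory needs room between \<rho> and R, and
    the tail needs the ratio r/\<rho> to be below 1.\<close>
  define \<rho> where "\<rho> = (r + R) / 2"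
  have \<rho>: "0 < \<rho>" "r < \<rho>" "\<rho> < R" using assms by (auto simp: \<rho>_def)
  define q where "q = r / \<rho>"
  have q: "0 < q" "q < 1" using assms \<rho> by (auto simp: q_def)
  define C2 where "C2 = 2 * \<rho> / (R - \<rho>)"
  have C2: "C2 > 0" using \<rho> by (simp add: C2_def)
  define r2 where "r2 = r1 / 2"
  have r2: "0 < r2" "r2 < r1" using assms by (auto simp: r2_def)
  define B1 where "B1 = 2 * r2 / (r1 - r2) * (ln 2 + ln 4)"
  have "(\<lambda>n. C2 * q ^ n / (1 - q)) \<longlonglongrightarrow> C2 * 0 / (1 - q)"
    using q by (intro tendsto_intros LIMSEQ_power_zero) auto
  then have "eventually (\<lambda>n. C2 * q ^ n / (1 - q) < \<delta>) sequentially"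
    using assms by (intro order_tendstoD(2)) auto
  then obtain N where N: "C2 * q ^ N / (1 - q) < \<delta>"
    using eventually_happens by fastforce
  define P where "P = (\<Sum>n<N. B1 * (r / r2) ^ n)"
  define K where "K = exp (P + \<delta> * (1 + ln 4) + ln 4)"
  have "norm (1 / \<phi> w) \<le> K * M powr \<delta>"
    if hol: "\<phi> holomorphic_on ball c R" and nz: "\<And>z. z \<in> ball c R \<Longrightarrow> \<phi> z \<noteq> 0"
      and M: "\<And>z. z \<in> ball c R \<Longrightarrow> norm (\<phi> z) \<le> M" "M \<ge> 1"
      and small: "\<And>z. z \<in> ball c r1 \<Longrightarrow> norm (\<phi> z - 1) \<le> 3 / 4" and w: "w \<in> cball c r"
    for \<phi> c M w
  proof -
    have c: "c \<in> ball c R" "c \<in> ball c r1" using assms by auto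
    obtain g where g: "g holomorphic_on ball c R" "\<And>z. z \<in> ball c R \<Longrightarrow> exp (g z) = \<phi> z"
      using holomorphic_logarithm_exists[OF convex_ball open_ball hol nz c(1)] by blast
    have nphi: "norm (\<phi> z) = exp (Re (g z))" if "z \<in> ball c R" for z
      using g(2)[OF that] by (metis norm_exp_eq_Re)
    have sub: "ball c r1 \<subseteq> ball c R" using assms by (intro subset_ball) auto
    have low: "Re (g z) \<ge> - ln 4" "Re (g z) < ln 2" if "z \<in> ball c r1" for z
    proof -
      have zR: "z \<in> ball c R" using that sub by auto
      have "1 / 4 \<le> norm (\<phi> z)" "norm (\<phi> z) \<le> 7 / 4"
        using small[OF that] norm_triangle_ineq2[of 1 "1 - \<phi> z"] norm_triangle_ineq2[of "\<phi> z" 1]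
        by (auto simp: norm_minus_commute)
      then have "exp (- ln 4) \<le> exp (Re (g z))" "exp (Re (g z)) < exp (ln 2)"
        unfolding nphi[OF zR] by (auto simp: exp_minus)
      then show "Re (g z) \<ge> - ln 4" "Re (g z) < ln 2" by (simp_all only: exp_le_cancel_iff exp_less_cancel_iff)
    qed
    have up: "Re (g z) < ln M + 1" if "z \<in> ball c R" for z
    proof -
      have "exp (Re (g z)) \<le> exp (ln M)" using M(1)[OF that] M(2) unfolding nphi[OF that] by simp
      then show ?thesis by simp
    qed
    define G where "G = (\<lambda>z. g z - g c)"
    have holG: "G holomorphic_on ball c R" unfolding G_def by (intro holomorphic_intros g)
    define a where "a = (\<lambda>n. (deriv ^^ n) G c / fact n)"
    have co: "norm (a n) \<le> B / s ^ n" if s: "0 < s" "s < R" and B: "\<And>z. z \<in> cball c s \<Longrightarrow> norm (G z) \<le> B" for n s B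
    proof -
      have "cball c s \<subseteq> ball c R" using s by auto
      then have "norm ((deriv ^^ n) G c) \<le> fact n * B / s ^ n"
        using s B holG ball_subset_cball[of c s]
        by (intro Cauchy_inequality) (auto intro: holomorphic_on_subset holomorphic_on_imp_continuous_on simp: dist_norm)
      then show ?thesis by (simp add: a_def norm_divide field_simps)
    qed
    have a1: "norm (a n) \<le> B1 / r2 ^ n" for n
    proof (rule co)
      show "0 < r2" "r2 < R" using r2 assms by auto
      fix z assume "z \<in> cball c r2"
      then have "norm (G z) \<le> 2 * r2 / (r1 - r2) * (ln 2 - Re (g c))"
        unfolding G_def using low(2)
        by (intro borel_caratheodory[of g c r1]) (use r2 g(1) sub in \<open>auto intro: holomorphic_on_subset\<close>)
      also have "\<dots> \<le> B1" unfolding B1_def using low(1)[OF c(2)] r2 by (intro mult_left_mono) auto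
      finally show "norm (G z) \<le> B1" .
    qed
    have a2: "norm (a n) \<le> C2 * (ln M + 1 + ln 4) / \<rho> ^ n" for n
    proof (rule co)
      show "0 < \<rho>" "\<rho> < R" using \<rho> by auto
      fix z assume "z \<in> cball c \<rho>"
      then have "norm (G z) \<le> 2 * \<rho> / (R - \<rho>) * (ln M + 1 - Re (g c))"
        unfolding G_def using up
        by (intro borel_caratheodory[of g c R]) (use \<rho> g(1) in auto)
      also have "\<dots> \<le> C2 * (ln M + 1 + ln 4)" unfolding C2_def using low(1)[OF c(2)] \<rho> by (intro mult_left_mono) auto
      finally show "norm (G z) \<le> C2 * (ln M + 1 + ln 4)" .
    qed
    define L where "L = ln M + 1 + ln 4"
    have L: "L \<ge> 0" using M(2) by (simp add: L_def)
    have "w \<in> ball c R" using w assms by auto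
    then have ps: "(\<lambda>n. a n * (w - c) ^ n) sums G w"
      unfolding a_def by (intro holomorphic_power_series[OF holG])
    have nw: "norm (w - c) \<le> r" using w by (simp add: dist_norm norm_minus_commute)
    \<comment> \<open>The ratio \<open>r / r2\<close> may exceed 1; this bound serves only for the
      finitely many n < N collected in \<open>P\<close>.\<close>
    have t1: "norm (a n * (w - c) ^ n) \<le> B1 * (r / r2) ^ n" for n
    proof -
      have "norm (a n * (w - c) ^ n) \<le> (B1 / r2 ^ n) * r ^ n"
        unfolding norm_mult norm_power using nw a1[of n] order_trans[OF norm_ge_zero a1[of n]]
        by (intro mult_mono power_mono) auto
      then show ?thesis by (simp add: power_divide)
    qed
    have t2: "norm (a n * (w - c) ^ n) \<le> C2 * L * q ^ n" for n
    proof -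
      have "norm (a n * (w - c) ^ n) \<le> (C2 * L / \<rho> ^ n) * r ^ n"
        unfolding norm_mult norm_power using nw a2[of n] order_trans[OF norm_ge_zero a2[of n]]
        by (intro mult_mono power_mono) (auto simp: L_def)
      then show ?thesis by (simp add: power_divide q_def)
    qed
    have G: "G w = (\<Sum>n. a (n + N) * (w - c) ^ (n + N)) + (\<Sum>n<N. a n * (w - c) ^ n)"
      using suminf_split_initial_segment[OF sums_summable[OF ps], of N] sums_unique[OF ps] by simp
    have "norm (\<Sum>n. a (n + N) * (w - c) ^ (n + N)) \<le> (\<Sum>n. C2 * L * q ^ (n + N))"
      by (rule norm_suminf_le[OF t2]) (use q in \<open>auto intro!: summable_mult summable_ignore_initial_segment summable_geometric\<close>)
    also have "\<dots> = (\<Sum>n. (C2 * L * q ^ N) * q ^ n)" by (simp add: power_add mult_ac)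
    also have "\<dots> = (C2 * L * q ^ N) * (1 / (1 - q))"
      using q by (subst suminf_mult) (auto simp: suminf_geometric intro!: summable_geometric)
    also have "\<dots> = (C2 * q ^ N / (1 - q)) * L" by simp
    also have "\<dots> \<le> \<delta> * L" using N L by (intro mult_right_mono) auto
    finally have b1: "norm (\<Sum>n. a (n + N) * (w - c) ^ (n + N)) \<le> \<delta> * L" .
    have b2: "norm (\<Sum>n<N. a n * (w - c) ^ n) \<le> P"
      unfolding P_def by (rule sum_norm_le) (use t1 in auto)
    have nG: "norm (G w) \<le> \<delta> * L + P"
      unfolding G using norm_triangle_mono[OF b1 b2] .
    have "- Re (g w) = - Re (G w) - Re (g c)" by (simp add: G_def)
    also have "\<dots> \<le> (\<delta> * L + P) + ln 4"
      using nG abs_Re_le_cmod[of "G w"] low(1)[OF c(2)] by linarith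
    finally have "exp (- Re (g w)) \<le> exp ((\<delta> * L + P) + ln 4)" by simp
    also have "\<dots> = K * exp (\<delta> * ln M)"
      unfolding K_def L_def by (simp add: exp_add[symmetric] algebra_simps)
    also have "exp (\<delta> * ln M) = M powr \<delta>" using M(2) by (simp add: powr_def)
    finally show ?thesis
      using nphi[OF \<open>w \<in> ball c R\<close>] by (simp add: norm_divide exp_minus inverse_eq_divide)
  qed
  moreover have "K > 0" by (simp add: K_def)
  ultimately show ?thesis using that by blast
qed

text \<open>The sum of n^(-2) over n \<ge> 2 is at most 1/4 + 1/2: the term for n = 2 is kept and
  the others are bounded by a telescoping sum. Telescoping from the start would give only 1 and not
  keep \<zeta> away from 0.\<close>

lemma zeta_near_one:
  assumes "Re s \<ge> 2"
  shows "norm (zeta_reg s / (s - 1) - 1) \<le> 3 / 4"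
proof -
  have s: "Re s > 1" using assms by simp
  have "(\<lambda>n. of_nat (Suc n) powr (- s)) sums (zeta_reg s / (s - 1))"
    using zeta_sums(1)[OF s] by (subst sums_Suc_iff) simp
  then have 1: "(\<lambda>n. of_nat (Suc (Suc n)) powr (- s) :: complex) sums (zeta_reg s / (s - 1) - 1)"
    by (subst sums_Suc_iff[of "\<lambda>n. of_nat (Suc n) powr (- s) :: complex"]) simp
  define b where "b = (\<lambda>n::nat. if n = 0 then 1 / 4 else 1 / real (Suc n) - 1 / real (Suc (Suc n)))"
  have "(\<lambda>n. 1 / real (Suc (Suc n)) - 1 / real (Suc (Suc (Suc n)))) sums (1 / real (Suc (Suc 0)) - 0)"
    by (rule telescope_sums'[where f = "\<lambda>n. 1 / real (Suc (Suc n))"]) real_asymp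
  then have "(\<lambda>n. b (Suc n)) sums (1 / 2)" by (simp add: b_def)
  then have b: "b sums (1 / 2 + 1 / 4)" by (subst (asm) sums_Suc_iff) (simp add: b_def)
  have le: "norm (of_nat (Suc (Suc n)) powr (- s) :: complex) \<le> b n" for n
  proof -
    have "norm (of_nat (Suc (Suc n)) powr (- s) :: complex) = real (Suc (Suc n)) powr (- Re s)"
      using norm_of_nat_powr[of "Suc n" "- s"] by simp
    also have "\<dots> \<le> real (Suc (Suc n)) powr (- 2)" using assms by (intro powr_mono) auto
    also have "\<dots> = 1 / (real (Suc (Suc n)))\<^sup>2" by (simp add: powr_minus powr_numeral inverse_eq_divide)
    also have "\<dots> \<le> b n"
    proof (cases "n = 0")
      case False
      have "1 / (real (Suc (Suc n)))\<^sup>2 \<le> 1 / (real (Suc n) * real (Suc (Suc n)))"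
        by (intro frac_le) (auto simp: power2_eq_square)
      also have "\<dots> = b n" using False by (simp add: b_def diff_frac_eq)
      finally show ?thesis .
    qed (simp add: b_def)
    finally show ?thesis .
  qed
  have "norm (\<Sum>n. of_nat (Suc (Suc n)) powr (- s) :: complex) \<le> (\<Sum>n. b n)"
    by (rule norm_suminf_le[OF le sums_summable[OF b]])
  then show ?thesis using sums_unique[OF 1] sums_unique[OF b] by simp
qed

text \<open>The local bound is applied on discs of radius 5/2 around points of real part 3. They lie
  in the half plane Re z > 1/2, and around each centre a disc of radius 1 lies where \<zeta> is
  within 3/4 of 1. On such a disc \<zeta> is O(|s|), so \<delta> = 1/4 gives the exponent.\<close>

theorem reciprocal_zeta_bound:
  assumes RH: "\<And>s. Re s > 1 / 2 \<Longrightarrow> zeta_reg s \<noteq> 0" and e: "\<epsilon> > 0"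
  obtains C where "C > 0" "\<And>s. Re s \<ge> 1 / 2 + \<epsilon> \<Longrightarrow> norm ((s - 1) / zeta_reg s) \<le> C * norm s powr (1 / 4)"
proof -
  define e where "e = min \<epsilon> 1"
  have e: "0 < e" "e \<le> \<epsilon>" "e \<le> 1" using e by (auto simp: e_def)
  obtain K where K: "K > 0"
    "\<forall>\<phi> c M w. \<phi> holomorphic_on ball c (5/2) \<and> (\<forall>z\<in>ball c (5/2). \<phi> z \<noteq> 0 \<and> norm (\<phi> z) \<le> M) \<and> M \<ge> 1 \<and>
       (\<forall>z\<in>ball c 1. norm (\<phi> z - 1) \<le> 3 / 4) \<and> w \<in> cball c (5/2 - e)
       \<longrightarrow> norm (1 / \<phi> w) \<le> K * M powr (1/4)"
    by (rule reciprocal_bound_local[of 1 "5/2 - e" "5/2" "1/4"]) (use e that in simp_all)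
  define D where "D = (\<Sum>n. real (Suc n) powr (- (1 / 2) - 1))"
  have D: "D \<ge> 0" unfolding D_def by (intro suminf_nonneg summable_Suc_powr) auto
  have far: "norm ((s - 1) / zeta_reg s) \<le> K * (1 + 4 * D) powr (1/4) * norm s powr (1/4)"
    if s: "1 / 2 + e \<le> Re s" "Re s \<le> 2" "\<bar>Im s\<bar> \<ge> 5" for s
  proof -
    \<comment> \<open>At the height of s, so that |s - c| = |3 - Re s| \<le> 5/2 - e. Height at
      least 5 keeps the pole at distance at least 1 from the disc.\<close>
    define c where "c = Complex 3 (Im s)"
    have cz: "\<bar>3 - Re z\<bar> \<le> norm (c - z)" "\<bar>Im s - Im z\<bar> \<le> norm (c - z)" for z
      using abs_Re_le_cmod[of "c - z"] abs_Im_le_cmod[of "c - z"] by (auto simp: c_def)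
    have rez: "Re z > 1 / 2" "norm (z - 1) \<ge> 1" "norm z \<le> 4 * norm s" if "z \<in> ball c (5/2)" for z
    proof -
      have d: "norm (c - z) < 5/2" using that by (simp add: dist_norm)
      show "Re z > 1 / 2" using cz(1)[of z] d by linarith
      have "\<bar>Im z\<bar> \<ge> 1" using cz(2)[of z] d s(3) by linarith
      then show "norm (z - 1) \<ge> 1" using abs_Im_le_cmod[of "z - 1"] by simp
      have "norm z \<le> norm c + norm (c - z)" using norm_triangle_ineq4[of c "c - z"] by simp
      also have "norm c \<le> 3 + \<bar>Im s\<bar>" using cmod_le[of c] by (simp add: c_def)
      also have "3 + \<bar>Im s\<bar> + norm (c - z) \<le> 4 * \<bar>Im s\<bar>" using d s(3) by linarith
      also have "\<dots> \<le> 4 * norm s" using abs_Im_le_cmod[of s] by simp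
      finally show "norm z \<le> 4 * norm s" by simp
    qed
    define M where "M = (1 + 4 * D) * norm s"
    have ns: "norm s \<ge> 1" using abs_Im_le_cmod[of s] s(3) by linarith
    have "norm (1 / (zeta_reg s / (s - 1))) \<le> K * M powr (1/4)"
    proof (rule K(2)[rule_format, of "\<lambda>z. zeta_reg z / (z - 1)" c M s], intro conjI ballI)
      show "(\<lambda>z. zeta_reg z / (z - 1)) holomorphic_on ball c (5/2)"
        using rez by (intro holomorphic_intros holomorphic_on_subset[OF holomorphic_zeta_reg]) force+
      show "zeta_reg z / (z - 1) \<noteq> 0" if "z \<in> ball c (5/2)" for z
        using RH[OF rez(1)[OF that]] rez(2)[OF that] by auto
      show "norm (zeta_reg z / (z - 1)) \<le> M" if z: "z \<in> ball c (5/2)" for z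
      proof -
        have "norm (zeta_reg z) \<le> 1 + norm (z - 1) * norm z * D"
          unfolding D_def using rez(1)[OF z] by (intro norm_zeta_reg_le) auto
        then have "norm (zeta_reg z / (z - 1)) \<le> (1 + norm (z - 1) * norm z * D) / norm (z - 1)"
          unfolding norm_divide by (intro divide_right_mono) auto
        also have "\<dots> = 1 / norm (z - 1) + norm z * D"
          using rez(2)[OF z] by (subst add_divide_distrib) auto
        also have "\<dots> \<le> 1 + (4 * norm s) * D"
          using rez[OF z] D by (intro add_mono mult_right_mono) (auto simp: divide_simps)
        also have "\<dots> \<le> M" using ns by (simp add: M_def algebra_simps)
        finally show ?thesis .
      qed
      show "M \<ge> 1" unfolding M_def using mult_mono[of 1 "1 + 4 * D" 1 "norm s"] ns D by simp
      show "norm (zeta_reg z / (z - 1) - 1) \<le> 3 / 4" if "z \<in> ball c 1" for z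
        using cz(1)[of z] that by (intro zeta_near_one) (simp add: dist_norm)
      have "c - s = of_real (3 - Re s)" by (simp add: c_def complex_eq_iff)
      then have "norm (c - s) = \<bar>3 - Re s\<bar>" by (simp only: norm_of_real)
      then show "s \<in> cball c (5/2 - e)" using s by (simp add: dist_norm)
    qed
    also have "M powr (1/4) = (1 + 4 * D) powr (1/4) * norm s powr (1/4)"
      unfolding M_def by (rule powr_mult)
    finally show ?thesis by (simp add: mult.assoc)
  qed
  have right: "norm ((s - 1) / zeta_reg s) \<le> 4 * norm s powr (1/4)" if s: "Re s \<ge> 2" for s
  proof -
    have "1 / 4 \<le> norm (zeta_reg s / (s - 1))"
      using zeta_near_one[OF s] norm_triangle_ineq2[of 1 "1 - zeta_reg s / (s - 1)"]
      by (simp add: norm_minus_commute)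
    then have "1 / norm (zeta_reg s / (s - 1)) \<le> 1 / (1 / 4)" by (intro frac_le) auto
    then have 1: "norm ((s - 1) / zeta_reg s) \<le> 4" by (simp add: norm_divide)
    have "norm s \<ge> 1" using abs_Re_le_cmod[of s] s by linarith
    then have "norm s powr (1/4) \<ge> 1" by (intro ge_one_powr_ge_zero) auto
    with 1 show ?thesis by linarith
  qed
  \<comment> \<open>At low heights the disc could contain the pole; here compactness suffices, since
    \<open>(s - 1) / zeta_reg s\<close> is continuous even at s = 1.\<close>
  define T where "T = cbox (Complex (1/2 + e) (-5)) (Complex 2 5)"
  have "compact ((\<lambda>s. (s - 1) / zeta_reg s) ` T)"
  proof (rule compact_continuous_image)
    have "T \<subseteq> {s. Re s > 0}" using e by (auto simp: T_def in_cbox_complex_iff)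
    then have "continuous_on T zeta_reg"
      using holomorphic_on_imp_continuous_on[OF holomorphic_zeta_reg] continuous_on_subset by blast
    then show "continuous_on T (\<lambda>s. (s - 1) / zeta_reg s)"
      using RH e by (intro continuous_intros) (auto simp: T_def in_cbox_complex_iff)
  qed (simp add: T_def)
  then obtain B where "B > 0" "\<forall>x\<in>(\<lambda>s. (s - 1) / zeta_reg s) ` T. norm x \<le> B"
    using compact_imp_bounded bounded_pos by blast
  then have B: "B > 0" "\<And>s. s \<in> T \<Longrightarrow> norm ((s - 1) / zeta_reg s) \<le> B" by blast+
  have mid: "norm ((s - 1) / zeta_reg s) \<le> 2 * B * norm s powr (1/4)"
    if s: "1/2 + e \<le> Re s" "Re s \<le> 2" "\<bar>Im s\<bar> \<le> 5" for s
  proof -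
    have "norm s \<ge> 1/2" using abs_Re_le_cmod[of s] s e by linarith
    then have "(1/2) powr (1/4) \<le> norm s powr (1/4)" by (intro powr_mono2) auto
    moreover have "(1/2 :: real) powr 1 \<le> (1/2) powr (1/4)" by (rule powr_mono') auto
    ultimately have "1 / 2 \<le> norm s powr (1/4)" by simp
    then have "B * 1 \<le> B * (2 * norm s powr (1/4))" using B by (intro mult_left_mono) auto
    moreover have "norm ((s - 1) / zeta_reg s) \<le> B"
      using s by (intro B) (auto simp: T_def in_cbox_complex_iff)
    ultimately show ?thesis by (simp add: mult_ac)
  qed
  define C where "C = K * (1 + 4 * D) powr (1/4) + 4 + 2 * B"
  have C: "C \<ge> K * (1 + 4 * D) powr (1/4)" "C \<ge> 4" "C \<ge> 2 * B"
    using K(1) B(1) by (auto simp: C_def add_increasing2 add_increasing)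
  have fin: "norm ((s - 1) / zeta_reg s) \<le> C * norm s powr (1 / 4)" if "Re s \<ge> 1 / 2 + \<epsilon>" for s
  proof -
    have es: "Re s \<ge> 1/2 + e" using that e by simp
    consider "Re s \<ge> 2" | "Re s \<le> 2" "\<bar>Im s\<bar> \<ge> 5" | "Re s \<le> 2" "\<bar>Im s\<bar> \<le> 5" by linarith
    then show ?thesis
    proof cases
      case 1
      then show ?thesis using right[of s] mult_right_mono[OF C(2), of "norm s powr (1/4)"] by simp
    next
      case 2
      then show ?thesis using far[OF es] mult_right_mono[OF C(1), of "norm s powr (1/4)"] by fastforce
    next
      case 3
      then show ?thesis using mid[OF es] mult_right_mono[OF C(3), of "norm s powr (1/4)"] by fastforce
    qed
  qed
  show ?thesis using that[OF _ fin] C(2) by simp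
qed

section \<open>Quotients of the completed zeta function\<close>

lemma xi_cnj:
  assumes "Re s > 0"
  shows "xi (cnj s) = cnj (xi s)"
  using cnj_Gamma[of "s / 2"] by (simp add: xi_def zeta_reg_cnj[OF assms] exp_cnj)

text \<open>On horizontal lines $|\Gamma(x+iy)|/\Gamma(x)$ increases with $x$, by the Euler product.\<close>

lemma norm_Gamma_mono:
  assumes "0 < Re z" "Re z \<le> Re w" "Im z = Im w"
  shows "norm (Gamma z) * norm (Gamma (of_real (Re w) :: complex)) \<le> norm (Gamma w) * norm (Gamma (of_real (Re z) :: complex))"
proof (rule LIMSEQ_le)
  let ?G = "\<lambda>z n. norm (Gamma_series (z :: complex) n)"
  show "(\<lambda>n. ?G z n * ?G (of_real (Re w)) n) \<longlonglongrightarrow> norm (Gamma z) * norm (Gamma (of_real (Re w) :: complex))"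
       "(\<lambda>n. ?G w n * ?G (of_real (Re z)) n) \<longlonglongrightarrow> norm (Gamma w) * norm (Gamma (of_real (Re z) :: complex))"
    by (intro tendsto_intros Gamma_series_LIMSEQ)+
  have "?G z n * ?G (of_real (Re w)) n \<le> ?G w n * ?G (of_real (Re z)) n" for n
  proof -
    define P where "P = (\<lambda>z :: complex. \<Prod>i<Suc n. norm (z + of_nat i))"
    have G: "?G z n = fact n * exp (Re z * ln (real n)) / P z" for z
      by (simp add: Gamma_series_def P_def pochhammer_prod norm_divide norm_mult prod_norm atLeast0LessThan)
    have fac: "norm (w + of_nat i) * norm (of_real (Re z) + of_nat i :: complex)
        \<le> norm (z + of_nat i) * norm (of_real (Re w) + of_nat i :: complex)" for i
    proof -
      let ?a = "Re z + real i" and ?b = "Re w + real i" and ?y = "Im z"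
      have ab: "0 < ?a" "?a \<le> ?b" using assms by auto
      have r: "norm (of_real (Re u) + of_nat i :: complex) = Re u + real i" if "Re u > 0" for u
        using that by (metis norm_of_real of_real_add of_real_of_nat_eq abs_of_nonneg add_nonneg_nonneg less_imp_le of_nat_0_le_iff)
      have "?a\<^sup>2 * ?y\<^sup>2 \<le> ?b\<^sup>2 * ?y\<^sup>2" using ab by (intro mult_right_mono power_mono) auto
      then have "(?b\<^sup>2 + ?y\<^sup>2) * ?a\<^sup>2 \<le> (?a\<^sup>2 + ?y\<^sup>2) * ?b\<^sup>2" by (simp add: algebra_simps)
      then have "(norm (w + of_nat i) * ?a)\<^sup>2 \<le> (norm (z + of_nat i) * ?b)\<^sup>2"
        using assms by (simp add: power_mult_distrib cmod_power2)
      then have "norm (w + of_nat i) * ?a \<le> norm (z + of_nat i) * ?b"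
        by (rule power2_le_imp_le) (use ab in auto)
      then show ?thesis using r[of z] r[of w] assms by simp
    qed
    have "P w * P (of_real (Re z)) \<le> P z * P (of_real (Re w))"
      unfolding P_def prod.distrib[symmetric] by (intro prod_mono) (use fac in auto)
    moreover have pos: "P u > 0" if "Re u > 0" for u
      unfolding P_def
    proof (intro prod_pos)
      fix i assume "i \<in> {..<Suc n}"
      have "u + of_nat i \<noteq> 0" using that by (auto simp: complex_eq_iff)
      then show "0 < norm (u + of_nat i)" by simp
    qed
    ultimately have "1 / (P z * P (of_real (Re w))) \<le> 1 / (P w * P (of_real (Re z)))"
      using assms by (intro frac_le mult_pos_pos) auto
    then have "(fact n * exp (Re z * ln (real n)) * (fact n * exp (Re w * ln (real n)))) * (1 / (P z * P (of_real (Re w))))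
        \<le> (fact n * exp (Re z * ln (real n)) * (fact n * exp (Re w * ln (real n)))) * (1 / (P w * P (of_real (Re z))))"
      by (intro mult_left_mono) auto
    then show ?thesis unfolding G by (simp add: mult_ac)
  qed
  then show "\<exists>N. \<forall>n\<ge>N. ?G z n * ?G (of_real (Re w)) n \<le> ?G w n * ?G (of_real (Re z)) n" by blast
qed

text \<open>\<open>norm_Gamma_mono\<close> compares values on a horizontal line up to real Gamma
  values, which are bounded above and below on the compact interval [1/8, 2]. The second bound goes
  on to z + 1 and returns by Gamma(z + 1) = z Gamma(z). The interval fits the use at z = s/2 with
  1/4 \<le> Re s \<le> 2.\<close>

lemma Gamma_shift_bounds:
  obtains A where "A > 0"
    "\<And>z h. \<lbrakk>1 / 8 \<le> Re z; Re z \<le> 1; 0 \<le> h; h \<le> 1\<rbrakk> \<Longrightarrow> norm (Gamma z) \<le> A * norm (Gamma (z + of_real h))"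
    "\<And>z h. \<lbrakk>1 / 8 \<le> Re z; Re z \<le> 1; 0 \<le> h; h \<le> 1\<rbrakk> \<Longrightarrow> norm (Gamma (z + of_real h)) \<le> A * norm z * norm (Gamma z)"
proof -
  let ?N = "\<lambda>x::real. norm (Gamma (complex_of_real x))"
  have np: "complex_of_real x \<notin> \<int>\<^sub>\<le>\<^sub>0" if "x > 0" for x
    using that by (intro Re_pos_notin_nonpos_Ints) simp
  have cont: "continuous_on {1/8..2} (\<lambda>x. Gamma (complex_of_real x))"
  proof -
    have "continuous_on (complex_of_real ` {1/8..2}) Gamma"
      by (rule continuous_on_Gamma) (use np in auto)
    then show ?thesis
      by (rule continuous_on_compose2) (auto intro!: continuous_on_of_real continuous_on_id)
  qed
  then have "compact ((\<lambda>x. Gamma (complex_of_real x)) ` {1/8..2})"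
    by (intro compact_continuous_image) auto
  then obtain g1 where "g1 > 0" "\<forall>y\<in>(\<lambda>x. Gamma (complex_of_real x)) ` {1/8..2}. norm y \<le> g1"
    using compact_imp_bounded bounded_pos by blast
  then have g1: "g1 > 0" "\<And>x. x \<in> {1/8..2} \<Longrightarrow> ?N x \<le> g1" by blast+
  have "compact ((\<lambda>x. 1 / Gamma (complex_of_real x)) ` {1/8..2})"
    using np by (intro compact_continuous_image continuous_intros cont) (auto simp: Gamma_eq_zero_iff)
  then obtain g0 where "g0 > 0" "\<forall>y\<in>(\<lambda>x. 1 / Gamma (complex_of_real x)) ` {1/8..2}. norm y \<le> g0"
    using compact_imp_bounded bounded_pos by blast
  then have g0: "g0 > 0" "\<And>x. x \<in> {1/8..2} \<Longrightarrow> norm (1 / Gamma (complex_of_real x)) \<le> g0" by blast+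
  have g0': "1 \<le> g0 * ?N x" if "x \<in> {1/8..2}" for x
  proof -
    have "?N x > 0" using np[of x] that by (auto simp: Gamma_eq_zero_iff)
    then show ?thesis using g0(2)[OF that] by (simp add: norm_divide field_simps)
  qed
  have up: "norm (Gamma z) \<le> (g1 * g0) * norm (Gamma w)"
    if "1/8 \<le> Re z" "Re z \<le> Re w" "Re w \<le> 2" "Im z = Im w" for z w
  proof -
    have "norm (Gamma z) * 1 \<le> norm (Gamma z) * (g0 * ?N (Re w))"
      using that by (intro mult_left_mono g0') auto
    also have "\<dots> = g0 * (norm (Gamma z) * ?N (Re w))" by simp
    also have "\<dots> \<le> g0 * (norm (Gamma w) * ?N (Re z))"
      using that g0 by (intro mult_left_mono norm_Gamma_mono) auto
    also have "\<dots> \<le> g0 * (norm (Gamma w) * g1)"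
      using that g0 by (intro mult_left_mono g1) auto
    finally show ?thesis by (simp add: mult_ac)
  qed
  show ?thesis
  proof (rule that[of "g1 * g0"])
    show "g1 * g0 > 0" using g0 g1 by simp
    fix z :: complex and h :: real assume zh: "1 / 8 \<le> Re z" "Re z \<le> 1" "0 \<le> h" "h \<le> 1"
    show "norm (Gamma z) \<le> g1 * g0 * norm (Gamma (z + of_real h))"
      using zh by (intro up) auto
    have "norm (Gamma (z + of_real h)) \<le> (g1 * g0) * norm (Gamma (z + 1))"
      using zh by (intro up) auto
    also have "Gamma (z + 1) = z * Gamma z"
      using zh by (intro Gamma_plus1 Re_pos_notin_nonpos_Ints) auto
    finally show "norm (Gamma (z + of_real h)) \<le> g1 * g0 * norm z * norm (Gamma z)"
      by (simp add: norm_mult mult_ac)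
  qed
qed

text \<open>The factor exp(\<eta> s^2) decays like exp(-\<eta> y^2) in the strip and beats
  polynomial growth on the horizontal sides of a tall rectangle; then \<eta> tends to 0. As
  \<open>C\<close> and \<open>n\<close> do not appear in the conclusion, they may later depend on
  \<epsilon>.\<close>

lemma phragmen_lindelof_strip:
  fixes q :: "complex \<Rightarrow> complex"
  assumes ab: "0 \<le> a" "a < b"
    and hol: "q holomorphic_on {s. a < Re s \<and> Re s < b}"
    and cont: "continuous_on {s. a \<le> Re s \<and> Re s \<le> b} q"
    and left: "\<And>s. Re s = a \<Longrightarrow> norm (q s) \<le> B"
    and right: "\<And>s. Re s = b \<Longrightarrow> norm (q s) \<le> B"
    and growth: "\<And>s. \<lbrakk>a \<le> Re s; Re s \<le> b; \<bar>Im s\<bar> \<ge> 1\<rbrakk> \<Longrightarrow> norm (q s) \<le> C * \<bar>Im s\<bar> ^ n"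
    and B: "B > 0" and s: "a \<le> Re s" "Re s \<le> b"
  shows "norm (q s) \<le> B"
proof -
  have step: "norm (q s * exp (of_real \<eta> * s\<^sup>2)) \<le> B * exp (\<eta> * b\<^sup>2)" if \<eta>: "\<eta> > 0" for \<eta>
  proof -
    have ne: "norm (exp (of_real \<eta> * z\<^sup>2)) = exp (\<eta> * ((Re z)\<^sup>2 - (Im z)\<^sup>2))" for z
      by (simp add: power2_eq_square)
    have ne_le: "norm (exp (of_real \<eta> * z\<^sup>2)) \<le> exp (\<eta> * b\<^sup>2) * exp (- \<eta> * (Im z)\<^sup>2)" if "a \<le> Re z" "Re z \<le> b" for z
    proof -
      have "(Re z)\<^sup>2 \<le> b\<^sup>2" using that ab by (intro power_mono) auto
      then have "\<eta> * ((Re z)\<^sup>2 - (Im z)\<^sup>2) \<le> \<eta> * b\<^sup>2 + - \<eta> * (Im z)\<^sup>2"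
        using \<eta> by (simp add: right_diff_distrib)
      then show ?thesis unfolding ne exp_add[symmetric] by (simp only: exp_le_cancel_iff)
    qed
    have "((\<lambda>T. C * T ^ n * exp (- \<eta> * T\<^sup>2)) \<longlongrightarrow> C * 0) at_top"
    proof -
      have "((\<lambda>T::real. T ^ n * exp (- \<eta> * T\<^sup>2)) \<longlongrightarrow> 0) at_top" using \<eta> by real_asymp
      from tendsto_mult[OF tendsto_const[of C] this] show ?thesis by (simp add: mult.assoc)
    qed
    then have "eventually (\<lambda>T. C * T ^ n * exp (- \<eta> * T\<^sup>2) < B) at_top"
      using B by (intro order_tendstoD(2)) auto
    then have "eventually (\<lambda>T. C * T ^ n * exp (- \<eta> * T\<^sup>2) < B \<and> T > \<bar>Im s\<bar> \<and> T \<ge> 1) at_top"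
      using eventually_gt_at_top[of "\<bar>Im s\<bar>"] eventually_ge_at_top[of 1] by eventually_elim auto
    then obtain T where T: "C * T ^ n * exp (- \<eta> * T\<^sup>2) < B" "T > \<bar>Im s\<bar>" "T \<ge> 1"
      by (auto simp: eventually_at_top_linorder)
    define S where "S = cbox (Complex a (-T)) (Complex b T)"
    have inS: "z \<in> S \<longleftrightarrow> a \<le> Re z \<and> Re z \<le> b \<and> -T \<le> Im z \<and> Im z \<le> T" for z
      by (auto simp: S_def in_cbox_complex_iff)
    have int: "interior S = {z. a < Re z \<and> Re z < b \<and> -T < Im z \<and> Im z < T}"
      unfolding S_def interior_cbox by (auto simp: in_box_complex_iff)
    show ?thesis
    proof (rule maximum_modulus_frontier[of "\<lambda>s. q s * exp (of_real \<eta> * s\<^sup>2)" S])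
      show "(\<lambda>s. q s * exp (of_real \<eta> * s\<^sup>2)) holomorphic_on interior S"
        unfolding int by (intro holomorphic_intros holomorphic_on_subset[OF hol]) auto
      have "closure S = S" unfolding S_def by simp
      then show "continuous_on (closure S) (\<lambda>s. q s * exp (of_real \<eta> * s\<^sup>2))"
        by (auto intro!: continuous_intros continuous_on_subset[OF cont] simp: inS)
      show "bounded S" unfolding S_def by simp
      show "s \<in> S" using s T(2) by (auto simp: inS)
      fix z assume "z \<in> frontier S"
      then have z: "z \<in> S" "z \<notin> interior S"
        using \<open>closure S = S\<close> by (auto simp: frontier_def)
      have zs: "a \<le> Re z" "Re z \<le> b" using z by (auto simp: inS)
      have "norm (q z) * exp (- \<eta> * (Im z)\<^sup>2) \<le> B"
      proof (cases "Re z = a \<or> Re z = b")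
        case True
        then have "norm (q z) \<le> B" using left right by auto
        moreover have "exp (- \<eta> * (Im z)\<^sup>2) \<le> 1" using \<eta> by simp
        ultimately show ?thesis using mult_mono[of "norm (q z)" B "exp (- \<eta> * (Im z)\<^sup>2)" 1] B by simp
      next
        case False
        then have im: "\<bar>Im z\<bar> = T" using z T(3) by (auto simp: inS int)
        then have "norm (q z) \<le> C * T ^ n" using growth[OF zs] T(3) by simp
        moreover have "(Im z)\<^sup>2 = T\<^sup>2" using im by (metis power2_abs)
        ultimately have "norm (q z) * exp (- \<eta> * (Im z)\<^sup>2) \<le> C * T ^ n * exp (- \<eta> * T\<^sup>2)"
          by (simp add: mult_right_mono)
        then show ?thesis using T(1) by linarith
      qed
      then have "exp (\<eta> * b\<^sup>2) * (norm (q z) * exp (- \<eta> * (Im z)\<^sup>2)) \<le> exp (\<eta> * b\<^sup>2) * B"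
        by (intro mult_left_mono) auto
      moreover have "norm (q z * exp (of_real \<eta> * z\<^sup>2)) \<le> norm (q z) * (exp (\<eta> * b\<^sup>2) * exp (- \<eta> * (Im z)\<^sup>2))"
        unfolding norm_mult using ne_le[OF zs] by (intro mult_left_mono) auto
      moreover have "norm (q z) * (exp (\<eta> * b\<^sup>2) * exp (- \<eta> * (Im z)\<^sup>2)) = exp (\<eta> * b\<^sup>2) * (norm (q z) * exp (- \<eta> * (Im z)\<^sup>2))"
        by (rule mult.left_commute)
      ultimately show "norm (q z * exp (of_real \<eta> * z\<^sup>2)) \<le> B * exp (\<eta> * b\<^sup>2)"
        by (simp only: mult.commute[of B])
    qed
  qed
  have h0: "(\<lambda>k. 1 / real (Suc k)) \<longlonglongrightarrow> 0" by real_asymp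
  have "(\<lambda>k. norm (q s * exp (of_real (1 / real (Suc k)) * s\<^sup>2))) \<longlonglongrightarrow> norm (q s * exp (of_real 0 * s\<^sup>2))"
    by (intro tendsto_intros h0)
  moreover have "(\<lambda>k. B * exp (1 / real (Suc k) * b\<^sup>2)) \<longlonglongrightarrow> B * exp (0 * b\<^sup>2)"
    by (intro tendsto_intros h0)
  ultimately have "norm (q s * exp (of_real 0 * s\<^sup>2)) \<le> B * exp (0 * b\<^sup>2)"
    by (rule LIMSEQ_le) (use step[of "1 / real (Suc k)" for k] in auto)
  then show ?thesis by simp
qed

lemma norm_add_of_real_mono:
  assumes "0 \<le> Re s" "0 \<le> e"
  shows "norm s \<le> norm (s + of_real e)"
  unfolding cmod_def using assms by (auto intro!: power_mono)

section \<open>Bounds when zeta has no zeros right of the critical line\<close>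

context
  assumes RH: "\<And>s. Re s > 1 / 2 \<Longrightarrow> zeta_reg s \<noteq> 0"
begin

lemma xi_nonzero:
  assumes "Re s > 1 / 2"
  shows "xi s \<noteq> 0"
proof -
  have "Gamma (s / 2) \<noteq> 0" using assms by (intro Gamma_nonzero Re_pos_notin_nonpos_Ints) simp
  then show ?thesis using RH[OF assms] assms by (auto simp: xi_def)
qed

lemma holomorphic_xi: "xi holomorphic_on {s. Re s > 0}"
proof -
  have G: "(\<lambda>s. Gamma (s / 2)) holomorphic_on {s. Re s > 0}"
    using holomorphic_on_compose_gen[of "\<lambda>s. s / 2" "{s. Re s > 0}" Gamma "- \<int>\<^sub>\<le>\<^sub>0", unfolded o_def]
      holomorphic_Gamma[of "- \<int>\<^sub>\<le>\<^sub>0"] Re_pos_notin_nonpos_Ints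
    by (force intro!: holomorphic_on_divide holomorphic_on_ident holomorphic_on_const)
  have E: "(\<lambda>s. exp (- (s / 2) * of_real (ln pi))) holomorphic_on {s. Re s > 0}"
    by (auto intro!: holomorphic_intros)
  show ?thesis unfolding xi_def by (intro holomorphic_on_mult holomorphic_on_ident holomorphic_zeta_reg E G)
qed

lemma norm_exp_ln_pi: "norm (exp (- (s / 2) * of_real (ln pi))) = exp (- (Re s / 2) * ln pi)"
  by simp

text \<open>On the left edge Re s = (1 - \<epsilon>)/2 the point 1 - s is the conjugate of s +
  \<epsilon>, so functional equation and conjugation symmetry force modulus one there. This edge
  lies left of 1/2, while s + \<epsilon> stays right of it, so the denominator has no zero in the
  strip. Only the growth constant depends on \<epsilon>.\<close>

lemma xi_quotient_bound:
  obtains B where "B > 0"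
    "\<And>\<epsilon> s. \<lbrakk>0 < \<epsilon>; \<epsilon> \<le> 1 / 2; Re s = 1 / 2\<rbrakk> \<Longrightarrow> norm (xi s) \<le> B * norm (xi (s + of_real \<epsilon>))"
proof -
  obtain A where A: "A > 0"
    "\<And>z h. \<lbrakk>1 / 8 \<le> Re z; Re z \<le> 1; 0 \<le> h; h \<le> 1\<rbrakk> \<Longrightarrow> norm (Gamma z) \<le> A * norm (Gamma (z + of_real h))"
    using Gamma_shift_bounds by metis
  \<comment> \<open>1 serves the left edge. On Re s = 2, 7 = (7/4) 4 bounds the zeta quotient by
    \<open>zeta_near_one\<close>, \<open>A\<close> the Gamma quotient and exp (ln pi) the power of
    pi.\<close>
  define B where "B = 1 + 7 * A * exp (ln pi)"
  have B: "B > 0" "B \<ge> 1" using A by (auto simp: B_def add_pos_nonneg)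
  have main: "norm (xi s) \<le> B * norm (xi (s + of_real \<epsilon>))" if e: "0 < \<epsilon>" "\<epsilon> \<le> 1 / 2" and s: "Re s = 1 / 2" for \<epsilon> s
  proof -
    define q where "q = (\<lambda>s. xi s / xi (s + of_real \<epsilon>))"
    define a where "a = 1 / 2 - \<epsilon> / 2"
    have a: "1 / 4 \<le> a" "a < 1 / 2" "0 \<le> a" "a < 2" "a + \<epsilon> > 1/2" using e by (auto simp: a_def)
    have nz: "xi (s + of_real \<epsilon>) \<noteq> 0" if "a \<le> Re s" for s
      using that a by (intro xi_nonzero) simp
    have nz2: "xi (s + of_real \<epsilon>) \<noteq> 0" if "1/2 - \<epsilon> < Re s" for s
      using that by (intro xi_nonzero) simp
    have hol: "q holomorphic_on {s. Re s > 1/2 - \<epsilon>} \<inter> {s. Re s > 0}"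
    proof -
      have "(xi \<circ> (\<lambda>s. s + of_real \<epsilon>)) holomorphic_on {s. Re s > 1/2 - \<epsilon>} \<inter> {s. Re s > 0}"
        using e by (intro holomorphic_on_compose_gen[OF _ holomorphic_xi] holomorphic_intros) auto
      then show ?thesis unfolding q_def o_def
        by (intro holomorphic_on_divide holomorphic_on_subset[OF holomorphic_xi])
           (auto dest: nz2)
    qed
    have quot: "norm (q s) \<le> norm (zeta_reg s) * norm (1 / zeta_reg (s + of_real \<epsilon>)) * (A * exp (ln pi))"
      if s: "a \<le> Re s" "Re s \<le> 2" for s
    proof -
      have s0: "Re (s + of_real \<epsilon>) > 1/2" using s a by simp
      have G: "norm (Gamma (s / 2)) \<le> A * norm (Gamma ((s + of_real \<epsilon>) / 2))"
        using A(2)[of "s / 2" "\<epsilon> / 2"] s a e by (simp add: add_divide_distrib)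
      have Gn: "norm (Gamma ((s + of_real \<epsilon>) / 2)) > 0"
        using Re_pos_notin_nonpos_Ints[of "(s + of_real \<epsilon>) / 2"] s0 by (simp add: Gamma_eq_zero_iff)
      have ns: "norm s \<le> norm (s + of_real \<epsilon>)"
        using s a e by (intro norm_add_of_real_mono) auto
      have E: "exp (- (Re s / 2) * ln pi) = exp (\<epsilon> / 2 * ln pi) * exp (- (Re (s + of_real \<epsilon>) / 2) * ln pi)"
        by (simp add: exp_add[symmetric] algebra_simps add_divide_distrib)
      have E2: "exp (\<epsilon> / 2 * ln pi) \<le> exp (ln pi)"
      proof -
        have "\<epsilon> / 2 * ln pi \<le> 1 * ln pi" using e pi_gt3 by (intro mult_right_mono ln_ge_zero) auto
        then show ?thesis by (simp only: exp_le_cancel_iff mult_1)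
      qed
      let ?e = "exp (- (Re (s + of_real \<epsilon>) / 2) * ln pi)"
      have "norm (xi s) = norm s * norm (zeta_reg s) * (exp (- (Re s / 2) * ln pi) * norm (Gamma (s / 2)))"
        unfolding xi_def norm_mult norm_exp_ln_pi ..
      also have "\<dots> \<le> norm (s + of_real \<epsilon>) * norm (zeta_reg s) * ((exp (ln pi) * ?e) * (A * norm (Gamma ((s + of_real \<epsilon>) / 2))))"
        unfolding E using E2 G ns A(1) by (intro mult_mono mult_nonneg_nonneg) auto
      finally have x: "norm (xi s) \<le> norm (s + of_real \<epsilon>) * norm (zeta_reg s) * ((exp (ln pi) * ?e) * (A * norm (Gamma ((s + of_real \<epsilon>) / 2))))" .
      have "norm (xi (s + of_real \<epsilon>)) = norm (s + of_real \<epsilon>) * norm (zeta_reg (s + of_real \<epsilon>)) * (?e * norm (Gamma ((s + of_real \<epsilon>) / 2)))"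
        unfolding xi_def norm_mult norm_exp_ln_pi ..
      moreover have "norm (s + of_real \<epsilon>) > 0"
        using less_le_trans[OF s0 complex_Re_le_cmod] by linarith
      moreover have "norm (zeta_reg (s + of_real \<epsilon>)) > 0" using RH[OF s0] by simp
      moreover have "norm (q s) = norm (xi s) / norm (xi (s + of_real \<epsilon>))" by (simp add: q_def norm_divide)
      moreover have "X * Zs * ((P * E) * (A * Gm)) / (X * Zp * (E * Gm)) = Zs * (1 / Zp) * (A * P)"
        if "X > 0" "Zp > 0" "E > 0" "Gm > 0" for X Zs P E Gm Zp :: real
        using that by simp
      ultimately show ?thesis using divide_right_mono[OF x norm_ge_zero[of "xi (s + of_real \<epsilon>)"]] Gn
        by (simp only: norm_divide norm_one exp_gt_zero)
    qed
    obtain C1 where C1: "C1 > 0" "\<And>s. Re s \<ge> 1 / 2 + \<epsilon> / 2 \<Longrightarrow> norm ((s - 1) / zeta_reg s) \<le> C1 * norm s powr (1 / 4)"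
      using reciprocal_zeta_bound[OF RH, of "\<epsilon> / 2"] e by auto
    define D where "D = (\<Sum>n. real (Suc n) powr (- (1 / 4) - 1))"
    have D: "D \<ge> 0" unfolding D_def by (intro suminf_nonneg summable_Suc_powr) auto
    \<comment> \<open>Crude cubic growth: \<open>zeta_reg s\<close> contributes t^2 and the
      reciprocal at s + \<epsilon> contributes t, by Littlewood's bound with exponent 1/4 relaxed to
      1.\<close>
    define C where "C = (1 + 9 * D) * (4 * C1) * (A * exp (ln pi))"
    have growth: "norm (q s) \<le> C * \<bar>Im s\<bar> ^ 3" if s: "a \<le> Re s" "Re s \<le> 2" "\<bar>Im s\<bar> \<ge> 1" for s
    proof -
      define t where "t = \<bar>Im s\<bar>"
      have t: "t \<ge> 1" using s by (simp add: t_def)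
      have ns: "norm s \<le> 3 * t" "norm (s - 1) \<le> 3 * t" "norm (s + of_real \<epsilon>) \<le> 4 * t"
        using cmod_le[of s] cmod_le[of "s - 1"] cmod_le[of "s + of_real \<epsilon>"] s a e t by (auto simp: t_def)
      have "norm (zeta_reg s) \<le> 1 + norm (s - 1) * norm s * D"
        unfolding D_def using s a by (intro norm_zeta_reg_le) auto
      also have "\<dots> \<le> t\<^sup>2 + (3 * t) * (3 * t) * D"
        using ns t D by (intro add_mono mult_mono mult_right_mono) (auto simp: power2_eq_square mult_ge1_I)
      finally have z1: "norm (zeta_reg s) \<le> (1 + 9 * D) * t\<^sup>2" by (simp add: power2_eq_square algebra_simps)
      let ?w = "s + of_real \<epsilon>"
      have w: "norm (?w - 1) \<ge> 1" "norm ?w \<ge> 1" "Re ?w \<ge> 1 / 2 + \<epsilon> / 2"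
        using abs_Im_le_cmod[of "?w - 1"] abs_Im_le_cmod[of ?w] s by (auto simp: a_def)
      have "norm (1 / zeta_reg ?w) \<le> norm ((?w - 1) / zeta_reg ?w)"
        unfolding norm_divide using w by (intro divide_right_mono) auto
      also have "\<dots> \<le> C1 * norm ?w powr (1 / 4)" by (rule C1(2)[OF w(3)])
      also have "\<dots> \<le> C1 * norm ?w powr 1" using w C1 by (intro mult_left_mono powr_mono) auto
      also have "\<dots> \<le> C1 * (4 * t)" using ns C1 w by (intro mult_left_mono) auto
      finally have z2: "norm (1 / zeta_reg ?w) \<le> 4 * C1 * t" by simp
      have "norm (q s) \<le> norm (zeta_reg s) * norm (1 / zeta_reg ?w) * (A * exp (ln pi))"
        by (rule quot[OF s(1,2)])
      also have "\<dots> \<le> ((1 + 9 * D) * t\<^sup>2) * (4 * C1 * t) * (A * exp (ln pi))"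
        using z1 z2 A(1) D t by (intro mult_right_mono mult_mono) auto
      also have "\<dots> = C * t ^ 3" by (simp add: C_def power2_eq_square power3_eq_cube)
      finally show ?thesis by (simp add: t_def)
    qed
    have "norm (q s) \<le> B"
    proof (rule phragmen_lindelof_strip[of a 2 q B C 3 s])
      show "q holomorphic_on {s. a < Re s \<and> Re s < 2}"
        by (rule holomorphic_on_subset[OF hol]) (use a in auto)
      show "continuous_on {s. a \<le> Re s \<and> Re s \<le> 2} q"
        by (rule continuous_on_subset[OF holomorphic_on_imp_continuous_on[OF hol]]) (use a in auto)
      show "norm (q s) \<le> B" if "Re s = a" for s
      proof -
        have "xi s = xi (1 - s)" using that a by (intro xi_functional_equation) auto
        also have "1 - s = cnj (s + of_real \<epsilon>)" using that by (simp add: complex_eq_iff a_def field_simps)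
        also have "xi \<dots> = cnj (xi (s + of_real \<epsilon>))" using that a by (intro xi_cnj) auto
        finally have "norm (xi s) = norm (xi (s + of_real \<epsilon>))" by simp
        then show ?thesis using nz[of s] that B by (simp add: q_def norm_divide)
      qed
      show "norm (q s) \<le> B" if s: "Re s = 2" for s
      proof -
        have se: "Re (s + of_real \<epsilon>) \<ge> 2" using s e by simp
        have z1: "norm (zeta_reg s) \<le> 7 / 4 * norm (s - 1)"
        proof -
          have "norm (zeta_reg s / (s - 1)) \<le> 7 / 4"
            using zeta_near_one[of s] s norm_triangle_ineq2[of "zeta_reg s / (s - 1)" 1] by simp
          moreover have "norm (s - 1) > 0" using s by auto
          ultimately show ?thesis by (simp add: norm_divide divide_simps)
        qed
        have z2: "norm (1 / zeta_reg (s + of_real \<epsilon>)) \<le> 4 / norm (s + of_real \<epsilon> - 1)"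
        proof -
          have "1 / 4 \<le> norm (zeta_reg (s + of_real \<epsilon>) / (s + of_real \<epsilon> - 1))"
            using zeta_near_one[OF se] norm_triangle_ineq2[of 1 "1 - zeta_reg (s + of_real \<epsilon>) / (s + of_real \<epsilon> - 1)"]
            by (simp add: norm_minus_commute)
          moreover have "norm (s + of_real \<epsilon> - 1) > 0"
          proof -
            have "Re (s + of_real \<epsilon> - 1) \<ge> 1" using se by simp
            then show ?thesis using complex_Re_le_cmod[of "s + of_real \<epsilon> - 1"] by linarith
          qed
          moreover have "zeta_reg (s + of_real \<epsilon>) \<noteq> 0" using se by (intro RH) simp
          ultimately show ?thesis by (simp add: norm_divide field_simps)
        qed
        have ms: "norm (s - 1) \<le> norm (s + of_real \<epsilon> - 1)" "norm (s - 1) > 0"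
          using s e norm_add_of_real_mono[of "s - 1" \<epsilon>] by (auto simp: algebra_simps)
        have "norm (zeta_reg s) * norm (1 / zeta_reg (s + of_real \<epsilon>)) \<le> (7 / 4 * norm (s - 1)) * (4 / norm (s + of_real \<epsilon> - 1))"
          by (intro mult_mono z1 z2) auto
        also have "\<dots> \<le> 7" using ms by (simp add: divide_simps)
        finally have "norm (zeta_reg s) * norm (1 / zeta_reg (s + of_real \<epsilon>)) \<le> 7" .
        then have "norm (zeta_reg s) * norm (1 / zeta_reg (s + of_real \<epsilon>)) * (A * exp (ln pi)) \<le> 7 * (A * exp (ln pi))"
          using A(1) by (intro mult_right_mono) auto
        with quot[of s] s a have "norm (q s) \<le> 7 * (A * exp (ln pi))" by linarith
        then show ?thesis by (simp add: B_def)
      qed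
      show "B > 0" "0 \<le> a" "a < 2" "a \<le> Re s" "Re s \<le> 2" using B a s by auto
      show "norm (q s) \<le> C * \<bar>Im s\<bar> ^ 3" if "a \<le> Re s" "Re s \<le> 2" "\<bar>Im s\<bar> \<ge> 1" for s
        by (rule growth[OF that])
    qed
    then show ?thesis using nz[of s] s a by (simp add: q_def norm_divide divide_simps)
  qed
  show ?thesis using that[OF B(1) main] .
qed

text \<open>Removing the Gamma factors from \<open>xi_quotient_bound\<close> costs a factor of order
  |s|, because Gamma((s + \<epsilon>)/2) is at most of order |s| times Gamma(s/2). The constant is
  independent of \<epsilon>, so the bound can dominate a limit.\<close>

theorem zeta_quotient_bound:
  obtains C where "C > 0"
    "\<And>\<epsilon> s. \<lbrakk>0 < \<epsilon>; \<epsilon> \<le> 1 / 2; Re s = 1 / 2\<rbrakk>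
       \<Longrightarrow> norm (zeta_reg s / (s - 1) * ((s + of_real \<epsilon> - 1) / zeta_reg (s + of_real \<epsilon>))) \<le> C * norm s"
proof -
  obtain B where B: "B > 0"
    "\<And>\<epsilon> s. \<lbrakk>0 < \<epsilon>; \<epsilon> \<le> 1 / 2; Re s = 1 / 2\<rbrakk> \<Longrightarrow> norm (xi s) \<le> B * norm (xi (s + of_real \<epsilon>))"
    using xi_quotient_bound by metis
  obtain A where A: "A > 0"
    "\<And>z h. \<lbrakk>1 / 8 \<le> Re z; Re z \<le> 1; 0 \<le> h; h \<le> 1\<rbrakk> \<Longrightarrow> norm (Gamma (z + of_real h)) \<le> A * norm z * norm (Gamma z)"
    using Gamma_shift_bounds by metis
  have main: "norm (zeta_reg s / (s - 1) * ((s + of_real \<epsilon> - 1) / zeta_reg (s + of_real \<epsilon>))) \<le> (A * B) * norm s"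
    if e: "0 < \<epsilon>" "\<epsilon> \<le> 1 / 2" and s: "Re s = 1 / 2" for \<epsilon> s
  proof -
    let ?w = "s + of_real \<epsilon>"
    have zw: "zeta_reg ?w \<noteq> 0" using RH[of ?w] s e by simp
    have ns: "norm s \<ge> 1 / 2" using abs_Re_le_cmod[of s] s by simp
    have nw: "norm ?w \<le> 2 * norm s" using norm_triangle_ineq[of s "of_real \<epsilon>"] ns e by simp
    have Gs: "norm (Gamma (s / 2)) > 0"
      using Re_pos_notin_nonpos_Ints[of "s / 2"] s by (simp add: Gamma_eq_zero_iff)
    have G: "norm (Gamma (?w / 2)) \<le> A * (norm s / 2) * norm (Gamma (s / 2))"
      using A(2)[of "s / 2" "\<epsilon> / 2"] s e by (simp add: add_divide_distrib norm_divide)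
    let ?E = "exp (- (Re s / 2) * ln pi)"
    have E: "exp (- (Re ?w / 2) * ln pi) \<le> ?E"
    proof -
      have "(Re s / 2) * ln pi \<le> (Re ?w / 2) * ln pi" using e pi_gt3 by (intro mult_right_mono ln_ge_zero) auto
      then show ?thesis by simp
    qed
    have "norm s * norm (zeta_reg s) * (?E * norm (Gamma (s / 2))) = norm (xi s)"
      unfolding xi_def norm_mult norm_exp_ln_pi ..
    also have "\<dots> \<le> B * norm (xi ?w)" by (rule B(2)[OF e s])
    also have "\<dots> = B * (norm ?w * norm (zeta_reg ?w) * (exp (- (Re ?w / 2) * ln pi) * norm (Gamma (?w / 2))))"
      unfolding xi_def norm_mult norm_exp_ln_pi ..
    also have "\<dots> \<le> B * ((2 * norm s) * norm (zeta_reg ?w) * (?E * (A * (norm s / 2) * norm (Gamma (s / 2)))))"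
      using B(1) nw E G by (intro mult_left_mono mult_mono mult_nonneg_nonneg) auto
    also have "\<dots> = (norm s * (?E * norm (Gamma (s / 2)))) * ((A * B) * norm s * norm (zeta_reg ?w))" by simp
    finally have "(norm s * (?E * norm (Gamma (s / 2)))) * norm (zeta_reg s)
        \<le> (norm s * (?E * norm (Gamma (s / 2)))) * ((A * B) * norm s * norm (zeta_reg ?w))" by (simp only: mult_ac)
    moreover have "norm s * (?E * norm (Gamma (s / 2))) > 0"
      using ns Gs by (intro mult_pos_pos) auto
    ultimately have z: "norm (zeta_reg s) \<le> (A * B) * norm s * norm (zeta_reg ?w)"
      by (simp only: mult_le_cancel_left_pos)
    have "norm (zeta_reg s) / norm (zeta_reg ?w) \<le> (A * B) * norm s"
      using z zw by (simp add: divide_simps)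
    moreover have "norm (?w - 1) / norm (s - 1) \<le> 1"
    proof -
      \<comment> \<open>The shift moves the real part from 1/2 towards 1, so the distance to 1 does
        not grow.\<close>
      have "(Re ?w - 1)\<^sup>2 \<le> (Re s - 1)\<^sup>2"
        using s e by (subst abs_le_square_iff[symmetric]) auto
      then have "norm (?w - 1) \<le> norm (s - 1)" unfolding cmod_def by auto
      then show ?thesis by (simp add: divide_le_eq_1)
    qed
    ultimately have "(norm (zeta_reg s) / norm (zeta_reg ?w)) * (norm (?w - 1) / norm (s - 1)) \<le> ((A * B) * norm s) * 1"
      using A(1) B(1) by (intro mult_mono) auto
    then show ?thesis by (simp add: norm_mult norm_divide mult_ac)
  qed
  show ?thesis using that[of "A * B"] main A(1) B(1) by simp
qed

end

section \<open>Approximation by Dirichlet polynomials\<close>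

definition dirichlet_poly :: "(complex \<Rightarrow> complex) \<Rightarrow> bool" where
  "dirichlet_poly P \<longleftrightarrow> (\<exists>N c. P = (\<lambda>s. \<Sum>i<N. c i * of_nat (Suc i) powr (- s)))"

section \<open>Closure properties of Dirichlet polynomials\<close>

lemma dirichlet_poly_zero: "dirichlet_poly (\<lambda>s. 0)"
  unfolding dirichlet_poly_def by (rule exI[of _ 0]) simp

lemma dirichlet_poly_monomial: "dirichlet_poly (\<lambda>s. c * of_nat (Suc n) powr (- s))"
proof -
  have "(\<Sum>i<Suc n. (if i = n then c else 0) * of_nat (Suc i) powr (- s)) = c * of_nat (Suc n) powr (- s)" for s
    by (simp add: if_distrib[of "\<lambda>x. x * _"] sum.delta cong: if_cong del: of_nat_Suc)
  then show ?thesis unfolding dirichlet_poly_def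
    by (intro exI[of _ "Suc n"] exI[of _ "\<lambda>i. if i = n then c else 0"]) (simp del: of_nat_Suc sum.lessThan_Suc)
qed

lemma dirichlet_poly_const: "dirichlet_poly (\<lambda>s. c)"
  using dirichlet_poly_monomial[of c 0] by simp

lemma dirichlet_poly_add:
  assumes "dirichlet_poly P" "dirichlet_poly Q"
  shows "dirichlet_poly (\<lambda>s. P s + Q s)"
proof -
  obtain N c where P: "P = (\<lambda>s. \<Sum>i<N. c i * of_nat (Suc i) powr (- s))" using assms(1) by (auto simp: dirichlet_poly_def)
  obtain M d where Q: "Q = (\<lambda>s. \<Sum>i<M. d i * of_nat (Suc i) powr (- s))" using assms(2) by (auto simp: dirichlet_poly_def)
  have ext: "(\<Sum>i<N. c i * g i) = (\<Sum>i<max N M. (if i < N then c i else 0) * g i)"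
    "(\<Sum>i<M. d i * g i) = (\<Sum>i<max N M. (if i < M then d i else 0) * g i)" for g :: "nat \<Rightarrow> complex"
    by (intro sum.mono_neutral_cong_left; auto)+
  show ?thesis unfolding P Q dirichlet_poly_def ext sum.distrib[symmetric] distrib_right[symmetric]
    by (intro exI[of _ "max N M"] exI[of _ "\<lambda>i. (if i < N then c i else 0) + (if i < M then d i else 0)"]) (rule refl)
qed

lemma dirichlet_poly_sum: "(\<And>i. i \<in> I \<Longrightarrow> dirichlet_poly (P i)) \<Longrightarrow> dirichlet_poly (\<lambda>s. \<Sum>i\<in>I. P i s)"
  by (induction I rule: infinite_finite_induct) (auto intro: dirichlet_poly_zero dirichlet_poly_add)

lemma dirichlet_poly_mult:
  assumes "dirichlet_poly P" "dirichlet_poly Q"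
  shows "dirichlet_poly (\<lambda>s. P s * Q s)"
proof -
  obtain N c where P: "P = (\<lambda>s. \<Sum>i<N. c i * of_nat (Suc i) powr (- s))" using assms(1) by (auto simp: dirichlet_poly_def)
  obtain M d where Q: "Q = (\<lambda>s. \<Sum>i<M. d i * of_nat (Suc i) powr (- s))" using assms(2) by (auto simp: dirichlet_poly_def)
  \<comment> \<open>Coefficients are indexed from 0, and (i+1)(j+1) = (i + j + ij) + 1.\<close>
  have m: "c i * of_nat (Suc i) powr (- s) * (d j * of_nat (Suc j) powr (- s))
      = (c i * d j) * of_nat (Suc (i + j + i * j)) powr (- s)" for i j s
  proof -
    have "(of_nat (Suc (i + j + i * j)) :: complex) = of_real (real (Suc i)) * of_real (real (Suc j))"
      by (simp add: algebra_simps)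
    then have "(of_nat (Suc (i + j + i * j)) :: complex) powr (- s) = of_nat (Suc i) powr (- s) * of_nat (Suc j) powr (- s)"
      by (simp add: powr_times_real del: of_nat_Suc)
    then show ?thesis by simp
  qed
  show ?thesis unfolding P Q sum_product m
    by (intro dirichlet_poly_sum dirichlet_poly_monomial)
qed

lemma dirichlet_poly_diff:
  assumes "dirichlet_poly P" "dirichlet_poly Q"
  shows "dirichlet_poly (\<lambda>s. P s - Q s)"
  using dirichlet_poly_add[OF assms(1) dirichlet_poly_mult[OF dirichlet_poly_const[of "-1"] assms(2)]] by simp

lemma dirichlet_poly_power: "dirichlet_poly P \<Longrightarrow> dirichlet_poly (\<lambda>s. P s ^ n)"
  by (induction n) (auto intro: dirichlet_poly_const dirichlet_poly_mult)

lemma dirichlet_poly_shift: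
  assumes "dirichlet_poly P"
  shows "dirichlet_poly (\<lambda>s. P (s + w))"
proof -
  obtain N c where P: "P = (\<lambda>s. \<Sum>i<N. c i * of_nat (Suc i) powr (- s))" using assms by (auto simp: dirichlet_poly_def)
  have "c i * of_nat (Suc i) powr (- (s + w)) = (c i * of_nat (Suc i) powr (- w)) * of_nat (Suc i) powr (- s)" for i s
    by (simp add: powr_def exp_add[symmetric] algebra_simps del: of_nat_Suc)
  then show ?thesis unfolding P dirichlet_poly_def
    by (intro exI[of _ N] exI[of _ "\<lambda>i. c i * of_nat (Suc i) powr (- w)"]) (simp only:)
qed

lemma dirichlet_poly_deriv:
  assumes "dirichlet_poly P"
  shows "dirichlet_poly (deriv P)" "P holomorphic_on S"
proof -
  obtain N c where P: "P = (\<lambda>s. \<Sum>i<N. c i * of_nat (Suc i) powr (- s))" using assms by (auto simp: dirichlet_poly_def)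
  have d: "(P has_field_derivative (\<Sum>i<N. (- c i * Ln (of_nat (Suc i))) * of_nat (Suc i) powr (- s))) (at s within T)" for s T
    unfolding P by (rule DERIV_sum) (auto intro!: derivative_eq_intros simp: powr_def simp del: of_nat_Suc)
  show "dirichlet_poly (deriv P)"
    unfolding dirichlet_poly_def
    by (intro exI[of _ N] exI[of _ "\<lambda>i. - c i * Ln (of_nat (Suc i))"] ext DERIV_imp_deriv d)
  show "P holomorphic_on S" using d by (auto simp: holomorphic_on_def field_differentiable_def)
qed

lemma dirichlet_poly_higher_deriv:
  assumes "dirichlet_poly P"
  shows "dirichlet_poly ((deriv ^^ k) P)"
  using assms by (induction k) (auto intro: dirichlet_poly_deriv)

text \<open>A partial sum of the zeta series approximates \<zeta> uniformly for Re s \<ge> 2, and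
  its inverse is a geometric series in 1 minus the partial sum. Truncating this series again leaves
  a Dirichlet polynomial, and both errors are uniform.\<close>

lemma reciprocal_zeta_approx:
  assumes "\<eta> > 0"
  obtains P where "dirichlet_poly P" "\<And>s. Re s \<ge> 2 \<Longrightarrow> norm ((s - 1) / zeta_reg s - P s) \<le> \<eta>"
proof -
  define S where "S = (\<lambda>N s. \<Sum>n<N. of_nat (Suc n) powr (- s) :: complex)"
  define \<tau> where "\<tau> = (\<lambda>N. \<Sum>n. real (Suc (n + N)) powr (- 2))"
  have sm: "summable (\<lambda>n. real (Suc n) powr (- 2))" by (rule summable_Suc_powr) simp
  have tail: "norm (zeta_reg s / (s - 1) - S N s) \<le> \<tau> N" if s: "Re s \<ge> 2" for s N
  proof -
    have s1: "Re s > 1" using s by simp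
    have z: "(\<lambda>n. of_nat (Suc n) powr (- s)) sums (zeta_reg s / (s - 1))"
      using zeta_sums(1)[OF s1] by (subst sums_Suc_iff) simp
    then have "zeta_reg s / (s - 1) - S N s = (\<Sum>n. of_nat (Suc (n + N)) powr (- s))"
      unfolding S_def using suminf_minus_initial_segment[OF sums_summable[OF z], of N] sums_unique[OF z] by simp
    also have "norm \<dots> \<le> \<tau> N"
      unfolding \<tau>_def
    proof (rule norm_suminf_le)
      show "summable (\<lambda>n. real (Suc (n + N)) powr (- 2))" using summable_ignore_initial_segment[OF sm, of N] .
      show "norm (of_nat (Suc (n + N)) powr (- s) :: complex) \<le> real (Suc (n + N)) powr (- 2)" for n
        unfolding norm_of_nat_powr using s by (intro powr_mono) auto
    qed
    finally show ?thesis .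
  qed
  have "\<tau> \<longlonglongrightarrow> 0" unfolding \<tau>_def by (rule suminf_exist_split2[OF sm])
  \<comment> \<open>1/8 gives |1 - S'| \<le> 3/4 + 1/8 and |S'| \<ge> 1/8. Then |1/z - 1/S'| \<le>
    32 |z - S'|, so \<eta>/64 leaves an error of \<eta>/2.\<close>
  then have "eventually (\<lambda>N. \<tau> N < min (1 / 8) (\<eta> / 64)) sequentially"
    using assms by (intro order_tendstoD(2)) auto
  then obtain N where "\<tau> N < min (1 / 8) (\<eta> / 64)" using eventually_happens by fastforce
  then have N: "\<tau> N \<le> 1 / 8" "\<tau> N \<le> \<eta> / 64" by auto
  have lim: "(\<lambda>m. 8 * (7 / 8 :: real) ^ m) \<longlonglongrightarrow> 8 * 0" by (intro tendsto_intros LIMSEQ_power_zero) auto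
  have "eventually (\<lambda>m. 8 * (7 / 8 :: real) ^ m < \<eta> / 2) sequentially"
    by (rule order_tendstoD(2)[OF lim]) (use assms in simp)
  then obtain m where m: "8 * (7 / 8 :: real) ^ m < \<eta> / 2" by (auto simp: eventually_sequentially)
  define P where "P = (\<lambda>s. \<Sum>k<m. (1 - S N s) ^ k)"
  have dS: "dirichlet_poly (S N)"
    unfolding S_def dirichlet_poly_def by (intro exI[of _ N] exI[of _ "\<lambda>_. 1"]) simp
  have "dirichlet_poly P"
    unfolding P_def by (intro dirichlet_poly_sum dirichlet_poly_power dirichlet_poly_diff dirichlet_poly_const dS)
  moreover have "norm ((s - 1) / zeta_reg s - P s) \<le> \<eta>" if s: "Re s \<ge> 2" for s
  proof -
    define z where "z = zeta_reg s / (s - 1)"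
    define S' where "S' = S N s"
    have z: "norm (z - 1) \<le> 3 / 4" unfolding z_def by (rule zeta_near_one[OF s])
    have zS: "norm (z - S') \<le> \<tau> N" unfolding z_def S'_def by (rule tail[OF s])
    have z4: "norm z \<ge> 1 / 4" using norm_triangle_ineq2[of 1 "1 - z"] z by (simp add: norm_minus_commute)
    have S1: "norm (1 - S') \<le> 7 / 8" using norm_triangle_ineq[of "1 - z" "z - S'"] z zS N by (simp add: norm_minus_commute)
    have S8: "norm S' \<ge> 1 / 8" using norm_triangle_ineq2[of 1 "1 - S'"] S1 by simp
    have nz: "z \<noteq> 0" "S' \<noteq> 0" using z4 S8 by auto
    have geo: "1 / S' - P s = (1 - S') ^ m / S'"
      unfolding P_def S'_def[symmetric] using sum_gp_strict[of "1 - S'" m] nz by (auto simp: diff_divide_distrib)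
    have "norm (1 / z - 1 / S') = norm (z - S') / (norm z * norm S')"
      using nz by (simp add: diff_frac_eq norm_divide norm_mult norm_minus_commute)
    also have "\<dots> \<le> \<tau> N / (1 / 4 * (1 / 8))"
      using zS z4 S8 order_trans[OF norm_ge_zero zS] by (intro frac_le mult_mono) auto
    finally have 1: "norm (1 / z - 1 / S') \<le> \<eta> / 2" using N by simp
    have "norm (1 / S' - P s) = norm (1 - S') ^ m / norm S'" unfolding geo by (simp add: norm_divide norm_power)
    also have "\<dots> \<le> (7 / 8) ^ m / (1 / 8)" using S1 S8 by (intro frac_le power_mono) auto
    finally have 2: "norm (1 / S' - P s) \<le> \<eta> / 2" using m by simp
    have "(s - 1) / zeta_reg s - P s = (1 / z - 1 / S') + (1 / S' - P s)" by (simp add: z_def)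
    then show ?thesis using norm_triangle_mono[OF 1 2] by simp
  qed
  ultimately show ?thesis using that by blast
qed

text \<open>The Taylor expansion around the point $s + 3$, where $1/\zeta$ is a uniform limit of Dirichlet
  polynomials, reaches $s+\varepsilon$ without crossing the critical line.\<close>

theorem reciprocal_zeta_shift_approx:
  assumes RH: "\<And>s. Re s > 1 / 2 \<Longrightarrow> zeta_reg s \<noteq> 0" and e: "0 < \<epsilon>" "\<epsilon> \<le> 1 / 2" and k: "\<kappa> > 0"
  obtains P where "dirichlet_poly P"
    "\<And>s. Re s = 1 / 2 \<Longrightarrow> norm ((s + of_real \<epsilon> - 1) / zeta_reg (s + of_real \<epsilon>) - P s) \<le> \<kappa> * norm s powr (1 / 4)"
proof -
  define D where "D = (\<lambda>s. (s - 1) / zeta_reg s)"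
  obtain C where C: "C > 0" "\<And>s. Re s \<ge> 1 / 2 + \<epsilon> / 2 \<Longrightarrow> norm (D s) \<le> C * norm s powr (1 / 4)"
    unfolding D_def using reciprocal_zeta_bound[OF RH, of "\<epsilon> / 2"] e by auto
  \<comment> \<open>Around s + 3 this radius exceeds the distance 3 - \<epsilon> to s + \<epsilon>,
    yet stays where Re \<ge> 1/2 + \<epsilon>/2, so Littlewood's bound holds with one
    constant.\<close>
  define \<rho> where "\<rho> = 3 - \<epsilon> / 2"
  define q where "q = (3 - \<epsilon>) / \<rho>"
  have r: "\<rho> > 0" "\<rho> < 3" and q: "0 < q" "q < 1" using e by (auto simp: \<rho>_def q_def)
  \<comment> \<open>On the circle |x| \<le> |s| + 6 \<le> 13 |s|, as |s| \<ge> 1/2.\<close>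
  define C' where "C' = C * 13 powr (1 / 4)"
  have C': "C' > 0" using C by (simp add: C'_def)
  have "(\<lambda>n. C' * q ^ n / (1 - q)) \<longlonglongrightarrow> C' * 0 / (1 - q)"
    using q by (intro tendsto_intros LIMSEQ_power_zero) auto
  then have "eventually (\<lambda>n. C' * q ^ n / (1 - q) < \<kappa> / 2) sequentially"
    using k by (intro order_tendstoD(2)) auto
  then obtain K where K: "C' * q ^ K / (1 - q) < \<kappa> / 2" using eventually_happens by fastforce
  \<comment> \<open>\<open>K\<close> is fixed first, by the Taylor tail. Each of the
    \<open>K\<close> coefficients then carries an error of at most \<eta> against a power of |y| <
    3, in total at most \<kappa>/4, which is below (\<kappa>/2)|s|^(1/4).\<close>
  define \<eta> where "\<eta> = \<kappa> / 4 / (1 + (\<Sum>k<K. 3 ^ k))"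
  have sp: "(\<Sum>k<K. 3 ^ k :: real) \<ge> 0" by (intro sum_nonneg) auto
  have \<eta>: "\<eta> > 0" "\<eta> * (\<Sum>k<K. 3 ^ k) \<le> \<kappa> / 4"
    using k sp by (auto simp: \<eta>_def divide_simps add_pos_nonneg)
  obtain Q where Q: "dirichlet_poly Q" "\<And>s. Re s \<ge> 2 \<Longrightarrow> norm (D s - Q s) \<le> \<eta>"
    unfolding D_def using reciprocal_zeta_approx[OF \<eta>(1)] by metis
  define P where "P = (\<lambda>s. \<Sum>k<K. (deriv ^^ k) Q (s + 3) * (of_real ((\<epsilon> - 3) ^ k) / fact k))"
  have dP: "dirichlet_poly P"
    unfolding P_def
    by (intro dirichlet_poly_sum dirichlet_poly_mult dirichlet_poly_const dirichlet_poly_shift dirichlet_poly_higher_deriv Q)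
  have holD: "D holomorphic_on {s. Re s > 1/2}"
    unfolding D_def using RH by (intro holomorphic_intros holomorphic_on_subset[OF holomorphic_zeta_reg]) auto
  have main: "norm (D (s + of_real \<epsilon>) - P s) \<le> \<kappa> * norm s powr (1 / 4)" if s: "Re s = 1 / 2" for s
  proof -
    have ns: "norm s \<ge> 1 / 2" using abs_Re_le_cmod[of s] s by simp
    have ns4: "norm s powr (1 / 4) \<ge> 1 / 2"
    proof -
      have "(1/2 :: real) powr 1 \<le> (1/2) powr (1/4)" by (rule powr_mono') auto
      also have "\<dots> \<le> norm s powr (1/4)" using ns by (intro powr_mono2) auto
      finally show ?thesis by simp
    qed
    have re: "Re z \<ge> 7 / 2 - d" if "norm (s + 3 - z) \<le> d" for z d
      using abs_Re_le_cmod[of "s + 3 - z"] that s by simp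
    have sub: "ball (s + 3) 3 \<subseteq> {s. Re s > 1/2}"
    proof
      fix z assume "z \<in> ball (s + 3) 3"
      then have "norm (s + 3 - z) < 3" by (simp add: dist_norm)
      then show "z \<in> {s. Re s > 1/2}" using abs_Re_le_cmod[of "s + 3 - z"] s by simp
    qed
    define a where "a = (\<lambda>k. (deriv ^^ k) D (s + 3) / fact k)"
    define y where "y = s + of_real \<epsilon> - (s + 3)"
    have y: "y = of_real (\<epsilon> - 3)" by (simp add: y_def)
    have ny: "norm y = 3 - \<epsilon>" unfolding y norm_of_real using e by simp
    have ps: "(\<lambda>k. a k * y ^ k) sums D (s + of_real \<epsilon>)"
      unfolding a_def y_def
      by (rule holomorphic_power_series[OF holomorphic_on_subset[OF holD sub]])
         (use ny e in \<open>simp add: y_def dist_norm norm_minus_commute\<close>)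
    have ab: "norm (a k) \<le> C' * norm s powr (1/4) / \<rho> ^ k" for k
    proof -
      have cs: "cball (s + 3) \<rho> \<subseteq> ball (s + 3) 3" using r by auto
      have "norm ((deriv ^^ k) D (s + 3)) \<le> fact k * (C' * norm s powr (1/4)) / \<rho> ^ k"
      proof (rule Cauchy_inequality)
        have hr: "D holomorphic_on cball (s + 3) \<rho>"
          by (rule holomorphic_on_subset[OF holD]) (use cs sub in blast)
        show "D holomorphic_on ball (s + 3) \<rho>"
          by (rule holomorphic_on_subset[OF hr ball_subset_cball])
        show "continuous_on (cball (s + 3) \<rho>) D"
          by (rule holomorphic_on_imp_continuous_on[OF hr])
        show "0 < \<rho>" by (rule r)
        fix x assume x: "norm (s + 3 - x) = \<rho>"
        have "Re x \<ge> 1 / 2 + \<epsilon> / 2" using re[of x \<rho>] x by (simp add: \<rho>_def)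
        then have "norm (D x) \<le> C * norm x powr (1/4)" by (rule C)
        also have "norm x \<le> 13 * norm s"
          using norm_triangle_ineq4[of "s + 3" "s + 3 - x"] norm_triangle_ineq[of s 3] x r ns by simp
        then have "C * norm x powr (1/4) \<le> C * (13 * norm s) powr (1/4)"
          using C by (intro mult_left_mono powr_mono2) auto
        also have "\<dots> = C' * norm s powr (1/4)" by (simp add: C'_def powr_mult)
        finally show "norm (D x) \<le> C' * norm s powr (1/4)" .
      qed
      then show ?thesis by (simp add: a_def norm_divide field_simps)
    qed
    have t2: "norm (a k * y ^ k) \<le> (C' * norm s powr (1/4)) * q ^ k" for k
    proof -
      have "norm (a k * y ^ k) \<le> (C' * norm s powr (1/4) / \<rho> ^ k) * (3 - \<epsilon>) ^ k"
        unfolding norm_mult norm_power ny using ab[of k] e by (intro mult_right_mono) auto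
      then show ?thesis by (simp add: power_divide q_def)
    qed
    have split: "D (s + of_real \<epsilon>) = (\<Sum>k. a (k + K) * y ^ (k + K)) + (\<Sum>k<K. a k * y ^ k)"
      using suminf_split_initial_segment[OF sums_summable[OF ps], of K] sums_unique[OF ps] by simp
    have "norm (\<Sum>k. a (k + K) * y ^ (k + K)) \<le> (\<Sum>k. (C' * norm s powr (1/4)) * q ^ (k + K))"
      by (rule norm_suminf_le[OF t2]) (use q in \<open>auto intro!: summable_mult summable_ignore_initial_segment summable_geometric\<close>)
    also have "\<dots> = (\<Sum>k. (C' * norm s powr (1/4) * q ^ K) * q ^ k)" by (simp add: power_add mult_ac)
    also have "\<dots> = (C' * norm s powr (1/4) * q ^ K) * (1 / (1 - q))"
      using q by (subst suminf_mult) (auto simp: suminf_geometric intro!: summable_geometric)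
    also have "\<dots> = (C' * q ^ K / (1 - q)) * norm s powr (1/4)" by simp
    also have "\<dots> \<le> \<kappa> / 2 * norm s powr (1/4)" using K by (intro mult_right_mono) auto
    finally have b1: "norm (\<Sum>k. a (k + K) * y ^ (k + K)) \<le> \<kappa> / 2 * norm s powr (1/4)" .
    \<comment> \<open>Cauchy's inequality on the unit circle around s + 3, where Re \<ge> 5/2 and
      \<open>Q\<close> is within \<eta> of \<open>D\<close>; dividing by \<open>fact k\<close>
      leaves \<eta> for every k.\<close>
    have dd: "norm (a k - (deriv ^^ k) Q (s + 3) / fact k) \<le> \<eta>" for k
    proof -
      have holDQ: "D holomorphic_on ball (s + 3) 3" "Q holomorphic_on ball (s + 3) 3"
        using holD sub dirichlet_poly_deriv(2)[OF Q(1)] by (auto intro: holomorphic_on_subset)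
      have sub1: "cball (s + 3) 1 \<subseteq> ball (s + 3) 3" by auto
      have "norm ((deriv ^^ k) (\<lambda>z. D z - Q z) (s + 3)) \<le> fact k * \<eta> / 1 ^ k"
      proof (rule Cauchy_inequality)
        have hr: "(\<lambda>z. D z - Q z) holomorphic_on cball (s + 3) 1"
          by (rule holomorphic_on_subset[OF holomorphic_on_diff[OF holDQ] sub1])
        show "(\<lambda>z. D z - Q z) holomorphic_on ball (s + 3) 1"
          by (rule holomorphic_on_subset[OF hr ball_subset_cball])
        show "continuous_on (cball (s + 3) 1) (\<lambda>z. D z - Q z)"
          by (rule holomorphic_on_imp_continuous_on[OF hr])
        show "norm (D x - Q x) \<le> \<eta>" if "norm (s + 3 - x) = 1" for x
          using re[of x 1] that by (intro Q) simp
      qed simp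
      also have "(deriv ^^ k) (\<lambda>z. D z - Q z) (s + 3) = (deriv ^^ k) D (s + 3) - (deriv ^^ k) Q (s + 3)"
        by (rule higher_deriv_diff[OF holDQ]) auto
      finally show ?thesis by (simp add: a_def diff_divide_distrib[symmetric] norm_divide pos_divide_le_eq mult.commute)
    qed
    have "(\<Sum>k<K. a k * y ^ k) - P s = (\<Sum>k<K. (a k - (deriv ^^ k) Q (s + 3) / fact k) * y ^ k)"
      unfolding P_def y by (simp add: sum_subtractf[symmetric] left_diff_distrib)
    also have "norm \<dots> \<le> (\<Sum>k<K. \<eta> * 3 ^ k)"
      unfolding norm_power norm_mult using dd e \<eta>(1) ny
      by (intro sum_norm_le) (auto simp: norm_mult norm_power intro!: mult_mono power_mono)
    also have "\<dots> \<le> \<kappa> / 4" using \<eta>(2) by (simp add: sum_distrib_left)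
    also have "\<dots> \<le> \<kappa> / 2 * norm s powr (1/4)" using mult_left_mono[OF ns4, of "\<kappa> / 2"] k by simp
    finally have b2: "norm ((\<Sum>k<K. a k * y ^ k) - P s) \<le> \<kappa> / 2 * norm s powr (1/4)" .
    have "D (s + of_real \<epsilon>) - P s = (\<Sum>k. a (k + K) * y ^ (k + K)) + ((\<Sum>k<K. a k * y ^ k) - P s)"
      unfolding split by simp
    then show ?thesis using norm_triangle_mono[OF b1 b2] by (simp add: add_diff_eq)
  qed
  show ?thesis using that[OF dP] main by (simp add: D_def)
qed

section \<open>Compactly supported kernels\<close>

lemma integrable_shift:
  fixes f :: "real \<Rightarrow> complex"
  shows "integrable lborel f \<Longrightarrow> integrable lborel (\<lambda>u. f (u + c))"
    and "(\<integral>u. f (u + c) \<partial>lborel) = (\<integral>u. f u \<partial>lborel)"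
  using lborel_integrable_real_affine[of f 1 c] lborel_integral_real_affine[of 1 f c] by (simp_all add: add.commute)

lemma integrable_exp_Iic:
  fixes a c :: real
  assumes "a > 0"
  shows "integrable lborel (\<lambda>u. indicator {..c} u * exp (a * u))"
proof -
  have "integrable lborel (\<lambda>u. indicator {..c} u *\<^sub>R exp (complex_of_real a * of_real u))"
    using integral_exp_Iic[of "of_real a" c] assms by (simp add: has_bochner_integral_iff)
  from integrable_norm[OF this] show ?thesis by simp
qed

text \<open>The isometry from the positive axis to the line: g corresponds to exp(u/2) g(exp u),
  whose Fourier transform is the Mellin transform on Re s = 1/2.\<close>

lemma set_nn_integral_exp_substitution:
  fixes g :: "real \<Rightarrow> complex"
  assumes m: "set_borel_measurable lborel {0<..} g"
    and i: "integrable lborel (\<lambda>u. (norm (exp (of_real u / 2) * g (exp u)))\<^sup>2)"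
  shows "set_nn_integral lborel {0<..} (\<lambda>x. ennreal ((norm (g x))\<^sup>2))
     = ennreal (\<integral>u. (norm (exp (of_real u / 2) * g (exp u)))\<^sup>2 \<partial>lborel)"
proof -
  let ?q = "\<lambda>u. (norm (exp (of_real u / 2) * g (exp u)))\<^sup>2"
  let ?G = "\<lambda>x. complex_of_real ((norm (g x))\<^sup>2)"
  have "(\<lambda>x. indicator {0<..} x *\<^sub>R g x) \<in> borel_measurable borel"
    using m by (simp add: set_borel_measurable_def)
  then have "(\<lambda>x. complex_of_real ((norm (indicator {0<..} x *\<^sub>R g x))\<^sup>2)) \<in> borel_measurable borel"
    by measurable
  also have "(\<lambda>x. complex_of_real ((norm (indicator {0<..} x *\<^sub>R g x))\<^sup>2)) = (\<lambda>x. indicator {0<..} x *\<^sub>R ?G x)"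
    by (auto simp: indicator_def)
  finally have mG: "set_borel_measurable lborel {0<..} ?G"
    by (simp add: set_borel_measurable_def)
  have eq: "exp u *\<^sub>R ?G (exp u) = of_real (?q u)" for u
  proof -
    have "(exp (u / 2))\<^sup>2 = exp u" by (simp add: exp_double[symmetric])
    then show ?thesis by (simp add: norm_mult power_mult_distrib scaleR_conv_of_real flip: of_real_power)
  qed
  have "set_integrable lborel {0<..} ?G"
    unfolding exp_substitution(1)[OF mG] eq complex_of_real_integrable_eq by (rule i)
  then have "integrable lborel (\<lambda>x. complex_of_real (indicator {0<..} x * (norm (g x))\<^sup>2))"
    by (simp add: set_integrable_def scaleR_conv_of_real)
  then have iR: "integrable lborel (\<lambda>x. indicator {0<..} x * (norm (g x))\<^sup>2)"
    by (simp only: complex_of_real_integrable_eq)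
  have "complex_of_real (\<integral>x. indicator {0<..} x * (norm (g x))\<^sup>2 \<partial>lborel) = set_lebesgue_integral lborel {0<..} ?G"
    unfolding set_lebesgue_integral_def scaleR_conv_of_real of_real_mult[symmetric] integral_complex_of_real ..
  also have "\<dots> = complex_of_real (\<integral>u. ?q u \<partial>lborel)"
    unfolding exp_substitution(2)[OF mG] eq integral_complex_of_real ..
  finally have v: "(\<integral>x. indicator {0<..} x * (norm (g x))\<^sup>2 \<partial>lborel) = (\<integral>u. ?q u \<partial>lborel)"
    by (simp only: of_real_eq_iff)
  have "set_nn_integral lborel {0<..} (\<lambda>x. ennreal ((norm (g x))\<^sup>2))
     = (\<integral>\<^sup>+ x. ennreal (indicator {0<..} x * (norm (g x))\<^sup>2) \<partial>lborel)"
    by (intro nn_integral_cong) (auto simp: indicator_def)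
  also have "\<dots> = ennreal (\<integral>x. indicator {0<..} x * (norm (g x))\<^sup>2 \<partial>lborel)"
    by (rule nn_integral_eq_integral[OF iR]) auto
  finally show ?thesis unfolding v .
qed

locale compact_kernel =
  fixes f f' :: "real \<Rightarrow> complex" and R :: real
  assumes deriv: "\<forall>x\<ge>0. (f has_vector_derivative f' x) (at x within {0..})"
    and contf': "continuous_on {0..} f'"
    and tends: "(f \<longlongrightarrow> 0) at_top"
    and fin: "set_nn_integral lborel {0<..} (\<lambda>t. ennreal (t * norm (f' t))) < \<infinity>"
    and R: "R \<ge> 1" and supp: "\<And>x. x \<ge> R \<Longrightarrow> f x = 0"
begin

lemmas kernel = deriv contf' tends fin

lemma continuous_f: "continuous_on {0..} f"
  using deriv by (auto simp: continuous_on_eq_continuous_within intro: has_vector_derivative_continuous)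

lemma deriv_support: "x > R \<Longrightarrow> f' x = 0"
proof -
  assume x: "x > R"
  have "(f has_vector_derivative f' x) (at x within {0..})" using x R by (intro deriv[rule_format]) simp
  moreover have "at x within {0..} = at x" using x R by (intro at_within_interior) auto
  ultimately have 1: "(f has_vector_derivative f' x) (at x)" by simp
  have "((\<lambda>_. 0) has_vector_derivative 0) (at x)" by simp
  then have "(f has_vector_derivative 0) (at x)"
    by (rule has_vector_derivative_transform_within_open[of _ _ _ "{R<..}"]) (use x supp in auto)
  with 1 show "f' x = 0" by (rule vector_derivative_unique_at)
qed

lemma muentz_tail:
  assumes "x \<ge> R"
  shows "muentz f x = - (set_lebesgue_integral lborel {0<..} f) / of_real x"
proof -
  have "f (real (Suc n) * x) = 0" for n
    using mult_mono[of 1 "real (Suc n)" R x] assms R by (intro supp) simp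
  then show ?thesis by (simp add: muentz_def)
qed

lemma continuous_muentz: "continuous_on {0<..} (muentz f)"
proof -
  have "isCont (muentz f) x" if x: "x > 0" for x
  proof -
    \<comment> \<open>Terms with index at least \<open>M\<close> vanish for all arguments above x/2,
      so the series is a fixed finite sum near x.\<close>
    define M where "M = nat \<lceil>2 * R / x\<rceil>"
    have M: "real M * (x / 2) \<ge> R"
    proof -
      have "2 * R / x \<le> real M" unfolding M_def by (rule real_nat_ceiling_ge)
      then show ?thesis using x by (simp add: field_simps)
    qed
    let ?g = "\<lambda>y. (\<Sum>n<M. f (real (Suc n) * y)) - complex_of_real (1 / y) * set_lebesgue_integral lborel {0<..} f"
    have eq: "muentz f y = ?g y" if y: "y \<in> {x/2<..}" for y
    proof -
      have "f (real (Suc n) * y) = 0" if "n \<ge> M" for n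
      proof (rule supp)
        have "real M * (x / 2) \<le> real (Suc n) * y" using that x y by (intro mult_mono) auto
        with M show "R \<le> real (Suc n) * y" by linarith
      qed
      then have "(\<Sum>n. f (real (Suc n) * y)) = (\<Sum>n<M. f (real (Suc n) * y))"
        by (intro suminf_finite) auto
      then show ?thesis by (simp add: muentz_def)
    qed
    have "continuous_on {x/2<..} ?g"
      by (intro continuous_intros continuous_on_compose2[OF continuous_f]) (use x in \<open>auto intro!: mult_nonneg_nonneg\<close>)
    then have "continuous_on {x/2<..} (muentz f)" using eq by (subst continuous_on_cong[OF refl]) auto
    then show ?thesis using x by (simp add: continuous_on_eq_continuous_at)
  qed
  then show ?thesis by (simp add: continuous_at_imp_continuous_on)
qed

text \<open>A fractional part is at most 1, so \<open>muentz_exp\<close> bounds the transform by the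
  integral of |f'|, also near 0, where the number of nonzero terms of the series may grow without
  bound.\<close>

lemma muentz_bounded:
  obtains B where "\<And>x. x > 0 \<Longrightarrow> norm (muentz f x) \<le> B"
proof -
  have i: "integrable lborel (\<lambda>v. exp (of_real v) * f' (exp v))"
    using integrable_deriv_exp[OF kernel, of 0] by simp
  have [measurable]: "(\<lambda>v. f' (exp v)) \<in> borel_measurable borel" by (rule kernel_measurable(3)[OF kernel])
  have "norm (muentz f x) \<le> (\<integral>v. norm (exp (of_real v) * f' (exp v)) \<partial>lborel)" if x: "x > 0" for x
  proof -
    define u where "u = ln x"
    have xu: "x = exp u" using x by (simp add: u_def)
    have b: "norm (of_real (frac (exp (v - u))) * (exp (of_real v) * f' (exp v))) \<le> norm (exp (of_real v) * f' (exp v))" for v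
    proof -
      have "norm (complex_of_real (frac (exp (v - u)))) \<le> 1" using frac_lt_1[of "exp (v - u)"] by simp
      from mult_right_mono[OF this norm_ge_zero] show ?thesis by (simp add: norm_mult)
    qed
    have "norm (muentz f (exp u)) \<le> (\<integral>v. norm (of_real (frac (exp (v - u))) * (exp (of_real v) * f' (exp v))) \<partial>lborel)"
      by (subst muentz_exp[OF kernel]) (rule Bochner_Integration.integral_norm_bound)
    also have "\<dots> \<le> (\<integral>v. norm (exp (of_real v) * f' (exp v)) \<partial>lborel)"
      by (rule integral_mono[OF _ integrable_norm[OF i] b], rule integrable_norm,
          rule Bochner_Integration.integrable_bound[OF i]) (use b in \<open>auto simp: frac_def\<close>)
    finally show ?thesis by (simp add: xu)
  qed
  then show ?thesis using that by blast
qed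

section \<open>Approximation errors and their transforms\<close>

definition remainder :: "nat \<Rightarrow> (nat \<Rightarrow> complex) \<Rightarrow> real \<Rightarrow> complex" where
  "remainder N c x = f x - (\<Sum>i<N. c i * muentz f (real (Suc i) * x))"

lemma remainder_continuous: "continuous_on {0<..} (remainder N c)"
  unfolding remainder_def
  by (intro continuous_intros continuous_on_compose2[OF continuous_muentz] continuous_on_subset[OF continuous_f])
     (auto intro!: mult_pos_pos simp del: of_nat_Suc)

lemma remainder_measurable: "set_borel_measurable lborel {0<..} (remainder N c)"
  unfolding set_borel_measurable_def
  using remainder_continuous by (auto intro!: borel_measurable_continuous_on_indicator)

lemma remainder_tail:
  assumes "x \<ge> R"
  shows "remainder N c x = ((\<Sum>i<N. c i / of_nat (Suc i)) * set_lebesgue_integral lborel {0<..} f) / of_real x"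
proof -
  have "muentz f (real (Suc i) * x) = - (1 / of_nat (Suc i) * set_lebesgue_integral lborel {0<..} f / of_real x)" for i
    using mult_mono[of 1 "real (Suc i)" R x] assms R by (subst muentz_tail) (simp_all add: field_simps)
  then show ?thesis using supp[OF assms]
    by (simp add: remainder_def sum_negf sum_distrib_right sum_divide_distrib del: of_nat_Suc)
qed

text \<open>A dilation by n is a translation by ln n in the variable u and multiplies the transform
  by n^(-s), so the coefficients of the combination become those of a Dirichlet polynomial.\<close>

lemma remainder_mellin:
  assumes s: "0 < Re s" "Re s < 1"
  shows "integrable lborel (\<lambda>u. exp (s * of_real u) * remainder N c (exp u))"
    and "(\<integral>u. exp (s * of_real u) * remainder N c (exp u) \<partial>lborel)
       = mellin f s * (1 - zeta_reg s / (s - 1) * (\<Sum>i<N. c i * of_nat (Suc i) powr (- s)))"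
proof -
  let ?m = "\<lambda>u. exp (s * of_real u) * muentz f (exp u)"
  note M = muentz_mellin_kernel[OF kernel s]
  have F: "integrable lborel (\<lambda>u. exp (s * of_real u) * f (exp u))"
    using mellin_kernel(1)[OF kernel, of s] s by simp
  have Fv: "(\<integral>u. exp (s * of_real u) * f (exp u) \<partial>lborel) = mellin f s"
    by (rule mellin_exp(2)[OF kernel_measurable(1)[OF kernel], symmetric])
  have sh: "exp (s * of_real u) * (c i * muentz f (real (Suc i) * exp u))
      = (c i * of_nat (Suc i) powr (- s)) * ?m (u + ln (real (Suc i)))" for i u
  proof -
    have "of_nat (Suc i) powr (- s) = exp (- s * of_real (ln (real (Suc i))))"
      using exp_ln_powr[of "real (Suc i)" "- s"] by simp
    then have "of_nat (Suc i) powr (- s) * exp (s * of_real (u + ln (real (Suc i)))) = exp (s * of_real u)"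
      by (simp add: exp_add[symmetric] algebra_simps del: of_nat_Suc)
    moreover have "exp (u + ln (real (Suc i))) = real (Suc i) * exp u"
      by (simp add: exp_add del: of_nat_Suc)
    ultimately show ?thesis by (simp only: mult_ac)
  qed
  have eq: "exp (s * of_real u) * remainder N c (exp u)
      = exp (s * of_real u) * f (exp u) - (\<Sum>i<N. (c i * of_nat (Suc i) powr (- s)) * ?m (u + ln (real (Suc i))))" for u
    unfolding remainder_def right_diff_distrib sum_distrib_left sh ..
  have I: "integrable lborel (\<lambda>u. (c i * of_nat (Suc i) powr (- s)) * ?m (u + ln (real (Suc i))))" for i
    by (intro Bochner_Integration.integrable_mult_right integrable_shift(1)[of ?m, OF M(1)])
  show "integrable lborel (\<lambda>u. exp (s * of_real u) * remainder N c (exp u))"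
    unfolding eq by (intro Bochner_Integration.integrable_diff Bochner_Integration.integrable_sum F I)
  have "(\<integral>u. exp (s * of_real u) * remainder N c (exp u) \<partial>lborel)
      = mellin f s - (\<Sum>i<N. (c i * of_nat (Suc i) powr (- s)) * (zeta_reg s / (s - 1) * mellin f s))"
    unfolding eq
    by (subst Bochner_Integration.integral_diff[OF F Bochner_Integration.integrable_sum[OF I]],
        subst Bochner_Integration.integral_sum[OF I])
       (simp only: integral_mult_right_zero integrable_shift(2)[of ?m] M(2) Fv)
  also have "\<dots> = mellin f s * (1 - zeta_reg s / (s - 1) * (\<Sum>i<N. c i * of_nat (Suc i) powr (- s)))"
    by (simp only: sum_distrib_right[symmetric] right_diff_distrib mult_1_right) (simp only: mult_ac)
  finally show "(\<integral>u. exp (s * of_real u) * remainder N c (exp u) \<partial>lborel)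
       = mellin f s * (1 - zeta_reg s / (s - 1) * (\<Sum>i<N. c i * of_nat (Suc i) powr (- s)))" .
qed

definition critical_point :: "real \<Rightarrow> complex" where
  "critical_point t = 1 / 2 + \<i> * of_real t"

lemma exp_critical_point: "exp (critical_point t * of_real u) = exp (of_real u / 2) * iexp (t * u)"
  by (simp add: critical_point_def exp_add[symmetric] algebra_simps)

text \<open>The boundedness needed for Plancherel: up to R all ingredients are bounded, and beyond R
  the error is a multiple of 1/x, which is not destroyed by the factor x^(1/2).\<close>

lemma remainder_bounded:
  obtains B where "\<And>u. norm (exp (of_real u / 2) * remainder N c (exp u)) \<le> B"
proof -
  let ?r = "remainder N c"
  let ?G = "\<lambda>u. exp (of_real u / 2) * ?r (exp u)"
  obtain B1 where B1: "\<And>x. x > 0 \<Longrightarrow> norm (muentz f x) \<le> B1" using muentz_bounded by blast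
  have "compact (f ` {0..R})"
    using continuous_f by (intro compact_continuous_image) (auto elim: continuous_on_subset)
  then obtain B2 where B2: "\<forall>y\<in>f ` {0..R}. norm y \<le> B2" using compact_imp_bounded bounded_iff by blast
  define B3 where "B3 = B2 + (\<Sum>i<N. norm (c i) * B1)"
  define K where "K = norm ((\<Sum>i<N. c i / of_nat (Suc i)) * set_lebesgue_integral lborel {0<..} f)"
  have "norm (?G u) \<le> max (sqrt R * B3) K" for u
  proof (cases "exp u \<le> R")
    case True
    have "norm (?r (exp u)) \<le> norm (f (exp u)) + norm (\<Sum>i<N. c i * muentz f (real (Suc i) * exp u))"
      unfolding remainder_def by (rule norm_triangle_ineq4)
    also have "norm (\<Sum>i<N. c i * muentz f (real (Suc i) * exp u)) \<le> (\<Sum>i<N. norm (c i) * B1)"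
      by (rule sum_norm_le) (auto simp: norm_mult simp del: of_nat_Suc intro!: mult_left_mono B1 mult_pos_pos)
    also have "norm (f (exp u)) \<le> B2" using B2 True by auto
    finally have r: "norm (?r (exp u)) \<le> B3" by (simp add: B3_def)
    have "exp (u / 2) = sqrt (exp u)" by (rule real_sqrt_unique[symmetric]) (simp_all add: exp_double[symmetric])
    then have "exp (u / 2) \<le> sqrt R" using True by simp
    then have "norm (?G u) \<le> sqrt R * B3"
      using r order_trans[OF norm_ge_zero r] R by (simp add: norm_mult mult_mono)
    then show ?thesis by simp
  next
    case False
    have "norm (?G u) = exp (u / 2) * (K / exp u)"
      using False by (subst remainder_tail) (auto simp: K_def norm_mult norm_divide)
    also have "\<dots> = K * (exp (u / 2) / exp u)" by simp
    also have "exp (u / 2) / exp u = exp (- (u / 2))" by (simp add: exp_diff[symmetric])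
    also have "K * exp (- (u / 2)) \<le> K * 1"
    proof (intro mult_left_mono)
      have "1 < exp u" using False R by linarith
      then have "0 < u" by simp
      then show "exp (- (u / 2)) \<le> 1" by simp
    qed (simp add: K_def)
    finally show ?thesis by simp
  qed
  then show ?thesis using that by blast
qed

lemma remainder_L2:
  defines "J \<equiv> \<lambda>N c u. (norm (exp (of_real u / 2) * remainder N c (exp u)))\<^sup>2"
  shows "integrable lborel (J N c)"
    and "set_nn_integral lborel {0<..} (\<lambda>x. ennreal ((norm (remainder N c x))\<^sup>2)) = ennreal (\<integral>u. J N c u \<partial>lborel)"
proof -
  let ?G = "\<lambda>u. exp (of_real u / 2) * remainder N c (exp u)"
  have G: "integrable lborel ?G"
    using remainder_mellin(1)[of "1 / 2" N c] by simp
  obtain B where B: "\<And>u. norm (?G u) \<le> B" using remainder_bounded[of N c] by blast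
  have i: "integrable lborel (\<lambda>u. (norm (?G u))\<^sup>2)"
  proof (rule Bochner_Integration.integrable_bound)
    show "integrable lborel (\<lambda>u. B * norm (?G u))" using G by simp
    show "AE u in lborel. norm ((norm (?G u))\<^sup>2) \<le> norm (B * norm (?G u))"
      using B order_trans[OF norm_ge_zero B]
      by (intro AE_I2) (auto simp: power2_eq_square abs_mult intro!: mult_right_mono)
  qed (use borel_measurable_integrable[OF G] in measurable)
  then show "integrable lborel (J N c)" unfolding J_def .
  show "set_nn_integral lborel {0<..} (\<lambda>x. ennreal ((norm (remainder N c x))\<^sup>2)) = ennreal (\<integral>u. J N c u \<partial>lborel)"
    unfolding J_def by (rule set_nn_integral_exp_substitution[OF remainder_measurable i])
qed

lemma remainder_plancherel:
  fixes N :: nat and c :: "nat \<Rightarrow> complex"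
  defines "T \<equiv> \<lambda>t. (norm (mellin f (critical_point t) * (1 - zeta_reg (critical_point t) / (critical_point t - 1)
       * (\<Sum>i<N. c i * of_nat (Suc i) powr (- critical_point t)))))\<^sup>2"
  shows "integrable lborel T"
    and "set_nn_integral lborel {0<..} (\<lambda>x. ennreal ((norm (remainder N c x))\<^sup>2)) = ennreal ((\<integral>t. T t \<partial>lborel) / (2 * pi))"
proof -
  let ?r = "remainder N c"
  let ?G = "\<lambda>u. exp (of_real u / 2) * ?r (exp u)"
  have re: "0 < Re (critical_point t)" "Re (critical_point t) < 1" for t by (simp_all add: critical_point_def)
  have G: "integrable lborel ?G"
    using remainder_mellin(1)[of "1 / 2" N c] by simp
  have cG: "continuous_on UNIV ?G"
    by (intro continuous_intros continuous_on_compose2[OF remainder_continuous]) auto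
  have FT: "(\<integral>u. ?G u * iexp (t * u) \<partial>lborel) = mellin f (critical_point t) * (1 - zeta_reg (critical_point t) / (critical_point t - 1)
       * (\<Sum>i<N. c i * of_nat (Suc i) powr (- critical_point t)))" for t
    unfolding remainder_mellin(2)[OF re, symmetric] exp_critical_point by (simp only: mult_ac)
  obtain B where B: "\<And>u. norm (?G u) \<le> B" using remainder_bounded[of N c] by blast
  note P = plancherel_continuous[OF G cG B, unfolded FT]
  show "integrable lborel T" unfolding T_def using P(1) .
  show "set_nn_integral lborel {0<..} (\<lambda>x. ennreal ((norm (?r x))\<^sup>2)) = ennreal ((\<integral>t. T t \<partial>lborel) / (2 * pi))"
    unfolding remainder_L2(2) using P(2) by (simp add: T_def)
qed

lemma span_remainder:
  "h \<in> dilate_span (muentz f) \<longleftrightarrow> (\<exists>N c. \<forall>x. f x - h x = remainder N c x)"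
  unfolding dilate_span_def remainder_def by (auto simp: fun_eq_iff)

text \<open>At a zero of $\zeta$ the transform of every approximation error equals that of $f$, while for
  $1/2 < \Re s < 1$ it is controlled by the $L_2$ norm: by the arithmetic-geometric mean inequality
  below $R$, and because the error is $C/x$ above $R$.\<close>

lemma mellin_le_L2:
  assumes s: "1 / 2 < Re s" "Re s < 1" and z: "zeta_reg s = 0"
  obtains K where "K > 0"
    "\<forall>N c \<eta>. \<eta> > 0 \<and> (\<integral>u. (norm (exp (of_real u / 2) * remainder N c (exp u)))\<^sup>2 \<partial>lborel) \<le> \<eta>\<^sup>2 \<longrightarrow> norm (mellin f s) \<le> K * \<eta>"
proof -
  define \<sigma> where "\<sigma> = Re s"
  define \<rho> where "\<rho> = ln R"
  have R0: "exp \<rho> = R" using R by (simp add: \<rho>_def)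
  let ?e1 = "\<lambda>u. indicator {..\<rho>} u * exp ((2 * \<sigma> - 1) * u)"
  let ?e2 = "\<lambda>u. indicator {\<rho>..} u * exp ((\<sigma> - 1) * u)"
  have i1: "integrable lborel ?e1"
    using integrable_exp_Iic[of "2 * \<sigma> - 1" \<rho>] s by (simp add: \<sigma>_def)
  have i2: "integrable lborel ?e2"
    using lborel_integrable_real_affine[OF integrable_exp_Iic[of "1 - \<sigma>" "- \<rho>"], of "-1" 0] s
    by (simp add: \<sigma>_def indicator_def algebra_simps cong: if_cong)
  define K1 where "K1 = (\<integral>u. ?e1 u \<partial>lborel)"
  define K2 where "K2 = sqrt (exp (\<rho> + 1)) * (\<integral>u. ?e2 u \<partial>lborel)"
  have K: "K1 \<ge> 0" "K2 \<ge> 0"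
    unfolding K1_def K2_def by (auto intro!: integral_nonneg_AE mult_nonneg_nonneg simp: indicator_def)
  have main: "norm (mellin f s) \<le> (K1 + 1 + K2) * \<eta>"
    if \<eta>: "\<eta> > 0" and J: "(\<integral>u. (norm (exp (of_real u / 2) * remainder N c (exp u)))\<^sup>2 \<partial>lborel) \<le> \<eta>\<^sup>2" for N c \<eta>
  proof -
    let ?G = "\<lambda>u. exp (of_real u / 2) * remainder N c (exp u)"
    have iJ: "integrable lborel (\<lambda>u. (norm (?G u))\<^sup>2)" by (rule remainder_L2(1))
    \<comment> \<open>The coefficient of the 1/x tail. It depends on the combination, so it has to
      be bounded by the norm of the error.\<close>
    define C0 where "C0 = norm ((\<Sum>i<N. c i / of_nat (Suc i)) * set_lebesgue_integral lborel {0<..} f)"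
    have tail: "norm (remainder N c (exp u)) = C0 * exp (- u)" if "u \<ge> \<rho>" for u
    proof -
      have "exp u \<ge> R" using that R0 by (metis exp_le_cancel_iff)
      then show ?thesis by (subst remainder_tail) (simp_all add: C0_def norm_divide norm_mult exp_minus divide_inverse norm_inverse)
    qed
    have sq: "(norm (?G u))\<^sup>2 = exp u * (norm (remainder N c (exp u)))\<^sup>2" for u
    proof -
      have "(exp (u / 2))\<^sup>2 = exp u" by (simp add: exp_double[symmetric])
      then show ?thesis by (simp add: norm_mult power_mult_distrib)
    qed
    \<comment> \<open>The mass of the tail on one unit interval already forces C0 =
      O(\<eta>).\<close>
    have "(\<integral>u. indicator {\<rho>..\<rho>+1} u * (C0\<^sup>2 * exp (- (\<rho> + 1))) \<partial>lborel) \<le> (\<integral>u. (norm (?G u))\<^sup>2 \<partial>lborel)"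
    proof (rule integral_mono[OF _ iJ])
      show "integrable lborel (\<lambda>u. indicator {\<rho>..\<rho>+1} u * (C0\<^sup>2 * exp (- (\<rho> + 1))))" by simp
      fix u
      show "indicator {\<rho>..\<rho>+1} u * (C0\<^sup>2 * exp (- (\<rho> + 1))) \<le> (norm (?G u))\<^sup>2"
      proof (cases "u \<in> {\<rho>..\<rho>+1}")
        case True
        have "(norm (?G u))\<^sup>2 = C0\<^sup>2 * (exp u * (exp (- u))\<^sup>2)"
          unfolding sq using tail[of u] True by (simp add: power_mult_distrib)
        also have "exp u * (exp (- u))\<^sup>2 = exp (- u)"
          by (simp add: exp_add[symmetric] power2_eq_square)
        also have "C0\<^sup>2 * exp (- u) \<ge> C0\<^sup>2 * exp (- (\<rho> + 1))"
          using True by (intro mult_left_mono) auto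
        finally show ?thesis using True by simp
      qed simp
    qed
    then have "C0\<^sup>2 * exp (- (\<rho> + 1)) \<le> \<eta>\<^sup>2" using J by simp
    then have "C0\<^sup>2 * exp (- (\<rho> + 1)) * exp (\<rho> + 1) \<le> \<eta>\<^sup>2 * exp (\<rho> + 1)"
      by (intro mult_right_mono) auto
    moreover have "exp (- (\<rho> + 1)) * exp (\<rho> + 1) = 1" by (simp add: exp_add[symmetric])
    ultimately have "C0\<^sup>2 \<le> \<eta>\<^sup>2 * exp (\<rho> + 1)" by (simp only: mult.assoc mult_1_right)
    then have "C0\<^sup>2 \<le> (\<eta> * sqrt (exp (\<rho> + 1)))\<^sup>2" by (simp add: power_mult_distrib)
    then have C0: "C0 \<le> \<eta> * sqrt (exp (\<rho> + 1))" by (rule power2_le_imp_le) (use \<eta> in auto)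
    have s01: "0 < Re s" "Re s < 1" using s by auto
    note M = remainder_mellin[OF s01, of N c]
    have "mellin f s = (\<integral>u. exp (s * of_real u) * remainder N c (exp u) \<partial>lborel)"
      unfolding M(2) z by simp
    also have "norm \<dots> \<le> (\<integral>u. norm (exp (s * of_real u) * remainder N c (exp u)) \<partial>lborel)"
      by (rule Bochner_Integration.integral_norm_bound)
    also have "\<dots> \<le> (\<integral>u. \<eta> * ?e1 u + (norm (?G u))\<^sup>2 / \<eta> + C0 * ?e2 u \<partial>lborel)"
    proof (rule integral_mono[OF integrable_norm[OF M(1)]])
      show "integrable lborel (\<lambda>u. \<eta> * ?e1 u + (norm (?G u))\<^sup>2 / \<eta> + C0 * ?e2 u)"
        using i1 i2 iJ by (intro Bochner_Integration.integrable_add) auto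
      fix u
      have n: "norm (exp (s * of_real u) * remainder N c (exp u)) = exp (\<sigma> * u) * norm (remainder N c (exp u))"
        by (simp add: norm_mult \<sigma>_def)
      show "norm (exp (s * of_real u) * remainder N c (exp u)) \<le> \<eta> * ?e1 u + (norm (?G u))\<^sup>2 / \<eta> + C0 * ?e2 u"
      proof (cases "u \<le> \<rho>")
        case True
        define a where "a = exp ((\<sigma> - 1 / 2) * u)"
        define b where "b = norm (?G u)"
        have "exp (\<sigma> * u) * norm (remainder N c (exp u)) = a * b"
          by (simp add: a_def b_def norm_mult exp_add[symmetric] mult.assoc[symmetric] algebra_simps)
        \<comment> \<open>Follows from (\<eta>a - b)^2 + \<eta>ab \<ge> 0. Weighting by \<eta> makes
          both integrals O(\<eta>): that of a^2 converges at minus infinity because \<sigma> > 1/2,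
          and that of b^2 is at most \<eta>^2.\<close>
        also have "\<dots> \<le> \<eta> * a\<^sup>2 + b\<^sup>2 / \<eta>"
        proof -
          have "0 \<le> (\<eta> * a - b)\<^sup>2 + \<eta> * a * b" using \<eta> by (simp add: a_def b_def)
          then have "\<eta> * (a * b) \<le> \<eta> * (\<eta> * a\<^sup>2 + b\<^sup>2 / \<eta>)"
            using \<eta> by (simp add: power2_eq_square algebra_simps)
          then show ?thesis using \<eta> by simp
        qed
        also have "a\<^sup>2 = exp ((2 * \<sigma> - 1) * u)"
          by (simp add: a_def exp_double[symmetric] algebra_simps)
        finally have "exp (\<sigma> * u) * norm (remainder N c (exp u)) \<le> \<eta> * ?e1 u + b\<^sup>2 / \<eta>" using True by simp
        moreover have "0 \<le> C0 * ?e2 u" by (simp add: C0_def)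
        ultimately show ?thesis unfolding n b_def by linarith
      next
        case False
        have "exp (\<sigma> * u) * norm (remainder N c (exp u)) = C0 * (exp (\<sigma> * u) * exp (- u))"
          using tail[of u] False by simp
        also have "exp (\<sigma> * u) * exp (- u) = ?e2 u"
          using False by (simp add: exp_add[symmetric] algebra_simps)
        finally show ?thesis unfolding n using \<eta> by simp
      qed
    qed
    also have "\<dots> = \<eta> * K1 + (\<integral>u. (norm (?G u))\<^sup>2 \<partial>lborel) / \<eta> + C0 * (\<integral>u. ?e2 u \<partial>lborel)"
      unfolding K1_def using i1 i2 iJ
      by (subst Bochner_Integration.integral_add; simp)+
    also have "\<dots> \<le> \<eta> * K1 + \<eta> + (\<eta> * sqrt (exp (\<rho> + 1))) * (\<integral>u. ?e2 u \<partial>lborel)"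
    proof (intro add_mono order_refl mult_right_mono C0)
      show "(\<integral>u. (norm (?G u))\<^sup>2 \<partial>lborel) / \<eta> \<le> \<eta>"
        using J \<eta> by (simp add: divide_le_eq power2_eq_square)
      show "0 \<le> (\<integral>u. ?e2 u \<partial>lborel)" by (intro integral_nonneg_AE) (auto simp: indicator_def)
    qed
    also have "\<dots> = (K1 + 1 + K2) * \<eta>" by (simp add: K2_def algebra_simps)
    finally show ?thesis .
  qed
  show ?thesis
  proof (rule that[of "K1 + 1 + K2"])
    show "K1 + 1 + K2 > 0" using K by simp
  qed (use main in blast)
qed

lemma zeta_reg_nonzero_of_closure:
  assumes clo: "in_L2_closure f (dilate_span (muentz f))" and s: "1 / 2 < Re s" "Re s < 1" and nz: "mellin f s \<noteq> 0"
  shows "zeta_reg s \<noteq> 0"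
proof
  assume "zeta_reg s = 0"
  then obtain K where K: "K > 0" "\<forall>N c \<eta>. \<eta> > 0 \<and> (\<integral>u. (norm (exp (of_real u / 2) * remainder N c (exp u)))\<^sup>2 \<partial>lborel) \<le> \<eta>\<^sup>2 \<longrightarrow> norm (mellin f s) \<le> K * \<eta>"
    using mellin_le_L2[OF s] by blast
  \<comment> \<open>Chosen so that the bound \<open>K * \<eta>\<close> is half of the norm it would
    have to dominate.\<close>
  define \<eta> where "\<eta> = norm (mellin f s) / (2 * K)"
  have \<eta>: "\<eta> > 0" using nz K by (simp add: \<eta>_def)
  then obtain h where h: "h \<in> dilate_span (muentz f)"
    "set_nn_integral lborel {0<..} (\<lambda>x. ennreal ((norm (f x - h x))\<^sup>2)) < ennreal (\<eta>\<^sup>2)"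
    using clo unfolding in_L2_closure_def by (metis zero_less_power)
  obtain N c where Nc: "\<And>x. f x - h x = remainder N c x" using h(1) unfolding span_remainder by blast
  have "ennreal (\<integral>u. (norm (exp (of_real u / 2) * remainder N c (exp u)))\<^sup>2 \<partial>lborel) < ennreal (\<eta>\<^sup>2)"
    using h(2) unfolding Nc remainder_L2(2) .
  then have "(\<integral>u. (norm (exp (of_real u / 2) * remainder N c (exp u)))\<^sup>2 \<partial>lborel) \<le> \<eta>\<^sup>2"
    by (metis ennreal_less_iff ennreal_leI less_imp_le not_le zero_le_power2 ennreal_le_iff)
  then have "norm (mellin f s) \<le> K * \<eta>" using K(2) \<eta> by blast
  then show False using nz K by (simp add: \<eta>_def)
qed

end

section \<open>Approximation when zeta has no zeros right of the critical line\<close>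

context compact_kernel
begin

text \<open>By \<open>mellin_kernel\<close>, s times the transform of f is minus the Fourier
  transform of exp(3u/2) f'(exp u). This function is continuous and integrable, and bounded because
  \<open>f'\<close> vanishes beyond the support, so Plancherel applies.\<close>

lemma weighted_mellin_integrable:
  "integrable lborel (\<lambda>t. (norm (critical_point t * mellin f (critical_point t)))\<^sup>2)"
proof -
  let ?G = "\<lambda>u. exp ((1 / 2 + 1) * of_real u) * f' (exp u)"
  have G: "integrable lborel ?G"
    using integrable_deriv_exp[OF kernel, of "1 / 2"] by simp
  have cG: "continuous_on UNIV ?G"
    by (intro continuous_intros continuous_on_compose2[OF contf']) auto
  have "compact (f' ` {0..R})"
    using contf' by (intro compact_continuous_image) (auto elim: continuous_on_subset)
  then obtain M where M: "\<forall>y\<in>f' ` {0..R}. norm y \<le> M" using compact_imp_bounded bounded_iff by blast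
  have M0: "M \<ge> 0" using M R by (force intro: order_trans[OF norm_ge_zero])
  have B: "norm (?G u) \<le> exp (3 / 2 * ln R) * M" for u
  proof (cases "exp u \<le> R")
    case True
    then have "u \<le> ln R" using R by (simp add: ln_ge_iff)
    then have "norm (exp ((1 / 2 + 1) * complex_of_real u)) \<le> exp (3 / 2 * ln R)" by simp
    moreover have "norm (f' (exp u)) \<le> M" using M True by auto
    ultimately show ?thesis unfolding norm_mult using M0 by (intro mult_mono) auto
  next
    case False
    then show ?thesis using deriv_support[of "exp u"] M0 by simp
  qed
  have FT: "(\<integral>u. ?G u * iexp (t * u) \<partial>lborel) = - (critical_point t * mellin f (critical_point t))" for t
  proof -
    have "critical_point t * mellin f (critical_point t) = - (\<integral>v. exp ((critical_point t + 1) * of_real v) * f' (exp v) \<partial>lborel)"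
      by (rule mellin_kernel(2)[OF kernel]) (simp_all add: critical_point_def)
    moreover have "exp ((critical_point t + 1) * of_real v) * f' (exp v) = ?G v * iexp (t * v)" for v
    proof -
      have "exp ((critical_point t + 1) * of_real v) = exp ((1 / 2 + 1) * of_real v) * iexp (t * v)"
        by (simp add: critical_point_def exp_add[symmetric] algebra_simps)
      then show ?thesis by simp
    qed
    ultimately show ?thesis by simp
  qed
  show ?thesis using plancherel_continuous(1)[OF G cG B] unfolding FT norm_minus_cancel .
qed

lemma measurable_mellin_critical: "(\<lambda>t. mellin f (critical_point t)) \<in> borel_measurable borel"
proof -
  have [measurable]: "(\<lambda>u. f (exp u)) \<in> borel_measurable borel"
    by (intro borel_measurable_continuous_onI continuous_on_compose2[OF continuous_f] continuous_intros) auto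
  have "mellin f (critical_point t) = (\<integral>u. exp (of_real u / 2) * iexp (t * u) * f (exp u) \<partial>lborel)" for t
    unfolding mellin_exp(2)[OF kernel_measurable(1)[OF kernel]] exp_critical_point ..
  then show ?thesis by simp
qed

lemma Re_critical_point: "Re (critical_point t) = 1 / 2"
  by (simp add: critical_point_def)

lemma measurable_zeta_critical:
  assumes "d \<ge> 0"
  shows "(\<lambda>t. zeta_reg (critical_point t + of_real d)) \<in> borel_measurable borel"
  using assms
  by (intro borel_measurable_continuous_onI
       continuous_on_compose2[OF holomorphic_on_imp_continuous_on[OF holomorphic_zeta_reg]])
     (auto simp: critical_point_def intro!: continuous_intros)

text \<open>Zeros on the critical line itself remain possible, and there
  \<zeta>(s)/\<zeta>(s+\<epsilon>) need not tend to 1; being countable, they do not affect the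
  dominated convergence.\<close>

lemma zeta_nonzero_AE: "AE t in lborel. zeta_reg (critical_point t) \<noteq> 0"
proof -
  let ?S = "{s. Re s > 0}"
  have "?S = (\<Union>n::nat. {s. Re s \<ge> 1 / real (Suc n)})"
  proof (intro subset_antisym subsetI)
    fix s assume "s \<in> ?S"
    then obtain n where "1 / real (Suc n) < Re s"
      using reals_Archimedean[of "Re s"] by (auto simp: inverse_eq_divide)
    then show "s \<in> (\<Union>n::nat. {s. Re s \<ge> 1 / real (Suc n)})" by (intro UN_I[of n]) auto
  next
    fix s :: complex assume "s \<in> (\<Union>n::nat. {s. Re s \<ge> 1 / real (Suc n)})"
    then obtain n where "1 / real (Suc n) \<le> Re s" by auto
    then show "s \<in> ?S" using less_le_trans[of 0 "1 / real (Suc n)" "Re s"] by simp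
  qed
  then have "fsigma ?S"
    using fsigma.intros[of "\<lambda>n. {s. Re s \<ge> 1 / real (Suc n)}"] closed_halfspace_Re_ge by simp
  then have "countable {s \<in> ?S. zeta_reg s = 0}"
    by (intro holomorphic_countable_zeros[OF holomorphic_zeta_reg] zeta_reg_nonconstant)
       (auto simp: open_halfspace_Re_gt convex_halfspace_Re_gt convex_connected)
  then have "countable (Im ` {s \<in> ?S. zeta_reg s = 0})" by (rule countable_image)
  moreover have "t \<in> Im ` {s \<in> ?S. zeta_reg s = 0}" if "zeta_reg (critical_point t) = 0" for t
    using that by (intro image_eqI[of _ _ "critical_point t"]) (auto simp: critical_point_def)
  ultimately show ?thesis
    by (intro AE_I'[OF countable_imp_null_set_lborel]) auto
qed

text \<open>The error splits as 1 - \<zeta>P = (1 - \<zeta>D) + \<zeta>(D - P), where D(s) =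
  1/\<zeta>(s+\<epsilon>). The first part is small in the weighted space for a suitable \<epsilon>,
  by dominated convergence. With \<epsilon> fixed, the second is at most |s|^(3/4) |s|^(1/4) = |s|
  times a small constant.\<close>

theorem closure_of_zeta_reg_nonzero:
  assumes RH: "\<And>s. Re s > 1 / 2 \<Longrightarrow> zeta_reg s \<noteq> 0"
  shows "in_L2_closure f (dilate_span (muentz f))"
  unfolding in_L2_closure_def
proof (intro allI impI)
  fix e :: real assume e: "e > 0"
  let ?s = critical_point
  define F where "F = (\<lambda>t. mellin f (?s t))"
  define Z where "Z = (\<lambda>t. zeta_reg (?s t) / (?s t - 1))"
  define D where "D = (\<lambda>\<epsilon> t. (?s t + of_real \<epsilon> - 1) / zeta_reg (?s t + of_real \<epsilon>))"
  define W where "W = (\<lambda>t. (norm (?s t * F t))\<^sup>2)"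
  have W: "integrable lborel W" unfolding W_def F_def by (rule weighted_mellin_integrable)
  have ns: "norm (?s t) \<ge> 1 / 2" for t using abs_Re_le_cmod[of "?s t"] Re_critical_point[of t] by simp
  have s1: "?s t - 1 \<noteq> 0" for t by (auto simp: critical_point_def complex_eq_iff)
  obtain C where C: "C > 0" "\<And>\<epsilon> s. \<lbrakk>0 < \<epsilon>; \<epsilon> \<le> 1 / 2; Re s = 1 / 2\<rbrakk>
       \<Longrightarrow> norm (zeta_reg s / (s - 1) * ((s + of_real \<epsilon> - 1) / zeta_reg (s + of_real \<epsilon>))) \<le> C * norm s"
    using zeta_quotient_bound[OF RH] by metis
  obtain C0 where C0: "C0 > 0" "\<And>s. Re s = 1 / 2 \<Longrightarrow> norm (zeta_reg s / (s - 1)) \<le> C0 * norm s powr (3 / 4)"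
    using zeta_critical_line_bound by metis
  have [measurable]: "F \<in> borel_measurable borel" unfolding F_def by (rule measurable_mellin_critical)
  have [measurable]: "?s \<in> borel_measurable borel"
    unfolding critical_point_def by (intro borel_measurable_continuous_onI continuous_intros)
  have [measurable]: "Z \<in> borel_measurable borel"
    using measurable_zeta_critical[of 0] unfolding Z_def by simp
  have mD: "D \<epsilon> \<in> borel_measurable borel" if "\<epsilon> \<ge> 0" for \<epsilon>
    using measurable_zeta_critical[OF that] unfolding D_def by simp
  \<comment> \<open>Starts at 1/2, the largest \<epsilon> that the uniform bound admits.\<close>
  define d where "d = (\<lambda>k. 1 / real (k + 2))"
  have d: "0 < d k" "d k \<le> 1 / 2" for k by (auto simp: d_def field_simps)
  have d0: "d \<longlonglongrightarrow> 0" unfolding d_def by real_asymp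
  define E where "E = (\<lambda>k t. (norm (F t * (1 - Z t * D (d k) t)))\<^sup>2)"
  have mE: "E k \<in> borel_measurable borel" for k
    unfolding E_def using mD[OF less_imp_le[OF d(1)[of k]]] by measurable
  have E_le: "E k t \<le> (2 + C)\<^sup>2 * W t" for k t
  proof -
    have "norm (1 - Z t * D (d k) t) \<le> 1 + C * norm (?s t)"
      using norm_triangle_ineq4[of 1 "Z t * D (d k) t"] C(2)[OF d(1)[of k] d(2)[of k] Re_critical_point[of t]]
      by (simp add: Z_def D_def)
    \<comment> \<open>1 \<le> 2 |s| on the critical line.\<close>
    also have "\<dots> \<le> (2 + C) * norm (?s t)" using ns[of t] by (simp add: algebra_simps)
    finally have "norm (F t) * norm (1 - Z t * D (d k) t) \<le> norm (F t) * ((2 + C) * norm (?s t))"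
      by (intro mult_left_mono) auto
    then have "(norm (F t) * norm (1 - Z t * D (d k) t))\<^sup>2 \<le> (norm (F t) * ((2 + C) * norm (?s t)))\<^sup>2"
      by (intro power_mono) auto
    then show ?thesis by (simp add: E_def W_def norm_mult power_mult_distrib mult_ac)
  qed
  have dom: "integrable lborel (\<lambda>t. (2 + C)\<^sup>2 * W t)" using W by simp
  have E0: "norm (E k t) = E k t" for k t by (simp add: E_def)
  have iE: "integrable lborel (E k)" for k
    by (rule Bochner_Integration.integrable_bound[OF dom])
       (use mE in \<open>auto intro!: AE_I2 order_trans[OF _ abs_ge_self] simp: E0[unfolded real_norm_def] E_le\<close>)
  have "(\<lambda>k. \<integral>t. E k t \<partial>lborel) \<longlonglongrightarrow> (\<integral>t. 0 \<partial>(lborel :: real measure))"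
  proof (rule integral_dominated_convergence[OF _ _ dom])
    show "AE t in lborel. (\<lambda>k. E k t) \<longlonglongrightarrow> 0"
      using zeta_nonzero_AE
    proof eventually_elim
      case (elim t)
      have "isCont zeta_reg (?s t)"
        using holomorphic_on_imp_continuous_on[OF holomorphic_zeta_reg]
        by (simp add: continuous_on_eq_continuous_at open_halfspace_Re_gt critical_point_def)
      moreover have sd: "(\<lambda>k. ?s t + of_real (d k)) \<longlonglongrightarrow> ?s t + of_real 0"
        by (intro tendsto_intros d0)
      ultimately have z: "(\<lambda>k. zeta_reg (?s t + of_real (d k))) \<longlonglongrightarrow> zeta_reg (?s t)"
        by (intro isCont_tendsto_compose[of _ zeta_reg]) simp_all
      have "(\<lambda>k. E k t) \<longlonglongrightarrow> (norm (F t * (1 - Z t * ((?s t + of_real 0 - 1) / zeta_reg (?s t)))))\<^sup>2"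
        unfolding E_def D_def by (intro tendsto_intros z sd d0 elim)
      also have "Z t * ((?s t + of_real 0 - 1) / zeta_reg (?s t)) = 1"
        using elim s1[of t] by (simp add: Z_def)
      finally show ?case by simp
    qed
    show "AE t in lborel. norm (E k t) \<le> (2 + C)\<^sup>2 * W t" for k
      unfolding E0 using E_le by simp
  qed (use mE in auto)
  then have "(\<lambda>k. \<integral>t. E k t \<partial>lborel) \<longlonglongrightarrow> 0" by simp
  then have "eventually (\<lambda>k. (\<integral>t. E k t \<partial>lborel) < e) sequentially"
    using e by (rule order_tendstoD(2))
  then obtain k where k: "(\<integral>t. E k t \<partial>lborel) < e" using eventually_happens by fastforce
  define w where "w = (\<integral>t. W t \<partial>lborel)"
  have w: "w \<ge> 0" unfolding w_def W_def by simp
  \<comment> \<open>Solves (C0 \<kappa>)^2 (1 + w) = e; the 1 guards against w = 0.\<close>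
  define \<kappa> where "\<kappa> = sqrt (e / (C0\<^sup>2 * (1 + w)))"
  have \<kappa>: "\<kappa> > 0" using e C0(1) w by (simp add: \<kappa>_def)
  have \<kappa>2: "(C0 * \<kappa>)\<^sup>2 * w \<le> e"
  proof -
    have "(C0 * \<kappa>)\<^sup>2 = e / (1 + w)" using e C0(1) w by (simp add: \<kappa>_def power_mult_distrib)
    then have "(C0 * \<kappa>)\<^sup>2 * (1 + w) = e" using w by simp
    moreover have "(C0 * \<kappa>)\<^sup>2 * w \<le> (C0 * \<kappa>)\<^sup>2 * (1 + w)" by (intro mult_left_mono) auto
    ultimately show ?thesis by (simp only:)
  qed
  obtain P where P: "dirichlet_poly P"
    "\<And>s. Re s = 1 / 2 \<Longrightarrow> norm ((s + of_real (d k) - 1) / zeta_reg (s + of_real (d k)) - P s) \<le> \<kappa> * norm s powr (1 / 4)"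
    using reciprocal_zeta_shift_approx[OF RH d(1,2) \<kappa>, of k] by metis
  obtain N c where Nc: "P = (\<lambda>s. \<Sum>i<N. c i * of_nat (Suc i) powr (- s))"
    using P(1) unfolding dirichlet_poly_def by blast
  define T where "T = (\<lambda>t. (norm (F t * (1 - Z t * P (?s t))))\<^sup>2)"
  have rp: "integrable lborel T"
    "set_nn_integral lborel {0<..} (\<lambda>x. ennreal ((norm (remainder N c x))\<^sup>2)) = ennreal ((\<integral>t. T t \<partial>lborel) / (2 * pi))"
    using remainder_plancherel[where N = N and c = c] unfolding T_def F_def Z_def Nc by simp_all
  have T_le: "T t \<le> 2 * E k t + 2 * (C0 * \<kappa>)\<^sup>2 * W t" for t
  proof -
    define a where "a = F t * (1 - Z t * D (d k) t)"
    define b where "b = F t * (Z t * (D (d k) t - P (?s t)))"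
    have "F t * (1 - Z t * P (?s t)) = a + b" by (simp add: a_def b_def algebra_simps)
    then have "T t = (norm (a + b))\<^sup>2" by (simp add: T_def)
    also have "\<dots> \<le> (norm a + norm b)\<^sup>2" by (intro power_mono norm_triangle_ineq) auto
    also have "\<dots> \<le> 2 * (norm a)\<^sup>2 + 2 * (norm b)\<^sup>2"
      using zero_le_power2[of "norm a - norm b"] by (simp add: power2_eq_square algebra_simps)
    also have "(norm b)\<^sup>2 \<le> (C0 * \<kappa>)\<^sup>2 * W t"
    proof -
      have "norm (Z t) * norm (D (d k) t - P (?s t)) \<le> (C0 * norm (?s t) powr (3 / 4)) * (\<kappa> * norm (?s t) powr (1 / 4))"
        unfolding Z_def D_def using C0 \<kappa>
        by (intro mult_mono C0(2) P(2) Re_critical_point) auto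
      also have "\<dots> = (C0 * \<kappa>) * (norm (?s t) powr (3 / 4) * norm (?s t) powr (1 / 4))" by simp
      also have "norm (?s t) powr (3 / 4) * norm (?s t) powr (1 / 4) = norm (?s t)"
        using ns[of t] by (simp add: powr_add[symmetric])
      finally have "norm b \<le> norm (F t) * ((C0 * \<kappa>) * norm (?s t))"
        unfolding b_def norm_mult by (intro mult_left_mono) (auto simp: norm_mult)
      then have "(norm b)\<^sup>2 \<le> (norm (F t) * ((C0 * \<kappa>) * norm (?s t)))\<^sup>2" by (intro power_mono) auto
      then show ?thesis by (simp add: W_def norm_mult power_mult_distrib mult_ac)
    qed
    finally show ?thesis by (simp add: E_def a_def)
  qed
  have "(\<integral>t. T t \<partial>lborel) \<le> (\<integral>t. 2 * E k t + 2 * (C0 * \<kappa>)\<^sup>2 * W t \<partial>lborel)"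
    using T_le by (intro integral_mono rp) (use iE W in auto)
  also have "\<dots> = 2 * (\<integral>t. E k t \<partial>lborel) + 2 * ((C0 * \<kappa>)\<^sup>2 * w)"
    using iE[of k] W by (subst Bochner_Integration.integral_add) (simp_all add: w_def)
  also have "\<dots> < 2 * e + 2 * e" using k \<kappa>2 by linarith
  \<comment> \<open>The 2 pi of Plancherel absorbs the total 4 e, since pi > 2.\<close>
  also have "\<dots> \<le> (2 * pi) * e" using pi_gt3 e mult_right_mono[of 2 pi "2 * e"] by simp
  finally have "(\<integral>t. T t \<partial>lborel) / (2 * pi) < e" by (simp add: divide_less_eq mult.commute)
  then have less: "ennreal ((\<integral>t. T t \<partial>lborel) / (2 * pi)) < ennreal e"
    using e by (simp add: ennreal_lessI)
  show "\<exists>h\<in>dilate_span (muentz f). set_nn_integral lborel {0<..} (\<lambda>x. ennreal ((norm (f x - h x))\<^sup>2)) < ennreal e"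
  proof (intro bexI[of _ "\<lambda>x. \<Sum>i<N. c i * muentz f (real (Suc i) * x)"])
    show "(\<lambda>x. \<Sum>i<N. c i * muentz f (real (Suc i) * x)) \<in> dilate_span (muentz f)"
      unfolding dilate_span_def by blast
    show "set_nn_integral lborel {0<..} (\<lambda>x. ennreal ((norm (f x - (\<Sum>i<N. c i * muentz f (real (Suc i) * x))))\<^sup>2)) < ennreal e"
      using less rp(2) unfolding remainder_def by simp
  qed
qed

end

text \<open>A zero of \<open>zeta_reg\<close> is one of \<open>xi\<close>, and at the reflected
  point the linear and Gamma factors of \<open>xi\<close> do not vanish.\<close>

lemma zeta_reg_nonzero_reflect:
  assumes "0 < Re s" "Re s < 1" "zeta_reg s = 0"
  shows "zeta_reg (1 - s) = 0"
proof -
  have "xi (1 - s) = 0"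
    using xi_functional_equation[OF assms(1,2)] assms(3) by (simp add: xi_def)
  moreover have "Gamma ((1 - s) / 2) \<noteq> 0"
    using assms by (intro Gamma_nonzero Re_pos_notin_nonpos_Ints) simp
  moreover have "1 - s \<noteq> 0" using assms by auto
  ultimately show ?thesis by (auto simp: xi_def)
qed

theorem mainTheorem3:
  fixes f :: "real \<Rightarrow> complex"
  assumes "good_kernel f"
    and "\<exists>R. \<forall>x\<ge>R. f x = 0"
    and "\<forall>s. 1/2 < Re s \<and> Re s < 1 \<longrightarrow> mellin f s \<noteq> 0"
  shows "riemann_hypothesis \<longleftrightarrow> in_L2_closure f (dilate_span (muentz f))"
proof -
  obtain f' where f': "\<forall>x\<ge>0. (f has_vector_derivative f' x) (at x within {0..})" "continuous_on {0..} f'"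
    "(f \<longlongrightarrow> 0) at_top" "set_nn_integral lborel {0<..} (\<lambda>t. ennreal (t * norm (f' t))) < \<infinity>"
    using assms(1) unfolding good_kernel_def by blast
  obtain R where R: "\<forall>x\<ge>R. f x = 0" using assms(2) by blast
  \<comment> \<open>The support radius is enlarged to at least 1, as the locale requires.\<close>
  interpret compact_kernel f f' "max 1 R"
    by unfold_locales (use f' R in auto)
  have zero: "riemann_zeta s = 0 \<longleftrightarrow> zeta_reg s = 0" if "0 < Re s" "Re s < 1" for s
    using riemann_zeta_eq[OF that] that by auto
  show ?thesis
  proof
    assume rh: "riemann_hypothesis"
    have "zeta_reg s \<noteq> 0" if s: "Re s > 1 / 2" for s
    \<comment> \<open>The hypothesis speaks only of the open strip; from Re s = 1 on, nonvanishing
      is unconditional.\<close>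
    proof (cases "Re s \<ge> 1")
      case True
      then show ?thesis by (rule zeta_reg_nonzero)
    next
      case False
      then show ?thesis using rh s zero[of s] unfolding riemann_hypothesis_def by force
    qed
    then show "in_L2_closure f (dilate_span (muentz f))" by (rule closure_of_zeta_reg_nonzero)
  next
    assume clo: "in_L2_closure f (dilate_span (muentz f))"
    have nz: "zeta_reg s \<noteq> 0" if "1 / 2 < Re s" "Re s < 1" for s
      using zeta_reg_nonzero_of_closure[OF clo that] assms(3) that by blast
    show riemann_hypothesis
      unfolding riemann_hypothesis_def
    proof (intro allI impI)
      fix s assume s: "0 < Re s \<and> Re s < 1 \<and> riemann_zeta s = 0"
      then have z: "zeta_reg s = 0" using zero by blast
      then have "zeta_reg (1 - s) = 0" using zeta_reg_nonzero_reflect s by blast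
      then have "\<not> Re (1 - s) > 1 / 2" using nz[of "1 - s"] s by force
      moreover have "\<not> Re s > 1 / 2" using nz[of s] z s by blast
      ultimately show "Re s = 1 / 2" by simp
    qed
  qed
qed

end
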